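(* For $\Lambda>0$ let $E_\Lambda$ be the span of all Dirichlet eigenfunctions of $-\Delta$ on the Sierpiński gasket $\mathrm{SG}$ with eigenvalue $\lambda\le\Lambda$, let $d_\Lambda=\dim E_\Lambda$, and let $P_\Lambda$ be the orthogonal projection of $L^2(\mathrm{SG},\mu)$ onto $E_\Lambda$. Let $f>0$ be continuous on $\mathrm{SG}$, let $[f]$ be the operator of multiplication by $f$, and let $\sigma_1^{(\Lambda)},\dots,\sigma_{d_\Lambda}^{(\Lambda)}$ be the eigenvalues, counted with multiplicity, of $M_\Lambda=P_\Lambda[f]P_\Lambda$ as an operator on $E_\Lambda$. Let $F$ be continuous on $[0,\infty)$. Then $$\lim_{\Lambda\to\infty}\frac1{d_\Lambda}\sum_{k=1}^{d_\Lambda}F(\sigma_k^{(\Lambda)})=\int_{\mathrm{SG}}F(f(x))\,d\mu(x).$$ Moreover, there are points $\{s_k^{(\Lambda)}\}_{k=1}^{d_\Lambda}$ in $\mathrm{SG}$ such that $\{\sigma_k^{(\Lambda)}\}$ and $\{f(s_k^{(\Lambda)})\}$ are "almost" equally distributed in $[0,\|f\|_{L^\infty}]$ as $\Lambda\to\infty$.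
   Context: Sierpiński gasket: let $F_1(x)=\frac12x$, $F_2(x)=\frac12x+(\frac12,0)$, $F_3(x)=\frac12x+(\frac14,\frac{\sqrt3}{4})$ on $\mathbb{R}^2$; $\mathrm{SG}$ is the unique nonempty compact set with $\mathrm{SG}=\bigcup_{i=1}^3F_i(\mathrm{SG})$. For a word $\omega=(\omega_1,\dots,\omega_m)$ in $\{1,2,3\}$, $F_\omega=F_{\omega_1}\circ\cdots\circ F_{\omega_m}$, and $F_\omega(\mathrm{SG})$ is called an $m$-cell. $\mu$ is the probability measure on $\mathrm{SG}$ giving each $m$-cell measure $3^{-m}$. $V_0=\{(0,0),(1,0),(\frac12,\frac{\sqrt3}{2})\}$ is the boundary, $V_m=\bigcup_{i=1}^3F_iV_{m-1}$; for distinct $x,y\in V_m$ write $x\sim_m y$ if $x,y$ lie in a common $m$-cell. Laplacian: $\Delta_mu(x)=\sum_{y\sim_mx}u(y)-4u(x)$ for $x\in V_m\setminus V_0$, and $\Delta u=\frac32\lim_{m\to\infty}5^m\Delta_mu$ (a continuous $u$ is in the domain with $\Delta u=g$, $g$ continuous, if the convergence to $g$ is uniform on $\bigcup_mV_m\setminus V_0$). A Dirichlet eigenfunction with eigenvalue $\lambda$ is a nonzero $u$ in the domain of $\Delta$ with $-\Delta u=\lambda u$ and $u|_{V_0}=0$. The Dirichlet spectrum is discrete, so $E_\Lambda$ is finite-dimensional. "Almost" equally distributed: for finite families $\{a_k^{(\Lambda)}\}_{k=1}^{d_\Lambda}$, $\{b_k^{(\Lambda)}\}_{k=1}^{d_\Lambda}$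 of numbers in an interval $I$, this means that for every continuous function $G$ on $I$, $\lim_{\Lambda\to\infty}\frac1{d_\Lambda}\sum_{k=1}^{d_\Lambda}[G(a_k^{(\Lambda)})-G(b_k^{(\Lambda)})]=0$ ("almost" refers to the number of terms running only through the values $d_\Lambda$ rather than all positive integers). *)

theory Defs
  imports "HOL-Probability.Probability" "HOL-Library.Function_Algebras"
begin

instantiation "fun" :: (type, real_vector) real_vector
begin

definition scaleR_fun :: "real \<Rightarrow> ('a \<Rightarrow> 'b) \<Rightarrow> 'a \<Rightarrow> 'b" where
  "scaleR_fun c u = (\<lambda>x. c *\<^sub>R u x)"

instance
  by standard (auto simp: scaleR_fun_def plus_fun_def algebra_simps)

end

definition sg_map :: "nat \<Rightarrow> real ^ 2 \<Rightarrow> real ^ 2" where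
  "sg_map i x =
     (if i = 1 then (1/2) *\<^sub>R x
      else if i = 2 then (1/2) *\<^sub>R x + vector [1/2, 0]
      else (1/2) *\<^sub>R x + vector [1/4, sqrt 3 / 4])"

definition sg :: "(real ^ 2) set" where
  "sg = (THE K. compact K \<and> K \<noteq> {} \<and> K = (\<Union>i\<in>{1,2,3}. sg_map i ` K))"

definition sg_word_map :: "nat list \<Rightarrow> real ^ 2 \<Rightarrow> real ^ 2" where
  "sg_word_map w = foldr (\<lambda>i g. sg_map i \<circ> g) w id"

definition sg_cells :: "nat \<Rightarrow> (real ^ 2) set set" where
  "sg_cells m = {sg_word_map w ` sg | w. length w = m \<and> set w \<subseteq> {1,2,3}}"

text \<open>A measure on the Borel subsets of \<open>sg\<close>; its underlying space is \<open>sg\<close>, not the plane.\<close>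

definition sg_measure :: "(real ^ 2) measure" where
  "sg_measure = (THE M. sets M = sets (restrict_space borel sg) \<and> prob_space M \<and>
                        (\<forall>m. \<forall>C\<in>sg_cells m. measure M C = 1 / 3 ^ m))"

primrec sg_vertices :: "nat \<Rightarrow> (real ^ 2) set" where
  "sg_vertices 0 = {vector [0, 0], vector [1, 0], vector [1/2, sqrt 3 / 2]}"
| "sg_vertices (Suc m) = (\<Union>i\<in>{1,2,3}. sg_map i ` sg_vertices m)"

definition sg_adj :: "nat \<Rightarrow> real ^ 2 \<Rightarrow> real ^ 2 \<Rightarrow> bool" where
  "sg_adj m x y \<longleftrightarrow> x \<in> sg_vertices m \<and> y \<in> sg_vertices m \<and> x \<noteq> y \<and>
                   (\<exists>C\<in>sg_cells m. x \<in> C \<and> y \<in> C)"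

definition graph_laplacian :: "nat \<Rightarrow> (real ^ 2 \<Rightarrow> real) \<Rightarrow> real ^ 2 \<Rightarrow> real" where
  "graph_laplacian m u x = (\<Sum>y | sg_adj m x y. u y) - 4 * u x"

text \<open>
  \<open>has_laplacian u g\<close> says that \<open>u\<close> lies in the domain of the Laplacian and that \<open>\<Delta>u = g\<close> on
  \<open>sg\<close>.  The \<open>m\<close>-th graph Laplacian lives on the non-boundary vertices of level \<open>m\<close> only, so
  uniform convergence on all non-boundary vertices means an error bound at each
  large level \<open>m\<close> that is uniform over the vertices of that level.
\<close>

definition has_laplacian :: "(real ^ 2 \<Rightarrow> real) \<Rightarrow> (real ^ 2 \<Rightarrow> real) \<Rightarrow> bool" where
  "has_laplacian u g \<longleftrightarrow> continuous_on sg u \<and> continuous_on sg g \<and>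
     (\<forall>e>0. \<exists>N. \<forall>m\<ge>N. \<forall>x\<in>sg_vertices m - sg_vertices 0.
        \<bar>3/2 * 5 ^ m * graph_laplacian m u x - g x\<bar> < e)"

text \<open>
  A function on \<open>sg\<close> is represented by its extension by zero to the plane; without this
  normalisation the eigenspaces below would have infinite dimension.
\<close>

definition dirichlet_eigenfunction :: "real \<Rightarrow> (real ^ 2 \<Rightarrow> real) \<Rightarrow> bool" where
  "dirichlet_eigenfunction l u \<longleftrightarrow> (\<forall>x. x \<notin> sg \<longrightarrow> u x = 0) \<and> u \<noteq> 0 \<and>
     (\<exists>g. has_laplacian u g \<and> (\<forall>x\<in>sg. - g x = l * u x)) \<and> (\<forall>x\<in>sg_vertices 0. u x = 0)"

definition dirichlet_space :: "real \<Rightarrow> (real ^ 2 \<Rightarrow> real) set" where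
  "dirichlet_space L = span {u. \<exists>l\<le>L. dirichlet_eigenfunction l u}"

text \<open>
  Meant for a square-integrable \<open>g\<close> and a finite-dimensional space \<open>E\<close> of square-integrable
  functions no nonzero one of which vanishes almost everywhere.  Continuous functions on \<open>sg\<close>
  have the latter property because \<open>sg_measure\<close> has full support.
\<close>

definition orth_proj :: "'a measure \<Rightarrow> ('a \<Rightarrow> real) set \<Rightarrow> ('a \<Rightarrow> real) \<Rightarrow> ('a \<Rightarrow> real)" where
  "orth_proj M E g = (THE h. h \<in> E \<and> (\<forall>v\<in>E. (LINT x|M. (g x - h x) * v x) = 0))"

definition dirichlet_proj :: "real \<Rightarrow> (real ^ 2 \<Rightarrow> real) \<Rightarrow> (real ^ 2 \<Rightarrow> real)" where
  "dirichlet_proj L = orth_proj sg_measure (dirichlet_space L)"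

definition compressed_mult ::
    "(real ^ 2 \<Rightarrow> real) \<Rightarrow> real \<Rightarrow> (real ^ 2 \<Rightarrow> real) \<Rightarrow> (real ^ 2 \<Rightarrow> real)" where
  "compressed_mult f L u = dirichlet_proj L (\<lambda>x. f x * dirichlet_proj L u x)"

text \<open>
  For a diagonalisable (for instance, self-adjoint) operator \<open>T\<close> on the finite-dimensional
  space \<open>E\<close>: \<open>s 1, \<dots>, s (dim E)\<close> lists the eigenvalues of \<open>T\<close>, each as often as the
  dimension of its eigenspace.
\<close>

definition eigenvalues_with_multiplicity ::
    "('v::real_vector \<Rightarrow> 'v) \<Rightarrow> 'v set \<Rightarrow> (nat \<Rightarrow> real) \<Rightarrow> bool" where
  "eigenvalues_with_multiplicity T E s \<longleftrightarrow>
     (\<forall>c. card {k\<in>{1..dim E}. s k = c} = dim {u\<in>E. T u = c *\<^sub>R u})"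

definition Linf_norm :: "'a measure \<Rightarrow> ('a \<Rightarrow> real) \<Rightarrow> real" where
  "Linf_norm M f = real_of_ereal (esssup M (\<lambda>x. ereal \<bar>f x\<bar>))"

definition almost_equally_distributed ::
    "real set \<Rightarrow> (real \<Rightarrow> nat) \<Rightarrow> (real \<Rightarrow> nat \<Rightarrow> real) \<Rightarrow> (real \<Rightarrow> nat \<Rightarrow> real) \<Rightarrow> bool" where
  "almost_equally_distributed I d a b \<longleftrightarrow>
     (\<forall>L>0. \<forall>k\<in>{1..d L}. a L k \<in> I \<and> b L k \<in> I) \<and>
     (\<forall>G. continuous_on I G \<longrightarrow>
        ((\<lambda>L. 1 / real (d L) * (\<Sum>k=1..d L. G (a L k) - G (b L k))) \<longlongrightarrow> (0::real)) at_top)"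

end

theory Submission
  imports Defs
begin

text \<open>
Continuous functions on the gasket with the inner product of \<open>L\<^sup>2(\<mu>)\<close> form a pre-Hilbert
space, on which the Dirichlet eigenfunctions with eigenvalue \<open>\<lambda>\<close> are the solutions of
\<open>\<lambda> G u = u\<close> for the Green operator \<open>G\<close>, a compact, symmetric, positive operator.
Self-similarity says that \<open>G\<close> is a rank three operator plus the operator acting as \<open>G/5\<close> on
each of the three \<open>1\<close>-cells. Iterating, the operator \<open>G\<^sub>N \<le> G\<close> that acts on each \<open>N\<close>-cell as
\<open>G/5\<^sup>N\<close> differs from \<open>G\<close> by an operator of rank at most \<open>3\<^sup>N\<^sup>+\<^sup>1/2\<close>, and its
eigenfunctions can be chosen to live on single \<open>N\<close>-cells, where \<open>f\<close> is nearly constant.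

Let \<open>P\<close> and \<open>Q\<close> be the spectral projections of \<open>G\<close> and \<open>G\<^sub>N\<close> for eigenvalues at least
\<open>1/\<Lambda>\<close>. The key estimate is \<open>tr P (1 - Q) = o(d)\<close>. Comparing the forms of the inverses
handles the eigenfunctions of eigenvalue at most \<open>(1 - \<epsilon>) \<Lambda>\<close>. Those in the remaining window below
\<open>\<Lambda>\<close> belong, up to a small proportion, to one single eigenvalue of high multiplicity, as is seen by
rescaling the window to a fixed scale; the eigenspace of that eigenvalue meets the kernel of
\<open>G - G\<^sub>N\<close> in small codimension, and there \<open>G\<close> and \<open>G\<^sub>N\<close> agree.

Given this, the squared inner products of the eigenvectors \<open>a\<close> of \<open>P [f] P\<close> with the localised
eigenfunctions \<open>q\<close> are nearly doubly stochastic weights, concentrated where the eigenvalue at \<open>a\<close>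
is close to the value of \<open>f\<close> on the cell of \<open>q\<close>. Hence the two families of values have the same
limit distribution, and the cells are equidistributed with respect to \<open>\<mu>\<close>. All eigenvalues
lie between the extreme values of \<open>f\<close>, so they are values of \<open>f\<close> because the gasket is connected.
\<close>

section \<open>Orthonormal sets and spectral families\<close>

lemma kernel_meets_span:
  fixes B :: "'a::real_vector set" and C :: "('a \<Rightarrow> real) set"
  assumes "independent B" "finite C" "\<And>c. c \<in> C \<Longrightarrow> linear c" "card C < card B"
  shows "\<exists>u\<in>span B. u \<noteq> 0 \<and> (\<forall>c\<in>C. c u = 0)"
proof (rule ccontr)
  assume neg: "\<not> ?thesis"
  define \<Phi> :: "'a \<Rightarrow> ('a \<Rightarrow> real) \<Rightarrow> real" where "\<Phi> = (\<lambda>u c. if c \<in> C then c u else 0)"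
  define e :: "('a \<Rightarrow> real) \<Rightarrow> ('a \<Rightarrow> real) \<Rightarrow> real" where "e = (\<lambda>c c'. if c' = c then 1 else 0)"
  have lin: "linear \<Phi>"
    by (rule linearI)
       (auto simp: \<Phi>_def fun_eq_iff scaleR_fun_def linear_add[OF assms(3)] linear_scale[OF assms(3)])
  have inj: "inj_on \<Phi> (span B)"
    unfolding linear_inj_on_iff_eq_0[OF lin subspace_span]
  proof (intro ballI impI)
    fix u assume u: "u \<in> span B" "\<Phi> u = 0"
    have "c u = 0" if "c \<in> C" for c using fun_cong[OF u(2), of c] that by (simp add: \<Phi>_def)
    then show "u = 0" using neg u(1) by blast
  qed
  have fs: "(\<Sum>a\<in>A. g a) c = (\<Sum>a\<in>A. g a c)" if "finite A"
    for A :: "('a \<Rightarrow> real) set" and g :: "('a \<Rightarrow> real) \<Rightarrow> ('a \<Rightarrow> real) \<Rightarrow> real" and c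
    using that by (induction A rule: finite_induct) auto
  have "\<Phi> u \<in> span (e ` C)" for u
  proof -
    have "\<Phi> u = (\<Sum>c\<in>C. c u *\<^sub>R e c)"
    proof
      fix c
      show "\<Phi> u c = (\<Sum>c\<in>C. c u *\<^sub>R e c) c"
        unfolding fs[OF assms(2)]
        by (simp add: scaleR_fun_def \<Phi>_def e_def assms(2) if_distrib[of "\<lambda>x. _ * x"] sum.delta cong: if_cong)
    qed
    then show ?thesis by (auto intro: span_sum span_scale span_base)
  qed
  then have sub: "\<Phi> ` B \<subseteq> span (e ` C)" by auto
  have "independent (\<Phi> ` B)"
    using linear_independent_injective_image[OF lin assms(1) inj] .
  from independent_span_bound[OF _ this sub] assms(2)
  have "card (\<Phi> ` B) \<le> card (e ` C)" by simp
  also have "\<dots> \<le> card C" using assms(2) by (rule card_image_le)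
  also have "card (\<Phi> ` B) = card B"
    using inj by (metis card_image inj_on_subset span_superset)
  finally show False using assms(4) by simp
qed

definition orthonormal :: "'a::real_inner set \<Rightarrow> bool" where
  "orthonormal B \<longleftrightarrow> finite B \<and> (\<forall>a\<in>B. \<forall>b\<in>B. inner a b = (if a = b then 1 else 0))"

definition proj_on :: "'a::real_inner set \<Rightarrow> 'a \<Rightarrow> 'a" where
  "proj_on B u = (\<Sum>b\<in>B. inner u b *\<^sub>R b)"

lemma orthonormalD:
  assumes "orthonormal B"
  shows "finite B" "\<And>b. b \<in> B \<Longrightarrow> inner b b = 1"
    "\<And>a b. a \<in> B \<Longrightarrow> b \<in> B \<Longrightarrow> a \<noteq> b \<Longrightarrow> inner a b = 0"
  using assms by (auto simp: orthonormal_def)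

lemma orthonormal_subset: "orthonormal B \<Longrightarrow> A \<subseteq> B \<Longrightarrow> orthonormal A"
  unfolding orthonormal_def by (meson finite_subset subsetD)

lemma orthonormal_nonzero: "orthonormal B \<Longrightarrow> b \<in> B \<Longrightarrow> b \<noteq> 0"
  using orthonormalD(2) by fastforce

lemma orthonormal_insert:
  assumes "orthonormal B" "inner u u = 1" "\<And>b. b \<in> B \<Longrightarrow> inner u b = 0"
  shows "orthonormal (insert u B)" "u \<notin> B"
proof -
  show "u \<notin> B" using assms(2,3) by fastforce
  then show "orthonormal (insert u B)"
    using assms unfolding orthonormal_def by (auto simp: inner_commute)
qed

lemma inner_proj_on_basis:
  assumes "orthonormal B" "b \<in> B"
  shows "inner (proj_on B u) b = inner u b"
proof -
  have "inner (proj_on B u) b = (\<Sum>a\<in>B. inner u a * inner a b)"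
    by (simp add: proj_on_def inner_sum_left)
  also have "\<dots> = (\<Sum>a\<in>B. if a = b then inner u a else 0)"
    using assms by (intro sum.cong) (auto simp: orthonormal_def)
  finally show ?thesis using assms by (simp add: orthonormal_def)
qed

lemma inner_diff_proj_on_basis:
  "orthonormal B \<Longrightarrow> b \<in> B \<Longrightarrow> inner (u - proj_on B u) b = 0"
  by (simp add: inner_diff_left inner_proj_on_basis)

lemma proj_on_in_span: "proj_on B u \<in> span B"
  unfolding proj_on_def by (intro span_sum span_scale span_base)

lemma linear_proj_on: "linear (proj_on B)"
  by (rule linearI)
     (simp_all add: proj_on_def inner_add_left scaleR_add_left sum.distrib scaleR_right.sum)

lemma inner_span_eq_0:
  assumes "\<And>b. b \<in> B \<Longrightarrow> inner u b = 0" "v \<in> span B"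
  shows "inner u v = 0"
  using assms(2)
proof (induction rule: span_induct_alt)
  case base then show ?case by simp
next
  case (step c x y) then show ?case using assms(1) by (simp add: inner_add_right)
qed

lemma proj_on_eq_if_span:
  assumes "orthonormal B" "u \<in> span B"
  shows "proj_on B u = u"
proof -
  have *: "u - proj_on B u \<in> span B" by (intro span_diff assms proj_on_in_span)
  have "inner (u - proj_on B u) (u - proj_on B u) = 0"
    by (rule inner_span_eq_0[OF inner_diff_proj_on_basis[OF assms(1)] *])
  then show ?thesis by simp
qed

lemma inner_proj_on:
  "inner (proj_on B u) v = (\<Sum>b\<in>B. inner u b * inner v b)"
  unfolding proj_on_def inner_sum_left by (simp add: inner_commute)

lemma inner_proj_on_self:
  assumes "orthonormal B"
  shows "inner (proj_on B u) (proj_on B u) = (\<Sum>b\<in>B. (inner u b)\<^sup>2)"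
  by (subst inner_proj_on, rule sum.cong) (simp_all add: inner_proj_on_basis[OF assms] power2_eq_square)

lemma inner_self_pythagoras:
  assumes "orthonormal B"
  shows "inner u u = (\<Sum>b\<in>B. (inner u b)\<^sup>2) + inner (u - proj_on B u) (u - proj_on B u)"
proof -
  have "inner (u - proj_on B u) (proj_on B u) = 0"
    by (rule inner_span_eq_0[OF inner_diff_proj_on_basis[OF assms] proj_on_in_span])
  then show ?thesis
    using inner_proj_on_self[OF assms, of u]
    by (simp add: inner_diff_left inner_diff_right inner_commute)
qed

lemma bessel:
  assumes "orthonormal B"
  shows "(\<Sum>b\<in>B. (inner u b)\<^sup>2) \<le> inner u u"
  using inner_self_pythagoras[OF assms, of u] by simp

lemma parseval_span:
  assumes "orthonormal B" "u \<in> span B"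
  shows "inner u u = (\<Sum>b\<in>B. (inner u b)\<^sup>2)"
  using inner_self_pythagoras[OF assms(1), of u] proj_on_eq_if_span[OF assms] by simp

lemma orthonormal_independent:
  assumes "orthonormal B"
  shows "independent B"
proof (rule independent_if_scalars_zero)
  show "finite B" using assms by (simp add: orthonormal_def)
  fix f b assume s: "(\<Sum>x\<in>B. f x *\<^sub>R x) = 0" and b: "b \<in> B"
  have "0 = inner (\<Sum>x\<in>B. f x *\<^sub>R x) b" using s by simp
  also have "\<dots> = (\<Sum>x\<in>B. if x = b then f x else 0)"
    unfolding inner_sum_left using assms b
    by (intro sum.cong) (auto simp: orthonormal_def)
  also have "\<dots> = f b" using assms b by (simp add: orthonormal_def)
  finally show "f b = 0" by simp
qed

lemma discriminant_le:
  fixes A B D :: real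
  assumes "\<And>t. 0 \<le> A * t\<^sup>2 + 2 * B * t + D"
  shows "B\<^sup>2 \<le> A * D"
proof (cases "A = 0")
  case True
  have "B = 0"
  proof (rule ccontr)
    assume "B \<noteq> 0"
    then show False using assms[of "- (D + 1) / (2 * B)"] True by simp
  qed
  then show ?thesis by (simp add: True)
next
  case False
  have "A > 0"
  proof (rule ccontr)
    assume "\<not> A > 0"
    then have A: "A < 0" using False by simp
    define t where "t = (2 * \<bar>B\<bar> + \<bar>D\<bar> + 1) / (- A) + 1"
    have t: "t \<ge> 1" "A * t = - (2 * \<bar>B\<bar> + \<bar>D\<bar> + 1) + A"
      using A by (auto simp: t_def field_simps)
    have "A * t\<^sup>2 + 2 * B * t + D = (A * t) * t + 2 * B * t + D" by (simp add: power2_eq_square)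
    also have "\<dots> = (- 2 * \<bar>B\<bar> + 2 * B) * t + (D - \<bar>D\<bar> * t) + (A - 1) * t"
      unfolding t(2) by (simp add: algebra_simps)
    also have "\<dots> < 0"
    proof -
      have "(- 2 * \<bar>B\<bar> + 2 * B) * t \<le> 0" using t(1) by (intro mult_nonpos_nonneg) auto
      moreover have "D - \<bar>D\<bar> * t \<le> 0"
        using t(1) mult_left_mono[of 1 t "\<bar>D\<bar>"] by auto
      moreover have "(A - 1) * t < 0" using t(1) A by (intro mult_neg_pos) auto
      ultimately show ?thesis by linarith
    qed
    finally show False using assms[of t] by simp
  qed
  have "A * (- B / A)\<^sup>2 + 2 * B * (- B / A) + D = D - B\<^sup>2 / A"
    using \<open>A > 0\<close> by (simp add: power2_eq_square field_simps)
  with assms[of "- B / A"] have "B\<^sup>2 / A \<le> D" by simp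
  then show ?thesis using \<open>A > 0\<close> by (simp add: field_simps)
qed

definition form_symmetric :: "('a::real_inner \<Rightarrow> 'a) \<Rightarrow> bool" where
  "form_symmetric T \<longleftrightarrow> linear T \<and> (\<forall>u v. inner (T u) v = inner u (T v))"

lemma form_cauchy_schwarz:
  assumes sym: "form_symmetric T" and S: "subspace W"
    and psd: "\<And>u. u \<in> W \<Longrightarrow> 0 \<le> inner (T u) u" and "u \<in> W" "v \<in> W"
  shows "(inner (T u) v)\<^sup>2 \<le> inner (T u) u * inner (T v) v"
proof -
  have lin: "linear T" using sym by (simp add: form_symmetric_def)
  have "0 \<le> inner (T u) u * t\<^sup>2 + 2 * inner (T u) v * t + inner (T v) v" for t
  proof -
    have "t *\<^sub>R u + v \<in> W" using S assms(4,5) by (simp add: subspace_add subspace_scale)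
    from psd[OF this] have "0 \<le> inner (T (t *\<^sub>R u + v)) (t *\<^sub>R u + v)" .
    also have "\<dots> = inner (T u) u * t\<^sup>2 + t * inner (T u) v + t * inner (T v) u + inner (T v) v"
      by (simp add: linear_add[OF lin] linear_scale[OF lin] inner_add power2_eq_square algebra_simps)
    also have "inner (T v) u = inner (T u) v"
      using sym by (metis form_symmetric_def inner_commute)
    finally show ?thesis by (simp add: algebra_simps)
  qed
  from discriminant_le[OF this] show ?thesis .
qed

definition eigen_family :: "('a::real_inner \<Rightarrow> 'a) \<Rightarrow> real \<Rightarrow> 'a set \<Rightarrow> bool" where
  "eigen_family T \<kappa> B \<longleftrightarrow> orthonormal B \<and> (\<forall>b\<in>B. T b = inner (T b) b *\<^sub>R b \<and> inner (T b) b \<ge> \<kappa>)"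

definition spectral_family :: "('a::real_inner \<Rightarrow> 'a) \<Rightarrow> real \<Rightarrow> 'a set \<Rightarrow> bool" where
  "spectral_family T \<kappa> B \<longleftrightarrow> eigen_family T \<kappa> B \<and>
     (\<forall>u. (\<forall>b\<in>B. inner u b = 0) \<longrightarrow> u \<noteq> 0 \<longrightarrow> inner (T u) u < \<kappa> * inner u u)"

lemma eigen_family_apply:
  assumes "eigen_family T \<kappa> B" "form_symmetric T"
  shows "b \<in> B \<Longrightarrow> inner (T u) b = inner (T b) b * inner u b"
proof -
  assume b: "b \<in> B"
  have "inner (T u) b = inner u (T b)" using assms(2) by (simp add: form_symmetric_def)
  also have "T b = inner (T b) b *\<^sub>R b" using assms(1) b by (simp add: eigen_family_def)
  finally show ?thesis by simp
qed

lemma eigen_family_span: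
  assumes "eigen_family T \<kappa> B" "form_symmetric T" "u \<in> span B"
  shows "T u = (\<Sum>b\<in>B. (inner (T b) b * inner u b) *\<^sub>R b)"
proof -
  have on: "orthonormal B" using assms(1) by (simp add: eigen_family_def)
  have lin: "linear T" using assms(2) by (simp add: form_symmetric_def)
  have "T u = T (proj_on B u)" by (simp add: proj_on_eq_if_span[OF on assms(3)])
  also have "\<dots> = (\<Sum>b\<in>B. inner u b *\<^sub>R T b)"
    by (simp add: proj_on_def linear_sum[OF lin] linear_scale[OF lin])
  also have "\<dots> = (\<Sum>b\<in>B. inner u b *\<^sub>R (inner (T b) b *\<^sub>R b))"
    using assms(1) by (intro sum.cong refl arg_cong2[where f = scaleR]) (simp add: eigen_family_def)
  finally show ?thesis by (simp add: mult.commute)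
qed

lemma eigen_family_form:
  assumes "eigen_family T \<kappa> B" "form_symmetric T" "u \<in> span B"
  shows "inner (T u) u = (\<Sum>b\<in>B. inner (T b) b * (inner u b)\<^sup>2)"
  unfolding eigen_family_span[OF assms] inner_sum_left
  by (intro sum.cong refl) (simp add: power2_eq_square inner_commute[of u])

lemma eigen_family_lower:
  assumes "eigen_family T \<kappa> B" "form_symmetric T" "u \<in> span B"
  shows "\<kappa> * inner u u \<le> inner (T u) u"
proof -
  have on: "orthonormal B" using assms(1) by (simp add: eigen_family_def)
  have "(\<Sum>b\<in>B. \<kappa> * (inner u b)\<^sup>2) \<le> (\<Sum>b\<in>B. inner (T b) b * (inner u b)\<^sup>2)"
    using assms(1) by (intro sum_mono mult_right_mono) (auto simp: eigen_family_def)
  then show ?thesis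
    unfolding eigen_family_form[OF assms] parseval_span[OF on assms(3)] by (simp add: sum_distrib_left)
qed

lemma form_split:
  assumes "eigen_family T \<kappa> B" "form_symmetric T"
  shows "inner (T u) u = (\<Sum>b\<in>B. inner (T b) b * (inner u b)\<^sup>2)
          + inner (T (u - proj_on B u)) (u - proj_on B u)"
proof -
  have on: "orthonormal B" using assms(1) by (simp add: eigen_family_def)
  have lin: "linear T" using assms(2) by (simp add: form_symmetric_def)
  define p w where "p = proj_on B u" and "w = u - proj_on B u"
  have w: "inner w b = 0" if "b \<in> B" for b
    using that by (simp add: w_def inner_diff_proj_on_basis[OF on])
  have p: "p \<in> span B" by (simp add: p_def proj_on_in_span)
  have "T p \<in> span B" unfolding eigen_family_span[OF assms p]
    by (intro span_sum span_scale span_base)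
  then have 1: "inner (T p) w = 0" by (subst inner_commute) (rule inner_span_eq_0[OF w])
  have 2: "inner (T w) p = 0" using 1 assms(2) by (metis form_symmetric_def inner_commute)
  have "u = p + w" by (simp add: p_def w_def)
  then have "inner (T u) u = inner (T p) p + inner (T w) w"
    using 1 2 by (simp add: linear_add[OF lin] inner_add)
  also have "inner (T p) p = (\<Sum>b\<in>B. inner (T b) b * (inner u b)\<^sup>2)"
    unfolding eigen_family_form[OF assms p]
    by (intro sum.cong refl) (simp add: p_def inner_proj_on_basis[OF on])
  finally show ?thesis by (simp add: w_def)
qed

lemma spectral_family_span:
  assumes "spectral_family T \<kappa> B" "form_symmetric T" "T u = k *\<^sub>R u" "k \<ge> \<kappa>"
  shows "u \<in> span B"
proof -
  have ef: "eigen_family T \<kappa> B" using assms(1) by (simp add: spectral_family_def)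
  have on: "orthonormal B" using ef by (simp add: eigen_family_def)
  have lin: "linear T" using assms(2) by (simp add: form_symmetric_def)
  define w where "w = u - proj_on B u"
  have c: "k * inner u b = inner (T b) b * inner u b" if "b \<in> B" for b
    using eigen_family_apply[OF ef assms(2) that, of u] assms(3) by simp
  have "T (proj_on B u) = k *\<^sub>R proj_on B u"
  proof -
    have "T (proj_on B u) = (\<Sum>b\<in>B. (inner (T b) b * inner u b) *\<^sub>R b)"
      unfolding eigen_family_span[OF ef assms(2) proj_on_in_span]
      by (intro sum.cong refl) (simp add: inner_proj_on_basis[OF on])
    also have "\<dots> = (\<Sum>b\<in>B. (k * inner u b) *\<^sub>R b)"
      by (intro sum.cong refl) (simp add: c)
    finally show ?thesis by (simp add: proj_on_def scaleR_right.sum)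
  qed
  then have "T w = k *\<^sub>R w"
    by (simp add: w_def linear_diff[OF lin] assms(3) scaleR_diff_right)
  then have "inner (T w) w \<ge> \<kappa> * inner w w" using assms(4) by (simp add: mult_right_mono)
  moreover have "inner w b = 0" if "b \<in> B" for b
    using that by (simp add: w_def inner_diff_proj_on_basis[OF on])
  ultimately have "w = 0" using assms(1) unfolding spectral_family_def by (meson not_less)
  then show ?thesis using proj_on_in_span[of B u] by (simp add: w_def)
qed

lemma spectral_family_restrict:
  assumes "spectral_family T \<kappa> B" "form_symmetric T" "\<kappa> \<le> \<kappa>'"
  shows "spectral_family T \<kappa>' {b\<in>B. inner (T b) b \<ge> \<kappa>'}"
proof -
  have ef: "eigen_family T \<kappa> B" using assms(1) by (simp add: spectral_family_def)
  have on: "orthonormal B" using ef by (simp add: eigen_family_def)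
  let ?A = "{b\<in>B. inner (T b) b \<ge> \<kappa>'}"
  have "inner (T u) u < \<kappa>' * inner u u" if u: "\<forall>b\<in>?A. inner u b = 0" "u \<noteq> 0" for u
  proof -
    let ?w = "u - proj_on B u"
    have le: "inner (T b) b * (inner u b)\<^sup>2 \<le> \<kappa>' * (inner u b)\<^sup>2" if "b \<in> B" for b
      using u(1) that by (cases "b \<in> ?A") (auto intro: mult_right_mono)
    have orth: "\<forall>b\<in>B. inner ?w b = 0" by (simp add: inner_diff_proj_on_basis[OF on])
    show ?thesis
    proof (cases "?w = 0")
      case False
      have "inner (T ?w) ?w < \<kappa> * inner ?w ?w"
        using assms(1) orth False by (simp add: spectral_family_def)
      also have "\<dots> \<le> \<kappa>' * inner ?w ?w" using assms(3) by (intro mult_right_mono) auto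
      finally have "inner (T ?w) ?w < \<kappa>' * inner ?w ?w" .
      moreover have "(\<Sum>b\<in>B. inner (T b) b * (inner u b)\<^sup>2) \<le> (\<Sum>b\<in>B. \<kappa>' * (inner u b)\<^sup>2)"
        by (intro sum_mono le)
      ultimately show ?thesis
        unfolding form_split[OF ef assms(2), of u]
        by (subst inner_self_pythagoras[OF on]) (simp add: distrib_left sum_distrib_left)
    next
      case True
      have "\<exists>b\<in>B. inner u b \<noteq> 0"
      proof (rule ccontr)
        assume "\<not> (\<exists>b\<in>B. inner u b \<noteq> 0)"
        then have "proj_on B u = 0" by (simp add: proj_on_def)
        then show False using True u(2) by simp
      qed
      then obtain a where a: "a \<in> B" "inner u a \<noteq> 0" by blast
      then have "a \<notin> ?A" using u(1) by blast
      then have "inner (T a) a < \<kappa>'" using a(1) by simp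
      then have "inner (T a) a * (inner u a)\<^sup>2 < \<kappa>' * (inner u a)\<^sup>2"
        using a(2) by simp
      then have "(\<Sum>b\<in>B. inner (T b) b * (inner u b)\<^sup>2) < (\<Sum>b\<in>B. \<kappa>' * (inner u b)\<^sup>2)"
        using a(1) le orthonormalD(1)[OF on] by (intro sum_strict_mono_ex1) auto
      moreover have "T ?w = 0" using True assms(2) by (metis form_symmetric_def linear_0)
      ultimately show ?thesis
        unfolding form_split[OF ef assms(2), of u]
        by (subst inner_self_pythagoras[OF on]) (simp add: True sum_distrib_left)
    qed
  qed
  moreover have "orthonormal ?A" by (rule orthonormal_subset[OF on]) auto
  ultimately show ?thesis
    using ef by (auto simp: spectral_family_def eigen_family_def)
qed

lemma linear_inner_right: "linear (\<lambda>u. inner u b)"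
  by (rule linearI) (simp_all add: inner_add_left)

lemma spectral_family_card_le:
  assumes "spectral_family T \<kappa> B" "spectral_family S \<kappa> A" "form_symmetric T"
    "finite C" "\<And>c. c \<in> C \<Longrightarrow> linear (c :: _ \<Rightarrow> real)"
    "\<And>u. (\<And>c. c \<in> C \<Longrightarrow> c u = 0) \<Longrightarrow> inner (T u) u \<le> inner (S u) u"
  shows "card B \<le> card A + card C"
proof (rule ccontr)
  assume neg: "\<not> ?thesis"
  have ef: "eigen_family T \<kappa> B" using assms(1) by (simp add: spectral_family_def)
  have on: "orthonormal B" using ef by (simp add: eigen_family_def)
  have fA: "finite A" using assms(2) by (simp add: spectral_family_def eigen_family_def orthonormal_def)
  let ?C = "(\<lambda>a u. inner u a) ` A \<union> C"
  have "card ?C \<le> card A + card C"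
    by (rule order_trans[OF card_Un_le]) (simp add: card_image_le fA)
  then have "card ?C < card B" using neg by linarith
  moreover have "linear c" if "c \<in> ?C" for c using that assms(5) linear_inner_right by blast
  moreover have "finite ?C" using assms(4) fA by simp
  ultimately have "\<exists>u\<in>span B. u \<noteq> 0 \<and> (\<forall>c\<in>?C. c u = 0)"
    by (intro kernel_meets_span[OF orthonormal_independent[OF on]])
  then obtain u where u: "u \<in> span B" "u \<noteq> 0" "\<forall>c\<in>?C. c u = 0" by blast
  have "\<forall>a\<in>A. inner u a = 0"
  proof
    fix a assume "a \<in> A"
    then have "(\<lambda>u. inner u a) \<in> ?C" by blast
    from bspec[OF u(3) this] show "inner u a = 0" .
  qed
  then have "inner (S u) u < \<kappa> * inner u u" using assms(2) u(2) by (simp add: spectral_family_def)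
  moreover have "inner (T u) u \<le> inner (S u) u" using assms(6) u(3) by blast
  moreover have "\<kappa> * inner u u \<le> inner (T u) u" by (rule eigen_family_lower[OF ef assms(3) u(1)])
  ultimately show False by simp
qed

locale compact_psd =
  fixes T :: "'a::real_inner \<Rightarrow> 'a"
  assumes symmetric: "form_symmetric T"
    and psd: "\<And>u. 0 \<le> inner (T u) u"
    and almost_finite_rank: "\<And>e. e > 0 \<Longrightarrow> \<exists>C. finite C \<and> (\<forall>c\<in>C. bounded_linear c) \<and>
          (\<forall>u. norm (T u) \<le> e * norm u + (\<Sum>c\<in>C. \<bar>c u :: real\<bar>))"
    and Cauchy_image: "\<And>u. Cauchy u \<Longrightarrow> convergent (\<lambda>n. T (u n))"
begin

lemma linear: "linear T"
  using symmetric by (simp add: form_symmetric_def)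

lemma bounded: "bounded_linear T"
proof -
  obtain C where C: "finite C" "\<And>c. c \<in> C \<Longrightarrow> bounded_linear c"
      "\<And>u. norm (T u) \<le> 1 * norm u + (\<Sum>c\<in>C. \<bar>c u :: real\<bar>)"
    using almost_finite_rank[OF zero_less_one] by blast
  have "\<exists>K. \<forall>u. \<bar>c u\<bar> \<le> K * norm u" if "c \<in> C" for c
    using bounded_linear.bounded[OF C(2)[OF that]] by (metis mult.commute real_norm_def)
  then obtain K where K: "\<And>c u. c \<in> C \<Longrightarrow> \<bar>c u\<bar> \<le> K c * norm u" by metis
  show ?thesis
  proof (rule bounded_linear_intro)
    show "T (x + y) = T x + T y" "T (r *\<^sub>R x) = r *\<^sub>R T x" for x y r
      using linear by (simp_all add: linear_add linear_scale)
    fix u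
    have "norm (T u) \<le> 1 * norm u + (\<Sum>c\<in>C. K c * norm u)"
      by (rule order_trans[OF C(3)]) (intro add_left_mono sum_mono K)
    also have "\<dots> = norm u * (1 + sum K C)" by (simp add: sum_distrib_left sum_distrib_right algebra_simps)
    finally show "norm (T u) \<le> norm u * (1 + sum K C)" .
  qed
qed

lemma convergent_subsequence_functionals:
  fixes u :: "nat \<Rightarrow> 'a"
  assumes "finite C" "\<And>c. c \<in> C \<Longrightarrow> bounded_linear c" "\<And>n. norm (u n) = 1"
  shows "\<exists>r::nat \<Rightarrow> nat. strict_mono r \<and> (\<forall>c\<in>C. convergent (\<lambda>n. c (u (r n)) :: real))"
  using assms(1,2)
proof (induction C rule: finite_induct)
  case empty then show ?case using strict_mono_id by auto
next
  case (insert c C)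
  then obtain r :: "nat \<Rightarrow> nat" where r: "strict_mono r" "\<And>c. c \<in> C \<Longrightarrow> convergent (\<lambda>n. c (u (r n)))" by auto
  interpret c: bounded_linear c using insert by simp
  obtain K where K: "\<And>x. norm (c x) \<le> norm x * K" using c.bounded by blast
  have "bounded (range (\<lambda>n. c (u (r n))))"
    unfolding bounded_iff using K assms(3) by (intro exI[of _ K]) (metis (no_types, lifting) imageE mult_1)
  then obtain l s where s: "strict_mono s" "((\<lambda>n. c (u (r n))) \<circ> s) \<longlonglongrightarrow> l"
    using bounded_imp_convergent_subsequence by blast
  have "convergent (\<lambda>n. d (u (r (s n))))" if "d \<in> C" for d
    using convergent_subseq_convergent[OF r(2)[OF that] s(1)] by (simp add: o_def)
  moreover have "convergent (\<lambda>n. c (u (r (s n))))" using s(2) by (auto simp: convergent_def o_def)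
  ultimately show ?case
    using strict_mono_o[OF r(1) s(1)] by (intro exI[of _ "r \<circ> s"]) (auto simp del: o_apply simp: o_def)
qed

lemma Cauchy_sum_functionals:
  fixes u :: "nat \<Rightarrow> 'a"
  assumes "finite C" "\<And>c. c \<in> C \<Longrightarrow> convergent (\<lambda>n. c (u n) :: real)" "e > 0"
  shows "\<exists>N. \<forall>m\<ge>N. \<forall>n\<ge>N. (\<Sum>c\<in>C. \<bar>c (u m) - c (u n)\<bar>) < e"
  using assms
proof (induction C arbitrary: e rule: finite_induct)
  case empty then show ?case by simp
next
  case (insert c C)
  obtain N1 where N1: "\<And>m n. m \<ge> N1 \<Longrightarrow> n \<ge> N1 \<Longrightarrow> (\<Sum>c\<in>C. \<bar>c (u m) - c (u n)\<bar>) < e / 2"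
    using insert.IH[of "e / 2"] insert.prems by auto
  have "Cauchy (\<lambda>n. c (u n))" using insert.prems(1)[of c] by (simp add: convergent_Cauchy)
  then obtain N2 where N2: "\<And>m n. m \<ge> N2 \<Longrightarrow> n \<ge> N2 \<Longrightarrow> \<bar>c (u m) - c (u n)\<bar> < e / 2"
    using insert.prems(2) unfolding Cauchy_def dist_real_def by (meson half_gt_zero)
  have "(\<Sum>c\<in>insert c C. \<bar>c (u m) - c (u n)\<bar>) < e" if "m \<ge> max N1 N2" "n \<ge> max N1 N2" for m n
    using N1[of m n] N2[of m n] that insert.hyps by simp
  then show ?case by blast
qed

lemma eigenvector_exists:
  assumes ef: "eigen_family T \<kappa> B" and "\<kappa> > 0"
    and u0: "\<And>b. b \<in> B \<Longrightarrow> inner u0 b = 0" "u0 \<noteq> 0" "\<kappa> * inner u0 u0 \<le> inner (T u0) u0"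
  shows "\<exists>g k. (\<forall>b\<in>B. inner g b = 0) \<and> inner g g = 1 \<and> T g = k *\<^sub>R g \<and> k \<ge> \<kappa>"
proof -
  define W where "W = {u. \<forall>b\<in>B. inner u b = 0}"
  have W: "subspace W" unfolding W_def by (auto simp: subspace_def inner_add_left)
  have TW: "T u \<in> W" if "u \<in> W" for u
  proof -
    have "inner (T u) b = 0" if "b \<in> B" for b
      by (subst eigen_family_apply[OF ef symmetric that]) (use \<open>u \<in> W\<close> that in \<open>simp add: W_def\<close>)
    then show ?thesis by (simp add: W_def)
  qed
  define S where "S = {inner (T u) u | u. u \<in> W \<and> norm u = 1}"
  obtain K where K: "\<And>x. norm (T x) \<le> norm x * K" using bounded_linear.bounded[OF bounded] by blast
  have "inner (T u) u \<le> K" if "norm u = 1" for u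
    using norm_cauchy_schwarz[of "T u" u] K[of u] that by simp
  then have bdd: "bdd_above S" by (auto simp: S_def intro!: bdd_aboveI)
  define k where "k = Sup S"
  have le_k: "inner (T u) u \<le> k * inner u u" if "u \<in> W" for u
  proof (cases "u = 0")
    case False
    define v where "v = (1 / norm u) *\<^sub>R u"
    have "norm v = 1" "v \<in> W" using False W that by (auto simp: v_def subspace_scale)
    then have "inner (T v) v \<le> k" unfolding k_def by (intro cSup_upper bdd) (auto simp: S_def)
    then have "inner (T u) u / (norm u)\<^sup>2 \<le> k"
      by (simp add: v_def linear_scale[OF linear] power2_eq_square)
    then show ?thesis using False by (simp add: field_simps power2_norm_eq_inner)
  qed (simp add: linear_0[OF linear])
  have "u0 \<in> W" using u0(1) by (simp add: W_def)
  then have "\<kappa> * inner u0 u0 \<le> k * inner u0 u0" using le_k u0(3) by fastforce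
  then have k: "\<kappa> \<le> k" using u0(2) by simp
  then have "k > 0" using \<open>\<kappa> > 0\<close> by simp
  have "S \<noteq> {}"
  proof -
    have "(1 / norm u0) *\<^sub>R u0 \<in> W" "norm ((1 / norm u0) *\<^sub>R u0) = 1"
      using u0(2) W \<open>u0 \<in> W\<close> by (auto simp: subspace_scale)
    then show ?thesis unfolding S_def by blast
  qed
  have "\<exists>u. u \<in> W \<and> norm u = 1 \<and> k - 1 / real (Suc n) < inner (T u) u" for n
  proof -
    have "k - 1 / real (Suc n) < Sup S" by (simp add: k_def)
    from less_cSupD[OF \<open>S \<noteq> {}\<close> this] show ?thesis by (auto simp: S_def)
  qed
  then obtain u where u: "\<And>n. u n \<in> W" "\<And>n. norm (u n) = 1" "\<And>n. k - 1 / real (Suc n) < inner (T (u n)) (u n)"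
    by metis
  define d where "d = (\<lambda>n. k *\<^sub>R u n - T (u n))"
  have dW: "d n \<in> W" for n using u(1) TW W by (simp add: d_def subspace_diff subspace_scale)
  have sym': "form_symmetric (\<lambda>u. k *\<^sub>R u - T u)"
    using symmetric unfolding form_symmetric_def
    by (auto intro!: linearI simp: linear_add linear_scale inner_diff algebra_simps)
  have psd': "0 \<le> inner (k *\<^sub>R u - T u) u" if "u \<in> W" for u
    using le_k[OF that] by (simp add: inner_diff_left)
  have dn: "k *\<^sub>R u n - T (u n) = d n" for n by (simp add: d_def)
  have small: "inner (d n) (d n) \<le> k * (1 / real (Suc n))" for n
  proof -
    have "(inner (d n) (d n))\<^sup>2 \<le> inner (d n) (u n) * inner (k *\<^sub>R d n - T (d n)) (d n)"
      using form_cauchy_schwarz[OF sym' W psd' u(1) dW, of n n] unfolding dn .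
    also have "\<dots> \<le> (1 / real (Suc n)) * (k * inner (d n) (d n))"
    proof (intro mult_mono)
      show "inner (d n) (u n) \<le> 1 / real (Suc n)"
        using u(2,3)[of n] by (simp add: d_def inner_diff_left dot_square_norm)
      show "inner (k *\<^sub>R d n - T (d n)) (d n) \<le> k * inner (d n) (d n)"
        using psd[of "d n"] by (simp add: inner_diff_left)
      show "0 \<le> inner (k *\<^sub>R d n - T (d n)) (d n)"
        using le_k[OF dW] by (simp add: inner_diff_left)
    qed auto
    finally have *: "inner (d n) (d n) * inner (d n) (d n) \<le> (k * (1 / real (Suc n))) * inner (d n) (d n)"
      by (simp add: power2_eq_square algebra_simps)
    show ?thesis
    proof (cases "d n = 0")
      case True then show ?thesis using \<open>k > 0\<close> by simp
    next
      case False then show ?thesis using * by (subst (asm) mult_le_cancel_right) simp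
    qed
  qed
  have d0: "d \<longlonglongrightarrow> 0"
  proof -
    have "(\<lambda>n. (norm (d n))\<^sup>2) \<longlonglongrightarrow> 0"
    proof (rule tendsto_sandwich[of "\<lambda>_. 0" _ _ "\<lambda>n. k * (1 / real (Suc n))"])
      have "(\<lambda>n. k * (1 / real (Suc n))) \<longlonglongrightarrow> k * 0"
        using LIMSEQ_inverse_real_of_nat by (intro tendsto_mult tendsto_const) (simp add: inverse_eq_divide)
      then show "(\<lambda>n. k * (1 / real (Suc n))) \<longlonglongrightarrow> 0" by simp
    qed (use small in \<open>auto simp: power2_norm_eq_inner\<close>)
    then have "(\<lambda>n. sqrt ((norm (d n))\<^sup>2)) \<longlonglongrightarrow> sqrt 0" by (rule tendsto_real_sqrt)
    then show ?thesis by (simp add: tendsto_norm_zero_iff)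
  qed
  obtain C where C: "finite C" "\<And>c. c \<in> C \<Longrightarrow> bounded_linear c"
      "\<And>u. norm (T u) \<le> (k / 2) * norm u + (\<Sum>c\<in>C. \<bar>c u :: real\<bar>)"
    using almost_finite_rank[OF half_gt_zero[OF \<open>k > 0\<close>]] by blast
  obtain r where r: "strict_mono r" "\<And>c. c \<in> C \<Longrightarrow> convergent (\<lambda>n. c (u (r n)))"
    using convergent_subsequence_functionals[of C u, OF C(1) C(2) u(2)] by blast
  define v where "v = u \<circ> r"
  have dv: "(\<lambda>n. d (r n)) \<longlonglongrightarrow> 0" using LIMSEQ_subseq_LIMSEQ[OF d0 r(1)] by (simp add: o_def)
  have "Cauchy v"
    unfolding Cauchy_def
  proof (intro allI impI)
    fix e :: real assume "e > 0"
    define e' where "e' = k * e / 8"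
    have "e' > 0" using \<open>e > 0\<close> \<open>k > 0\<close> by (simp add: e'_def)
    obtain N1 where N1: "\<And>n. n \<ge> N1 \<Longrightarrow> norm (d (r n)) < e'"
      using LIMSEQ_D[OF dv \<open>e' > 0\<close>] by auto
    obtain N2 where N2: "\<And>m n. m \<ge> N2 \<Longrightarrow> n \<ge> N2 \<Longrightarrow> (\<Sum>c\<in>C. \<bar>c (u (r m)) - c (u (r n))\<bar>) < e'"
      using Cauchy_sum_functionals[OF C(1), of "\<lambda>n. u (r n)" e'] r(2) \<open>e' > 0\<close> by blast
    have "dist (v m) (v n) < e" if "m \<ge> max N1 N2" "n \<ge> max N1 N2" for m n
    proof -
      define z where "z = v m - v n"
      have "k *\<^sub>R z = (d (r m) - d (r n)) + T z"
        by (simp add: z_def v_def d_def linear_diff[OF linear] algebra_simps)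
      then have "k * norm z \<le> norm (d (r m)) + norm (d (r n)) + norm (T z)"
        using norm_triangle_ineq[of "d (r m) - d (r n)" "T z"] norm_triangle_ineq4[of "d (r m)" "d (r n)"]
          \<open>k > 0\<close> by (metis abs_of_pos add_mono_thms_linordered_semiring(3) norm_scaleR order_trans)
      also have "norm (T z) \<le> (k / 2) * norm z + (\<Sum>c\<in>C. \<bar>c z\<bar>)" by (rule C(3))
      also have "(\<Sum>c\<in>C. \<bar>c z\<bar>) = (\<Sum>c\<in>C. \<bar>c (u (r m)) - c (u (r n))\<bar>)"
        using C(2) by (intro sum.cong refl) (simp add: z_def v_def bounded_linear.linear linear_diff)
      also have "\<dots> < e'" using N2 that by simp
      finally have "(k / 2) * norm z < 3 * e'"
        using N1[of m] N1[of n] that by (auto simp: field_simps)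
      then have "norm z < e" using \<open>k > 0\<close> \<open>e > 0\<close> by (auto simp: e'_def field_simps)
      then show ?thesis by (simp add: dist_norm z_def)
    qed
    then show "\<exists>M. \<forall>m\<ge>M. \<forall>n\<ge>M. dist (v m) (v n) < e" by blast
  qed
  then obtain h where h: "(\<lambda>n. T (v n)) \<longlonglongrightarrow> h" using Cauchy_image convergent_def by blast
  define g where "g = (1 / k) *\<^sub>R h"
  have "v n = (1 / k) *\<^sub>R (d (r n) + T (v n))" for n
    using \<open>k > 0\<close> by (simp add: d_def v_def)
  moreover have "(\<lambda>n. (1 / k) *\<^sub>R (d (r n) + T (v n))) \<longlonglongrightarrow> (1 / k) *\<^sub>R (0 + h)"
    by (intro tendsto_intros dv h)
  ultimately have vg: "v \<longlonglongrightarrow> g" by (simp add: g_def)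
  have "(\<lambda>n. T (v n)) \<longlonglongrightarrow> T g" using bounded_linear.tendsto[OF bounded vg] .
  then have "T g = h" using h LIMSEQ_unique by blast
  then have 1: "T g = k *\<^sub>R g" using \<open>k > 0\<close> by (simp add: g_def)
  have "norm g = 1"
    using tendsto_norm[OF vg] u(2) by (simp add: v_def LIMSEQ_const_iff)
  then have 2: "inner g g = 1" by (simp add: norm_eq_1)
  have "inner g b = 0" if "b \<in> B" for b
  proof -
    have "(\<lambda>n. inner (v n) b) \<longlonglongrightarrow> inner g b" by (intro tendsto_intros vg)
    moreover have "inner (v n) b = 0" for n using u(1) that by (simp add: v_def W_def)
    ultimately show ?thesis by (simp add: LIMSEQ_const_iff)
  qed
  then show ?thesis using 1 2 k by blast
qed

lemma spectral_family_exists: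
  assumes "\<kappa> > 0"
  obtains B where "spectral_family T \<kappa> B"
proof -
  obtain C where C: "finite C" "\<And>c. c \<in> C \<Longrightarrow> bounded_linear c"
      "\<And>u. norm (T u) \<le> (\<kappa> / 2) * norm u + (\<Sum>c\<in>C. \<bar>c u :: real\<bar>)"
    using almost_finite_rank[OF half_gt_zero[OF assms]] by blast
  have bd: "card B \<le> card C" if ef: "eigen_family T \<kappa> B" for B
  proof (rule ccontr)
    assume "\<not> card B \<le> card C"
    have on: "orthonormal B" using ef by (simp add: eigen_family_def)
    have "\<exists>u\<in>span B. u \<noteq> 0 \<and> (\<forall>c\<in>C. c u = 0)"
      using \<open>\<not> card B \<le> card C\<close> C(2)
      by (intro kernel_meets_span[OF orthonormal_independent[OF on] C(1)] bounded_linear.linear) auto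
    then obtain u where u: "u \<in> span B" "u \<noteq> 0" "\<And>c. c \<in> C \<Longrightarrow> c u = 0" by blast
    have "(\<Sum>c\<in>C. \<bar>c u\<bar>) = 0" using u(3) by (simp add: sum.neutral)
    then have Tu: "norm (T u) \<le> (\<kappa> / 2) * norm u" using C(3)[of u] by linarith
    have "\<kappa> * (norm u * norm u) \<le> inner (T u) u"
      using eigen_family_lower[OF ef symmetric u(1)] by (simp add: dot_square_norm power2_eq_square)
    also have "\<dots> \<le> norm (T u) * norm u" by (rule norm_cauchy_schwarz)
    also have "norm (T u) \<le> (\<kappa> / 2) * norm u" by (rule Tu)
    finally have "\<kappa> * (norm u * norm u) \<le> (\<kappa> / 2) * (norm u * norm u)"
      by (simp add: mult_right_mono mult.assoc)
    moreover have "norm u * norm u > 0" using u(2) by simp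
    ultimately show False using assms by simp
  qed
  have "eigen_family T \<kappa> {}" by (simp add: eigen_family_def orthonormal_def)
  then have "\<exists>B. eigen_family T \<kappa> B \<and> (\<forall>A. eigen_family T \<kappa> A \<longrightarrow> card A \<le> card B)"
    using bd by (intro ex_has_greatest_nat[where b = "Suc (card C)"]) (auto simp: less_Suc_eq_le)
  then obtain B where B: "eigen_family T \<kappa> B" "\<And>A. eigen_family T \<kappa> A \<Longrightarrow> card A \<le> card B"
    by blast
  have on: "orthonormal B" using B(1) by (simp add: eigen_family_def)
  have "inner (T u) u < \<kappa> * inner u u" if "\<forall>b\<in>B. inner u b = 0" "u \<noteq> 0" for u
  proof (rule ccontr)
    assume "\<not> ?thesis"
    then have "\<exists>g k. (\<forall>b\<in>B. inner g b = 0) \<and> inner g g = 1 \<and> T g = k *\<^sub>R g \<and> k \<ge> \<kappa>"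
      using that by (intro eigenvector_exists[OF B(1) assms, of u]) auto
    then obtain g k where g: "\<And>b. b \<in> B \<Longrightarrow> inner g b = 0" "inner g g = 1" "T g = k *\<^sub>R g" "k \<ge> \<kappa>"
      by blast
    have "eigen_family T \<kappa> (insert g B)"
      using B(1) orthonormal_insert(1)[OF on g(2,1)] g by (simp add: eigen_family_def)
    then have "card (insert g B) \<le> card B" by (rule B(2))
    then show False using orthonormal_insert(2)[OF on g(2,1)] orthonormalD(1)[OF on] by simp
  qed
  then have "spectral_family T \<kappa> B" using B(1) by (simp add: spectral_family_def)
  then show ?thesis by (rule that)
qed

end

section \<open>Geometry of the gasket\<close>

abbreviation idx :: "nat set" where "idx \<equiv> {1, 2, 3}"

definition corner :: "nat \<Rightarrow> real ^ 2" where
  "corner i = (if i = 1 then vector [0, 0] else if i = 2 then vector [1, 0] else vector [1/2, sqrt 3 / 2])"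

definition bary :: "nat \<Rightarrow> real ^ 2 \<Rightarrow> real" where
  "bary k x = (if k = 1 then 1 - x $ 1 - x $ 2 / sqrt 3
               else if k = 2 then x $ 1 - x $ 2 / sqrt 3 else 2 * x $ 2 / sqrt 3)"

lemma sg_map_eq: "sg_map i x = (1/2) *\<^sub>R (x + corner i)"
  by (simp add: sg_map_def corner_def vec_eq_iff forall_2)

lemma bary_sum: "bary 1 x + bary 2 x + bary 3 x = 1"
  by (simp add: bary_def)

lemma bary_corner: "i \<in> idx \<Longrightarrow> j \<in> idx \<Longrightarrow> bary i (corner j) = (if i = j then 1 else 0)"
  by (auto simp: bary_def corner_def field_simps)

lemma bary_sg_map: "i \<in> idx \<Longrightarrow> k \<in> idx \<Longrightarrow> bary k (sg_map i x) = (bary k x + (if k = i then 1 else 0)) / 2"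
  by (auto simp: bary_def corner_def sg_map_eq field_simps)

lemma bary_inject: "(\<And>k. k \<in> idx \<Longrightarrow> bary k x = bary k y) \<Longrightarrow> x = y"
proof -
  assume *: "\<And>k. k \<in> idx \<Longrightarrow> bary k x = bary k y"
  from *[of 3] have "x $ 2 = y $ 2" by (simp add: bary_def)
  moreover from *[of 2] this have "x $ 1 = y $ 1" by (simp add: bary_def)
  ultimately show ?thesis by (simp add: vec_eq_iff forall_2)
qed

lemma bary_expand: "x = bary 1 x *\<^sub>R corner 1 + bary 2 x *\<^sub>R corner 2 + bary 3 x *\<^sub>R corner 3"
  by (simp add: vec_eq_iff forall_2 bary_def corner_def field_simps)

lemma dist_sg_map: "dist (sg_map i x) (sg_map i y) = dist x y / 2"
proof -
  have "sg_map i x - sg_map i y = (1/2) *\<^sub>R (x - y)" by (simp add: sg_map_eq algebra_simps)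
  then show ?thesis by (simp add: dist_norm)
qed

lemma sg_map_inject: "sg_map i x = sg_map i y \<longleftrightarrow> x = y"
  by (simp add: sg_map_eq)

lemma continuous_on_sg_map [continuous_intros]: "continuous_on S (sg_map i)"
  unfolding sg_map_eq by (intro continuous_intros)

lemma sg_map_corner_self: "sg_map i (corner i) = corner i"
  by (simp add: sg_map_eq scaleR_2[symmetric])

lemma sg_map_corner_swap: "sg_map i (corner j) = sg_map j (corner i)"
  by (simp add: sg_map_eq add.commute)

lemma corner_inject: "i \<in> idx \<Longrightarrow> j \<in> idx \<Longrightarrow> corner i = corner j \<longleftrightarrow> i = j"
  using bary_corner[of i i] bary_corner[of i j] by (auto split: if_splits)

definition sg_triangle :: "(real ^ 2) set" where
  "sg_triangle = {x. \<forall>k\<in>idx. 0 \<le> bary k x}"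

lemma sg_triangle_eq_hull: "sg_triangle = convex hull {corner 1, corner 2, corner 3}"
proof
  show "sg_triangle \<subseteq> convex hull {corner 1, corner 2, corner 3}"
  proof
    fix x assume "x \<in> sg_triangle"
    then show "x \<in> convex hull {corner 1, corner 2, corner 3}"
      unfolding convex_hull_3 using bary_expand[of x] bary_sum[of x] by (auto simp: sg_triangle_def)
  qed
  have "convex {x. 0 \<le> bary k x}" for k
  proof (rule convexI)
    fix x y and u v :: real
    assume *: "x \<in> {x. 0 \<le> bary k x}" "y \<in> {x. 0 \<le> bary k x}" "0 \<le> u" "0 \<le> v" "u + v = 1"
    have "bary k (u *\<^sub>R x + v *\<^sub>R y) = u * bary k x + v * bary k y"
    proof -
      have "v = 1 - u" using *(5) by simp
      show ?thesis unfolding \<open>v = 1 - u\<close> by (simp add: bary_def field_simps)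
    qed
    then show "u *\<^sub>R x + v *\<^sub>R y \<in> {x. 0 \<le> bary k x}" using * by simp
  qed
  then have "convex sg_triangle"
    unfolding sg_triangle_def by (simp only: Collect_ball_eq) (intro convex_INT, simp)
  moreover have "{corner 1, corner 2, corner 3} \<subseteq> sg_triangle"
    by (auto simp: sg_triangle_def bary_corner)
  ultimately show "convex hull {corner 1, corner 2, corner 3} \<subseteq> sg_triangle" by (rule hull_minimal[rotated])
qed

lemma compact_sg_triangle: "compact sg_triangle"
  by (simp add: sg_triangle_eq_hull finite_imp_compact_convex_hull)

lemma connected_sg_triangle: "connected sg_triangle"
  by (simp add: sg_triangle_eq_hull convex_connected)

lemma corner_in_sg_triangle: "i \<in> idx \<Longrightarrow> corner i \<in> sg_triangle"
  by (auto simp: sg_triangle_def bary_corner)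

lemma dist_sg_triangle_le:
  assumes "x \<in> sg_triangle" "y \<in> sg_triangle"
  shows "dist x y \<le> 1"
proof -
  have c: "dist (corner i) (corner j) \<le> 1" if "i \<in> idx" "j \<in> idx" for i j
  proof -
    have "(dist (corner i) (corner j))\<^sup>2 = (corner i $ 1 - corner j $ 1)\<^sup>2 + (corner i $ 2 - corner j $ 2)\<^sup>2"
      by (simp add: dist_norm norm_vec_def L2_set_def sum_2)
    also have "\<dots> \<le> 1" using that by (auto simp: corner_def power_divide)
    finally show ?thesis by (simp add: abs_square_le_1)
  qed
  have 1: "sg_triangle \<subseteq> cball (corner j) 1" if "j \<in> idx" for j
    unfolding sg_triangle_eq_hull
    by (rule hull_minimal) (use c[OF that] in \<open>auto intro: convex_cball\<close>)
  have "sg_triangle \<subseteq> cball x 1"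
  proof (subst sg_triangle_eq_hull, rule hull_minimal)
    show "{corner 1, corner 2, corner 3} \<subseteq> cball x 1"
      using 1[of 1] 1[of 2] 1[of 3] assms(1) by (auto simp: dist_commute)
  qed (rule convex_cball)
  then show ?thesis using assms(2) by auto
qed

lemma sg_map_sg_triangle: "i \<in> idx \<Longrightarrow> x \<in> sg_triangle \<Longrightarrow> sg_map i x \<in> sg_triangle"
  by (simp add: sg_triangle_def bary_sg_map)

primrec sg_approx :: "nat \<Rightarrow> (real ^ 2) set" where
  "sg_approx 0 = sg_triangle"
| "sg_approx (Suc m) = (\<Union>i\<in>idx. sg_map i ` sg_approx m)"

lemma corner_in_sg_approx: "i \<in> idx \<Longrightarrow> corner i \<in> sg_approx m"
proof (induction m)
  case (Suc m)
  then have "sg_map i (corner i) \<in> sg_approx (Suc m)" by fastforce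
  then show ?case by (simp add: sg_map_corner_self)
qed (simp add: corner_in_sg_triangle)

lemma compact_sg_approx: "compact (sg_approx m)"
proof (induction m)
  case (Suc m)
  then show ?case by (auto intro!: compact_Un compact_continuous_image continuous_on_sg_map)
qed (simp add: compact_sg_triangle)

lemma connected_sg_approx: "connected (sg_approx m)"
proof (induction m)
  case (Suc m)
  have c: "connected (sg_map i ` sg_approx m)" for i
    by (intro connected_continuous_image continuous_on_sg_map Suc)
  have m: "sg_map i (corner j) \<in> sg_map i ` sg_approx m" if "j \<in> idx" for i j
    using corner_in_sg_approx[OF that] by simp
  have 1: "connected (sg_map 1 ` sg_approx m \<union> sg_map 2 ` sg_approx m)"
    using m[of 2 1] m[of 1 2] sg_map_corner_swap[of 1 2] by (intro connected_Un c) auto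
  have "connected ((sg_map 1 ` sg_approx m \<union> sg_map 2 ` sg_approx m) \<union> sg_map 3 ` sg_approx m)"
    using m[of 3 1] m[of 1 3] sg_map_corner_swap[of 1 3] by (intro connected_Un c 1) auto
  then show ?case by (simp add: Un_assoc)
qed (simp add: connected_sg_triangle)

lemma sg_approx_Suc_subset: "sg_approx (Suc m) \<subseteq> sg_approx m"
proof (induction m)
  case 0 then show ?case using sg_map_sg_triangle by auto
next
  case (Suc m) then show ?case by (simp, blast)
qed

lemma sg_approx_antimono: "m \<le> n \<Longrightarrow> sg_approx n \<subseteq> sg_approx m"
  by (rule lift_Suc_antimono_le[of sg_approx]) (use sg_approx_Suc_subset in auto)

lemma self_similar_subset:
  assumes A: "compact A" "A = (\<Union>i\<in>idx. sg_map i ` A)"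
    and B: "compact B" "B \<noteq> {}" "B = (\<Union>i\<in>idx. sg_map i ` B)"
  shows "A \<subseteq> B"
proof (cases "A = {}")
  case False
  have "continuous_on A (\<lambda>x. infdist x B)" by (intro continuous_intros)
  then obtain a where a: "a \<in> A" "\<And>x. x \<in> A \<Longrightarrow> infdist x B \<le> infdist a B"
    using continuous_attains_sup[OF A(1) False] by blast
  obtain i a' where i: "i \<in> idx" "a' \<in> A" "a = sg_map i a'" using a(1) A(2) by blast
  obtain b where b: "b \<in> B" "infdist a' B = dist a' b"
    using infdist_attains_inf[OF compact_imp_closed[OF B(1)] B(2)] by blast
  have "sg_map i b \<in> B" using B(3) b(1) i(1) by blast
  then have "infdist a B \<le> dist a (sg_map i b)" by (rule infdist_le)
  also have "\<dots> = infdist a' B / 2" by (simp add: i(3) dist_sg_map b(2))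
  also have "\<dots> \<le> infdist a B / 2" using a(2)[OF i(2)] by simp
  finally have "infdist a B \<le> 0" by simp
  then have "infdist x B = 0" if "x \<in> A" for x
    using a(2)[OF that] infdist_nonneg[of x B] by linarith
  then show ?thesis using in_closed_iff_infdist_zero[OF compact_imp_closed[OF B(1)] B(2)] by blast
qed simp

lemma self_similar_Inter: "(\<Inter>m. sg_approx m) = (\<Union>i\<in>idx. sg_map i ` (\<Inter>m. sg_approx m))"
proof
  show "(\<Union>i\<in>idx. sg_map i ` (\<Inter>m. sg_approx m)) \<subseteq> (\<Inter>m. sg_approx m)"
  proof
    fix x assume "x \<in> (\<Union>i\<in>idx. sg_map i ` (\<Inter>m. sg_approx m))"
    then obtain i y where *: "i \<in> idx" "\<And>m. y \<in> sg_approx m" "x = sg_map i y" by blast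
    have "x \<in> sg_approx (Suc m)" for m using * by auto
    then show "x \<in> (\<Inter>m. sg_approx m)" using sg_approx_Suc_subset by blast
  qed
  show "(\<Inter>m. sg_approx m) \<subseteq> (\<Union>i\<in>idx. sg_map i ` (\<Inter>m. sg_approx m))"
  proof
    fix x assume x: "x \<in> (\<Inter>m. sg_approx m)"
    have "\<exists>i\<in>idx. \<forall>m. x \<in> sg_map i ` sg_approx m"
    proof (rule ccontr)
      assume "\<not> ?thesis"
      then obtain M where M: "\<And>i. i \<in> idx \<Longrightarrow> x \<notin> sg_map i ` sg_approx (M i)" by metis
      define n where "n = Max (M ` idx)"
      have "x \<in> sg_approx (Suc n)" using x by blast
      then obtain i where i: "i \<in> idx" "x \<in> sg_map i ` sg_approx n" by auto
      have "M i \<le> n" using i(1) unfolding n_def by (intro Max_ge) auto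
      then show False using M[OF i(1)] i(2) sg_approx_antimono by blast
    qed
    then obtain i where i: "i \<in> idx" "\<And>m. x \<in> sg_map i ` sg_approx m" by blast
    define y where "y = 2 *\<^sub>R x - corner i"
    have "y \<in> sg_approx m" for m using i(2)[of m] by (auto simp: y_def sg_map_eq)
    moreover have "x = sg_map i y" by (simp add: y_def sg_map_eq)
    ultimately show "x \<in> (\<Union>i\<in>idx. sg_map i ` (\<Inter>m. sg_approx m))" using i(1) by blast
  qed
qed

lemma compact_Inter_sg_approx: "compact (\<Inter>m. sg_approx m)"
proof -
  have "closed (\<Inter>m. sg_approx m)" by (intro closed_INT ballI compact_imp_closed compact_sg_approx)
  moreover have "bounded (\<Inter>m. sg_approx m)"
    by (rule bounded_subset[OF compact_imp_bounded[OF compact_sg_approx[of 0]]]) blast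
  ultimately show ?thesis by (simp add: compact_eq_bounded_closed)
qed

lemma sg_eq_Inter: "sg = (\<Inter>m. sg_approx m)"
  unfolding sg_def
proof (rule the_equality)
  have "corner 1 \<in> (\<Inter>m. sg_approx m)" using corner_in_sg_approx by blast
  then show *: "compact (\<Inter>m. sg_approx m) \<and> (\<Inter>m. sg_approx m) \<noteq> {} \<and>
    (\<Inter>m. sg_approx m) = (\<Union>i\<in>idx. sg_map i ` (\<Inter>m. sg_approx m))"
    using self_similar_Inter compact_Inter_sg_approx by blast
  fix K assume "compact K \<and> K \<noteq> {} \<and> K = (\<Union>i\<in>idx. sg_map i ` K)"
  then show "K = (\<Inter>m. sg_approx m)"
    using * self_similar_subset[of K "\<Inter>m. sg_approx m"] self_similar_subset[of "\<Inter>m. sg_approx m" K] by blast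
qed

lemma compact_sg: "compact sg"
  unfolding sg_eq_Inter by (rule compact_Inter_sg_approx)

lemma connected_sg: "connected sg"
  unfolding sg_eq_Inter
  by (intro connected_nest compact_sg_approx connected_sg_approx sg_approx_antimono)

lemma sg_eq_Union: "sg = (\<Union>i\<in>idx. sg_map i ` sg)"
  unfolding sg_eq_Inter by (rule self_similar_Inter)

lemma sg_map_in_sg: "i \<in> idx \<Longrightarrow> x \<in> sg \<Longrightarrow> sg_map i x \<in> sg"
  using sg_eq_Union by blast

lemma sg_cases:
  assumes "x \<in> sg"
  obtains i y where "i \<in> idx" "y \<in> sg" "x = sg_map i y"
  using assms sg_eq_Union by blast

lemma corner_in_sg: "i \<in> idx \<Longrightarrow> corner i \<in> sg"
  unfolding sg_eq_Inter using corner_in_sg_approx by blast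

lemma sg_nonempty: "sg \<noteq> {}"
  using corner_in_sg by blast

lemma sg_subset_triangle: "sg \<subseteq> sg_triangle"
  unfolding sg_eq_Inter using sg_approx.simps(1) by blast

lemma bary_sg_nonneg: "x \<in> sg \<Longrightarrow> k \<in> idx \<Longrightarrow> 0 \<le> bary k x"
  using sg_subset_triangle by (auto simp: sg_triangle_def)

lemma dist_sg_le: "x \<in> sg \<Longrightarrow> y \<in> sg \<Longrightarrow> dist x y \<le> 1"
  using dist_sg_triangle_le sg_subset_triangle by blast

lemma bary_eq_1:
  assumes "x \<in> sg" "i \<in> idx" "bary i x \<ge> 1"
  shows "x = corner i"
proof (rule bary_inject)
  fix k assume "k \<in> idx"
  then show "bary k x = bary k (corner i)"
    using assms(2,3) bary_sum[of x] bary_sg_nonneg[OF assms(1), of 1]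
      bary_sg_nonneg[OF assms(1), of 2] bary_sg_nonneg[OF assms(1), of 3]
    by (auto simp: bary_corner)
qed

lemma sg_map_overlap:
  assumes "x \<in> sg" "y \<in> sg" "i \<in> idx" "j \<in> idx" "i \<noteq> j" "sg_map i x = sg_map j y"
  shows "x = corner j" "y = corner i"
proof -
  have "bary i (sg_map i x) = bary i (sg_map j y)" "bary j (sg_map i x) = bary j (sg_map j y)"
    using assms(6) by simp_all
  then have "bary i y \<ge> 1" "bary j x \<ge> 1"
    using assms(3-5) bary_sg_nonneg[OF assms(1,3)] bary_sg_nonneg[OF assms(2,4)]
    by (simp_all add: bary_sg_map)
  then show "x = corner j" "y = corner i" using assms bary_eq_1 by blast+
qed

lemma sg_vertices_0: "sg_vertices 0 = corner ` idx"
  by (auto simp: corner_def)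

lemma corner_in_sg_vertices: "i \<in> idx \<Longrightarrow> corner i \<in> sg_vertices m"
proof (induction m)
  case 0 then show ?case unfolding sg_vertices_0 by blast
next
  case (Suc m)
  then have "sg_map i (corner i) \<in> sg_vertices (Suc m)" by fastforce
  then show ?case by (simp only: sg_map_corner_self)
qed

lemma sg_vertices_subset_sg: "sg_vertices m \<subseteq> sg"
proof (induction m)
  case 0 then show ?case unfolding sg_vertices_0 using corner_in_sg by blast
next
  case (Suc m) then show ?case using sg_map_in_sg by auto
qed

lemma finite_sg_vertices: "finite (sg_vertices m)"
  by (induction m) auto

lemma sg_vertices_dense: "x \<in> sg \<Longrightarrow> \<exists>y\<in>sg_vertices m. dist x y \<le> 1 / 2 ^ m"
proof (induction m arbitrary: x)
  case 0
  then show ?case using dist_sg_le corner_in_sg[of 1] corner_in_sg_vertices[of 1 0] by force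
next
  case (Suc m)
  from Suc.prems obtain i x' where x': "i \<in> idx" "x' \<in> sg" "x = sg_map i x'" by (rule sg_cases)
  from Suc.IH[OF x'(2)] obtain y where y: "y \<in> sg_vertices m" "dist x' y \<le> 1 / 2 ^ m" by blast
  have "dist x (sg_map i y) \<le> 1 / 2 ^ Suc m"
    using y(2) by (simp add: x'(3) dist_sg_map field_simps)
  moreover have "sg_map i y \<in> sg_vertices (Suc m)" using x'(1) y(1) by auto
  ultimately show ?case by blast
qed

lemma sg_cells_0: "sg_cells 0 = {sg}"
  by (auto simp: sg_cells_def sg_word_map_def)

lemma sg_word_map_Cons: "sg_word_map (i # w) x = sg_map i (sg_word_map w x)"
  by (simp add: sg_word_map_def)

lemma sg_cells_Suc: "sg_cells (Suc m) = (\<Union>i\<in>idx. (\<lambda>C. sg_map i ` C) ` sg_cells m)"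
proof
  show "sg_cells (Suc m) \<subseteq> (\<Union>i\<in>idx. (\<lambda>C. sg_map i ` C) ` sg_cells m)"
  proof
    fix C assume "C \<in> sg_cells (Suc m)"
    then obtain w where w: "C = sg_word_map w ` sg" "length w = Suc m" "set w \<subseteq> idx"
      by (auto simp: sg_cells_def)
    then obtain i v where v: "w = i # v" by (cases w) auto
    have "C = sg_map i ` (sg_word_map v ` sg)" by (simp add: w(1) v sg_word_map_Cons image_image)
    moreover have "sg_word_map v ` sg \<in> sg_cells m" using w v unfolding sg_cells_def by auto
    ultimately show "C \<in> (\<Union>i\<in>idx. (\<lambda>C. sg_map i ` C) ` sg_cells m)" using w(3) v by auto
  qed
  show "(\<Union>i\<in>idx. (\<lambda>C. sg_map i ` C) ` sg_cells m) \<subseteq> sg_cells (Suc m)"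
  proof
    fix C assume "C \<in> (\<Union>i\<in>idx. (\<lambda>C. sg_map i ` C) ` sg_cells m)"
    then obtain i v where v: "i \<in> idx" "C = sg_map i ` (sg_word_map v ` sg)" "length v = m" "set v \<subseteq> idx"
      by (auto simp: sg_cells_def)
    have "C = sg_word_map (i # v) ` sg" by (simp add: v(2) sg_word_map_Cons image_image)
    moreover have "length (i # v) = Suc m" "set (i # v) \<subseteq> idx" using v by auto
    ultimately show "C \<in> sg_cells (Suc m)" unfolding sg_cells_def by blast
  qed
qed

lemma sg_cells_subset: "C \<in> sg_cells m \<Longrightarrow> C \<subseteq> sg"
proof (induction m arbitrary: C)
  case 0 then show ?case by (simp add: sg_cells_0)
next
  case (Suc m) then show ?case unfolding sg_cells_Suc using sg_map_in_sg by auto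
qed

lemma sg_adj_0: "sg_adj 0 x y \<longleftrightarrow> x \<in> sg_vertices 0 \<and> y \<in> sg_vertices 0 \<and> x \<noteq> y"
  using sg_vertices_subset_sg[of 0] unfolding sg_adj_def sg_cells_0 by blast

lemma sg_vertices_Suc_preimage:
  assumes "sg_map i x \<in> sg_vertices (Suc m)" "i \<in> idx" "x \<in> sg"
  shows "x \<in> sg_vertices m"
proof -
  obtain j y where y: "j \<in> idx" "y \<in> sg_vertices m" "sg_map i x = sg_map j y"
    using assms(1) by auto
  show ?thesis
  proof (cases "i = j")
    case True then show ?thesis using y by (simp add: sg_map_inject)
  next
    case False
    then have "x = corner j"
      using sg_map_overlap[of x y i j] assms y sg_vertices_subset_sg by blast
    then show ?thesis using corner_in_sg_vertices y(1) by blast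
  qed
qed

lemma sg_adj_Suc:
  "sg_adj (Suc m) x y \<longleftrightarrow> (\<exists>i\<in>idx. \<exists>x' y'. x = sg_map i x' \<and> y = sg_map i y' \<and> sg_adj m x' y')"
proof
  assume adj: "sg_adj (Suc m) x y"
  then obtain C where C: "C \<in> sg_cells (Suc m)" "x \<in> C" "y \<in> C" by (auto simp: sg_adj_def)
  then obtain i D where D: "i \<in> idx" "D \<in> sg_cells m" "C = sg_map i ` D" unfolding sg_cells_Suc by blast
  then obtain x' y' where xy: "x' \<in> D" "y' \<in> D" "x = sg_map i x'" "y = sg_map i y'" using C by blast
  have "x' \<in> sg" "y' \<in> sg" using sg_cells_subset[OF D(2)] xy by auto
  then have "sg_adj m x' y'"
    using adj xy D sg_vertices_Suc_preimage[OF _ D(1)] unfolding sg_adj_def by blast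
  then show "\<exists>i\<in>idx. \<exists>x' y'. x = sg_map i x' \<and> y = sg_map i y' \<and> sg_adj m x' y'" using xy D by blast
next
  assume "\<exists>i\<in>idx. \<exists>x' y'. x = sg_map i x' \<and> y = sg_map i y' \<and> sg_adj m x' y'"
  then obtain i x' y' where *: "i \<in> idx" "x = sg_map i x'" "y = sg_map i y'" "sg_adj m x' y'" by blast
  then obtain C where C: "C \<in> sg_cells m" "x' \<in> C" "y' \<in> C" by (auto simp: sg_adj_def)
  then have "sg_map i ` C \<in> sg_cells (Suc m)" "x \<in> sg_map i ` C" "y \<in> sg_map i ` C"
    using * unfolding sg_cells_Suc by auto
  moreover have "x \<in> sg_vertices (Suc m)" "y \<in> sg_vertices (Suc m)" using * by (auto simp: sg_adj_def)
  moreover have "x \<noteq> y" using * by (simp add: sg_adj_def sg_map_inject)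
  ultimately show "sg_adj (Suc m) x y" unfolding sg_adj_def by (intro conjI bexI[of _ "sg_map i ` C"])
qed

lemma sg_adjD: "sg_adj m x y \<Longrightarrow> x \<in> sg \<and> y \<in> sg \<and> x \<noteq> y \<and> y \<in> sg_vertices m"
  using sg_vertices_subset_sg by (auto simp: sg_adj_def)

definition nbr_sum :: "nat \<Rightarrow> (real ^ 2 \<Rightarrow> real) \<Rightarrow> real ^ 2 \<Rightarrow> real" where
  "nbr_sum m u x = (\<Sum>y | sg_adj m x y. u y)"

lemma finite_sg_adj: "finite {y. sg_adj m x y}"
  using sg_adjD by (intro finite_subset[OF _ finite_sg_vertices[of m]]) auto

lemma nbr_sum_image: "nbr_sum m (\<lambda>y. u (sg_map i y)) x = (\<Sum>y\<in>sg_map i ` {y. sg_adj m x y}. u y)"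
  unfolding nbr_sum_def by (subst sum.reindex) (auto simp: inj_on_def sg_map_inject)

lemma nbr_sum_interior:
  assumes "i \<in> idx" "x \<in> sg" "x \<notin> sg_vertices 0"
  shows "nbr_sum (Suc m) u (sg_map i x) = nbr_sum m (\<lambda>y. u (sg_map i y)) x"
proof -
  have "{y. sg_adj (Suc m) (sg_map i x) y} = sg_map i ` {y. sg_adj m x y}"
  proof (intro equalityI subsetI)
    fix y assume "y \<in> {y. sg_adj (Suc m) (sg_map i x) y}"
    then obtain j x' y' where *: "j \<in> idx" "sg_map i x = sg_map j x'" "y = sg_map j y'" "sg_adj m x' y'"
      unfolding sg_adj_Suc by blast
    have "i = j"
    proof (rule ccontr)
      assume "i \<noteq> j"
      then have "x = corner j" using sg_map_overlap[of x x' i j] * assms sg_adjD by blast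
      then show False using assms(3) *(1) corner_in_sg_vertices by blast
    qed
    then show "y \<in> sg_map i ` {y. sg_adj m x y}" using * by (simp add: sg_map_inject)
  next
    fix y assume "y \<in> sg_map i ` {y. sg_adj m x y}"
    then show "y \<in> {y. sg_adj (Suc m) (sg_map i x) y}" unfolding sg_adj_Suc using assms(1) by blast
  qed
  then show ?thesis unfolding nbr_sum_image by (simp add: nbr_sum_def)
qed

lemma nbr_sum_corner:
  assumes "j \<in> idx"
  shows "nbr_sum (Suc m) u (corner j) = nbr_sum m (\<lambda>y. u (sg_map j y)) (corner j)"
proof -
  have "{y. sg_adj (Suc m) (corner j) y} = sg_map j ` {y. sg_adj m (corner j) y}"
  proof (intro equalityI subsetI)
    fix y assume "y \<in> {y. sg_adj (Suc m) (corner j) y}"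
    then obtain i x' y' where *: "i \<in> idx" "corner j = sg_map i x'" "y = sg_map i y'" "sg_adj m x' y'"
      unfolding sg_adj_Suc by blast
    have eq: "sg_map j (corner j) = sg_map i x'" using *(2) sg_map_corner_self by metis
    have "i = j"
    proof (rule ccontr)
      assume "i \<noteq> j"
      then have "corner j = corner i"
        using sg_map_overlap(1)[of "corner j" x' j i] * assms sg_adjD eq corner_in_sg by blast
      then show False using corner_inject[OF assms *(1)] \<open>i \<noteq> j\<close> by simp
    qed
    then have "x' = corner j" using eq sg_map_inject by metis
    then show "y \<in> sg_map j ` {y. sg_adj m (corner j) y}" using * \<open>i = j\<close> by blast
  next
    fix y assume "y \<in> sg_map j ` {y. sg_adj m (corner j) y}"
    then have "sg_adj (Suc m) (sg_map j (corner j)) y" unfolding sg_adj_Suc using assms by blast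
    then show "y \<in> {y. sg_adj (Suc m) (corner j) y}" by (simp add: sg_map_corner_self)
  qed
  then show ?thesis unfolding nbr_sum_image by (simp add: nbr_sum_def)
qed

lemma nbr_sum_midpoint:
  assumes "i \<in> idx" "j \<in> idx" "i \<noteq> j"
  shows "nbr_sum (Suc m) u (sg_map i (corner j)) =
    nbr_sum m (\<lambda>y. u (sg_map i y)) (corner j) + nbr_sum m (\<lambda>y. u (sg_map j y)) (corner i)"
proof -
  let ?A = "sg_map i ` {y. sg_adj m (corner j) y}" and ?B = "sg_map j ` {y. sg_adj m (corner i) y}"
  have "{y. sg_adj (Suc m) (sg_map i (corner j)) y} = ?A \<union> ?B"
  proof (intro equalityI subsetI)
    fix y assume "y \<in> {y. sg_adj (Suc m) (sg_map i (corner j)) y}"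
    then obtain k x' y' where *: "k \<in> idx" "sg_map i (corner j) = sg_map k x'" "y = sg_map k y'" "sg_adj m x' y'"
      unfolding sg_adj_Suc by blast
    show "y \<in> ?A \<union> ?B"
    proof (cases "k = i")
      case True
      then have "x' = corner j" using *(2) sg_map_inject by metis
      then show ?thesis using * True by blast
    next
      case False
      then have o: "corner j = corner k" "x' = corner i"
        using sg_map_overlap[of "corner j" x' i k] * assms sg_adjD corner_in_sg by blast+
      then have "k = j" using corner_inject[OF assms(2) *(1)] by simp
      then show ?thesis using * o by blast
    qed
  next
    fix y assume y: "y \<in> ?A \<union> ?B"
    then show "y \<in> {y. sg_adj (Suc m) (sg_map i (corner j)) y}"
    proof
      assume "y \<in> ?B"
      then have "sg_adj (Suc m) (sg_map j (corner i)) y" unfolding sg_adj_Suc using assms by blast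
      then show ?thesis by (simp add: sg_map_corner_swap[of i j])
    qed (use assms in \<open>auto simp: sg_adj_Suc\<close>)
  qed
  moreover have "?A \<inter> ?B = {}"
  proof (rule ccontr)
    assume "?A \<inter> ?B \<noteq> {}"
    then obtain y y' where *: "sg_adj m (corner j) y" "sg_adj m (corner i) y'" "sg_map i y = sg_map j y'" by auto
    then have "y = corner j" using sg_map_overlap[of y y' i j] assms sg_adjD by blast
    then show False using * sg_adjD by blast
  qed
  ultimately show ?thesis
    unfolding nbr_sum_image by (simp add: nbr_sum_def sum.union_disjoint finite_sg_adj)
qed

lemma nbr_sum_0:
  assumes "j \<in> idx"
  shows "nbr_sum 0 u (corner j) = u (corner 1) + u (corner 2) + u (corner 3) - u (corner j)"
proof -
  have c: "corner 1 \<noteq> corner 2" "corner 1 \<noteq> corner 3" "corner 2 \<noteq> corner 3"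
    using corner_inject[of 1 2] corner_inject[of 1 3] corner_inject[of 2 3] by auto
  have "{y. sg_adj 0 (corner j) y} = sg_vertices 0 - {corner j}"
    unfolding sg_adj_0 using corner_in_sg_vertices[OF assms, of 0] by blast
  then have "nbr_sum 0 u (corner j) = (\<Sum>y\<in>sg_vertices 0 - {corner j}. u y)" by (simp add: nbr_sum_def)
  also have "\<dots> = (\<Sum>y\<in>sg_vertices 0. u y) - u (corner j)"
    using corner_in_sg_vertices[OF assms, of 0] finite_sg_vertices[of 0] by (simp add: sum_diff1 del: sg_vertices.simps)
  also have "(\<Sum>y\<in>sg_vertices 0. u y) = u (corner 1) + u (corner 2) + u (corner 3)"
    unfolding sg_vertices_0 using c by simp
  finally show ?thesis .
qed

section \<open>The self-similar measure\<close>

lemma half_power_less: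
  assumes "(e :: real) > 0"
  shows "\<exists>m. 1 / 2 ^ m < e"
  using real_arch_pow_inv[OF assms, of "1/2"] by (simp add: power_divide)

abbreviation digits :: "nat measure" where
  "digits \<equiv> measure_pmf (pmf_of_set idx)"

definition sg_code :: "nat stream \<Rightarrow> real ^ 2" where
  "sg_code s = (\<Sum>n. (1/2) ^ Suc n *\<^sub>R corner (s !! n))"

lemma idx_normalize: "\<exists>j\<in>idx. corner i = corner j \<and> sg_map i = sg_map j"
proof (cases "i \<in> idx")
  case False
  then have "corner i = corner 3 \<and> sg_map i = sg_map 3" by (auto simp: corner_def sg_map_def)
  then show ?thesis by blast
qed blast

lemma norm_corner_le: "norm (corner i) \<le> 1"
proof -
  obtain j where j: "j \<in> idx" "corner i = corner j" using idx_normalize by blast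
  have "corner 1 = 0" by (simp add: corner_def vec_eq_iff forall_2)
  then show ?thesis
    using dist_sg_le[OF corner_in_sg[OF j(1)] corner_in_sg[of 1]] j(2) by (simp add: dist_norm)
qed

lemma summable_half: "summable (\<lambda>n. (1/2 :: real) ^ Suc n)"
  using summable_mult[OF summable_geometric[of "1/2 :: real"], of "1/2"] by simp

lemma summable_sg_code: "summable (\<lambda>n. (1/2) ^ Suc n *\<^sub>R corner (s !! n))"
proof (rule summable_comparison_test'[OF summable_half, of 0])
  fix n
  show "norm ((1/2) ^ Suc n *\<^sub>R corner (s !! n)) \<le> (1/2) ^ Suc n"
    using mult_left_mono[OF norm_corner_le, of "(1/2) ^ Suc n" "s !! n"] by simp
qed

lemma norm_sg_code_le: "norm (sg_code s) \<le> 1"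
proof -
  have "norm (sg_code s) \<le> (\<Sum>n. (1/2) ^ Suc n)"
    unfolding sg_code_def
  proof (rule norm_suminf_le[OF _ summable_half])
    fix n
    show "norm ((1/2) ^ Suc n *\<^sub>R corner (s !! n)) \<le> (1/2) ^ Suc n"
      using mult_left_mono[OF norm_corner_le, of "(1/2) ^ Suc n" "s !! n"] by simp
  qed
  also have "\<dots> = 1" using power_half_series by (simp add: sums_iff)
  finally show ?thesis .
qed

lemma sg_code_SCons: "sg_code (i ## s) = sg_map i (sg_code s)"
proof -
  have "sg_code (i ## s) = (\<Sum>n. (1/2) ^ Suc (Suc n) *\<^sub>R corner (s !! n)) + (1/2) *\<^sub>R corner i"
    unfolding sg_code_def using suminf_split_head[OF summable_sg_code[of "i ## s"]] by simp
  also have "(\<Sum>n. (1/2) ^ Suc (Suc n) *\<^sub>R corner (s !! n)) = (1/2) *\<^sub>R sg_code s"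
    unfolding sg_code_def
    using bounded_linear.suminf[OF bounded_linear_scaleR_right summable_sg_code[of s], of "1/2"] by simp
  finally show ?thesis by (simp add: sg_map_eq algebra_simps)
qed

lemma sg_code_in_sg: "sg_code s \<in> sg"
proof -
  have near: "\<exists>y\<in>sg. dist (sg_code s) y \<le> 2 / 2 ^ m" for m s
  proof (induction m arbitrary: s)
    case 0
    have "corner 1 = 0" by (simp add: corner_def vec_eq_iff forall_2)
    then show ?case using norm_sg_code_le[of s] corner_in_sg[of 1] by (force simp: dist_norm)
  next
    case (Suc m)
    obtain y where y: "y \<in> sg" "dist (sg_code (stl s)) y \<le> 2 / 2 ^ m" using Suc by blast
    obtain j where j: "j \<in> idx" "sg_map (shd s) = sg_map j" using idx_normalize by blast
    have "sg_code s = sg_map j (sg_code (stl s))"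
      using sg_code_SCons[of "shd s" "stl s"] j(2) by simp
    then have "dist (sg_code s) (sg_map j y) \<le> 2 / 2 ^ Suc m" using y(2) by (simp add: dist_sg_map)
    then show ?case using sg_map_in_sg[OF j(1) y(1)] by blast
  qed
  have "infdist (sg_code s) sg \<le> e" if e: "e > 0" for e
  proof -
    obtain m where "1 / 2 ^ m < e / 2" using half_power_less[OF half_gt_zero[OF e]] by blast
    then have "2 / 2 ^ m \<le> e" by (simp add: field_simps)
    moreover obtain y where "y \<in> sg" "dist (sg_code s) y \<le> 2 / 2 ^ m" using near by blast
    ultimately show ?thesis using infdist_le[of y sg "sg_code s"] by linarith
  qed
  then have "infdist (sg_code s) sg = 0"
    by (meson infdist_nonneg antisym field_le_epsilon add_0 le_numeral_extra(3) dense_ge)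
  then show ?thesis
    using in_closed_iff_infdist_zero[OF compact_imp_closed[OF compact_sg] sg_nonempty] by simp
qed

lemma prob_space_digits: "prob_space digits"
  by (rule measure_pmf.prob_space_axioms)

abbreviation digit_streams :: "nat stream measure" where
  "digit_streams \<equiv> stream_space digits"

lemma prob_space_digit_streams: "prob_space digit_streams"
  by (rule prob_space.prob_space_stream_space[OF prob_space_digits])

definition sg_distr :: "(real ^ 2) measure" where
  "sg_distr = distr digit_streams (restrict_space borel sg) sg_code"

lemma measurable_sg_code [measurable]: "sg_code \<in> measurable digit_streams (restrict_space borel sg)"
proof (rule measurable_restrict_space2)
  show "sg_code \<in> borel_measurable digit_streams"
    unfolding sg_code_def
  proof (rule borel_measurable_suminf)
    fix n
    have "(\<lambda>s. s !! n) \<in> measurable digit_streams (count_space UNIV)"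
      using measurable_snth[of n digits] by simp
    then show "(\<lambda>s. (1/2) ^ Suc n *\<^sub>R corner (s !! n)) \<in> borel_measurable digit_streams"
      by (rule measurable_compose) simp
  qed
qed (use sg_code_in_sg in auto)

lemma sets_sg_distr: "sets sg_distr = sets (restrict_space borel sg)"
  by (simp add: sg_distr_def)

lemma space_sg_distr: "space sg_distr = sg"
  by (simp add: sg_distr_def space_restrict_space)

lemma prob_space_sg_distr: "prob_space sg_distr"
  unfolding sg_distr_def using prob_space_digit_streams by (rule prob_space.prob_space_distr) simp

lemma borel_sg: "sg \<in> sets borel"
  using compact_sg by (intro borel_closed compact_imp_closed)

lemma measurable_sg_map_restrict:
  assumes "i \<in> idx"
  shows "sg_map i \<in> measurable (restrict_space borel sg) (restrict_space borel sg)"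
proof (rule measurable_restrict_space3)
  show "sg_map i \<in> borel_measurable borel"
    by (intro borel_measurable_continuous_onI continuous_on_sg_map)
qed (use sg_map_in_sg[OF assms] in auto)

lemma nn_integral_sg_distr:
  assumes [measurable]: "g \<in> borel_measurable (restrict_space borel sg)"
  shows "(\<integral>\<^sup>+x. g x \<partial>sg_distr) = (\<Sum>i\<in>idx. \<integral>\<^sup>+x. g (sg_map i x) \<partial>sg_distr) / 3"
proof -
  have "(\<integral>\<^sup>+x. g x \<partial>sg_distr) = (\<integral>\<^sup>+s. g (sg_code s) \<partial>digit_streams)"
    unfolding sg_distr_def by (rule nn_integral_distr) simp_all
  also have "\<dots> = (\<integral>\<^sup>+i. \<integral>\<^sup>+s. g (sg_code (i ## s)) \<partial>digit_streams \<partial>digits)"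
    by (rule prob_space.nn_integral_stream_space[OF prob_space_digits]) simp
  also have "\<dots> = (\<Sum>i\<in>idx. \<integral>\<^sup>+s. g (sg_code (i ## s)) \<partial>digit_streams) / 3"
    by (subst nn_integral_pmf_of_set) auto
  also have "(\<Sum>i\<in>idx. \<integral>\<^sup>+s. g (sg_code (i ## s)) \<partial>digit_streams)
      = (\<Sum>i\<in>idx. \<integral>\<^sup>+x. g (sg_map i x) \<partial>sg_distr)"
  proof (rule sum.cong[OF refl])
    fix i assume "i \<in> idx"
    from measurable_compose[OF measurable_sg_map_restrict[OF this] assms]
    show "(\<integral>\<^sup>+s. g (sg_code (i ## s)) \<partial>digit_streams) = (\<integral>\<^sup>+x. g (sg_map i x) \<partial>sg_distr)"
      unfolding sg_distr_def by (subst nn_integral_distr) (simp_all add: sg_code_SCons)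
  qed
  finally show ?thesis .
qed

lemma measure_sg_distr:
  assumes A: "A \<in> sets (restrict_space borel sg)"
  shows "measure sg_distr A = (\<Sum>i\<in>idx. measure sg_distr {x\<in>sg. sg_map i x \<in> A}) / 3"
proof -
  interpret prob_space sg_distr by (rule prob_space_sg_distr)
  have B: "{x\<in>sg. sg_map i x \<in> A} \<in> sets sg_distr" if "i \<in> idx" for i
    using measurable_sets[OF measurable_sg_map_restrict[OF that] A]
    by (simp add: vimage_def Int_def space_restrict_space sets_sg_distr conj_commute)
  have "emeasure sg_distr A = (\<integral>\<^sup>+x. indicator A x \<partial>sg_distr)"
    using A by (simp add: sets_sg_distr)
  also have "\<dots> = (\<Sum>i\<in>idx. \<integral>\<^sup>+x. indicator A (sg_map i x) \<partial>sg_distr) / 3"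
    by (rule nn_integral_sg_distr) (use A in simp)
  also have "(\<Sum>i\<in>idx. \<integral>\<^sup>+x. indicator A (sg_map i x) \<partial>sg_distr)
      = (\<Sum>i\<in>idx. ennreal (measure sg_distr {x\<in>sg. sg_map i x \<in> A}))"
  proof (rule sum.cong[OF refl])
    fix i assume i: "i \<in> idx"
    have "(\<integral>\<^sup>+x. indicator A (sg_map i x) \<partial>sg_distr) = (\<integral>\<^sup>+x. indicator {x\<in>sg. sg_map i x \<in> A} x \<partial>sg_distr)"
      by (rule nn_integral_cong) (auto simp: space_sg_distr split: split_indicator)
    then show "(\<integral>\<^sup>+x. indicator A (sg_map i x) \<partial>sg_distr) = ennreal (measure sg_distr {x\<in>sg. sg_map i x \<in> A})"
      using B[OF i] by (simp add: emeasure_eq_measure)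
  qed
  also have "\<dots> = ennreal (\<Sum>i\<in>idx. measure sg_distr {x\<in>sg. sg_map i x \<in> A})"
    by (rule sum_ennreal) simp
  also have "\<dots> / 3 = ennreal ((\<Sum>i\<in>idx. measure sg_distr {x\<in>sg. sg_map i x \<in> A}) / 3)"
    by (subst divide_ennreal[symmetric]) (auto intro: sum_nonneg)
  finally show ?thesis
    by (simp add: emeasure_eq_measure sum_nonneg del: sum.insert)
qed

lemma singleton_in_sets: "x \<in> sg \<Longrightarrow> {x} \<in> sets (restrict_space borel sg)"
  by (simp add: sets_restrict_space_iff borel_sg)

lemma measure_sg_distr_singleton_le: "measure sg_distr {x} \<le> (2/3) ^ m"
proof (induction m arbitrary: x)
  case 0
  then show ?case using prob_space.prob_le_1[OF prob_space_sg_distr] by simp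
next
  case (Suc m)
  interpret prob_space sg_distr by (rule prob_space_sg_distr)
  show ?case
  proof (cases "x \<in> sg")
    case False
    then have "{x} \<notin> sets sg_distr" using sets.sets_into_space[of "{x}" sg_distr] by (auto simp: space_sg_distr)
    then show ?thesis by (simp add: measure_notin_sets)
  next
    case True
    define A where "A = (\<lambda>i. {y\<in>sg. sg_map i y \<in> {x}})"
    have A: "measure sg_distr (A i) \<le> (2/3) ^ m" for i
    proof (cases "A i = {}")
      case False
      then obtain y where "y \<in> A i" by blast
      then have "A i = {y}" by (auto simp: A_def sg_map_inject)
      then show ?thesis using Suc by simp
    qed simp
    have "\<exists>i\<in>idx. A i = {}"
    proof (rule ccontr)
      assume "\<not> ?thesis"
      then obtain y1 y2 y3 where y: "y1 \<in> A 1" "y2 \<in> A 2" "y3 \<in> A 3" by blast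
      have "y1 = corner 2" "y1 = corner 3"
        using y sg_map_overlap(1)[of y1 y2 1 2] sg_map_overlap(1)[of y1 y3 1 3] by (auto simp: A_def)
      then show False using corner_inject[of 2 3] by simp
    qed
    then obtain k where k: "k \<in> idx" "A k = {}" by blast
    have "measure sg_distr {x} = (\<Sum>i\<in>idx. measure sg_distr (A i)) / 3"
      unfolding A_def by (rule measure_sg_distr[OF singleton_in_sets[OF True]])
    also have "(\<Sum>i\<in>idx. measure sg_distr (A i)) \<le> 2 * (2/3) ^ m"
      using k A[of 1] A[of 2] A[of 3] by (auto simp: measure_empty)
    finally show ?thesis by simp
  qed
qed

lemma measure_sg_distr_singleton: "measure sg_distr {x} = 0"
proof (rule antisym)
  have "(\<lambda>m. (2/3 :: real) ^ m) \<longlonglongrightarrow> 0" by (rule LIMSEQ_power_zero) simp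
  then show "measure sg_distr {x} \<le> 0"
    by (rule LIMSEQ_le_const) (use measure_sg_distr_singleton_le in blast)
qed simp

lemma compact_sg_cell: "C \<in> sg_cells m \<Longrightarrow> compact C"
proof (induction m arbitrary: C)
  case 0 then show ?case by (simp add: sg_cells_0 compact_sg)
next
  case (Suc m)
  then show ?case unfolding sg_cells_Suc
    by (auto intro: compact_continuous_image continuous_on_sg_map)
qed

lemma sg_cell_in_sets: "C \<in> sg_cells m \<Longrightarrow> C \<in> sets (restrict_space borel sg)"
  using compact_sg_cell sg_cells_subset
  by (simp add: sets_restrict_space_iff borel_sg borel_closed compact_imp_closed)

lemma measure_sg_distr_cell: "C \<in> sg_cells m \<Longrightarrow> measure sg_distr C = 1 / 3 ^ m"
proof (induction m arbitrary: C)
  case 0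
  then show ?case
    using prob_space.prob_space[OF prob_space_sg_distr] by (simp add: sg_cells_0 space_sg_distr)
next
  case (Suc m)
  interpret prob_space sg_distr by (rule prob_space_sg_distr)
  obtain i D where D: "i \<in> idx" "D \<in> sg_cells m" "C = sg_map i ` D"
    using Suc.prems unfolding sg_cells_Suc by blast
  have j: "measure sg_distr {x\<in>sg. sg_map j x \<in> C} = (if j = i then 1 / 3 ^ m else 0)" if "j \<in> idx" for j
  proof (cases "j = i")
    case True
    have "{x\<in>sg. sg_map j x \<in> C} = D"
      using sg_cells_subset[OF D(2)] by (auto simp: D(3) True sg_map_inject)
    then show ?thesis using Suc.IH[OF D(2)] True by simp
  next
    case False
    have "{x\<in>sg. sg_map j x \<in> C} \<subseteq> {corner i}"
      using sg_map_overlap(1)[OF _ _ that D(1) False] sg_cells_subset[OF D(2)] by (auto simp: D(3))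
    then have "measure sg_distr {x\<in>sg. sg_map j x \<in> C} \<le> measure sg_distr {corner i}"
      by (intro finite_measure_mono) (simp_all add: sets_sg_distr singleton_in_sets corner_in_sg[OF D(1)])
    then show ?thesis using False by (simp add: measure_sg_distr_singleton measure_le_0_iff)
  qed
  have "measure sg_distr C = (\<Sum>j\<in>idx. if j = i then 1 / 3 ^ m else 0) / 3"
    unfolding measure_sg_distr[OF sg_cell_in_sets[OF Suc.prems]]
    by (intro arg_cong2[where f = "(/)"] sum.cong refl j)
  also have "\<dots> = 1 / 3 ^ Suc m" using D(1) by (subst sum.delta) auto
  finally show ?case .
qed

lemma finite_sg_cells: "finite (sg_cells m)"
  by (induction m) (simp_all add: sg_cells_0 sg_cells_Suc)

lemma sg_cells_cover: "x \<in> sg \<Longrightarrow> \<exists>C\<in>sg_cells m. x \<in> C"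
proof (induction m arbitrary: x)
  case 0 then show ?case by (simp add: sg_cells_0)
next
  case (Suc m)
  from Suc.prems obtain i y where y: "i \<in> idx" "y \<in> sg" "x = sg_map i y" by (rule sg_cases)
  obtain C where "C \<in> sg_cells m" "y \<in> C" using Suc.IH y(2) by blast
  then show ?case unfolding sg_cells_Suc using y by blast
qed

lemma dist_sg_cell_le: "C \<in> sg_cells m \<Longrightarrow> x \<in> C \<Longrightarrow> y \<in> C \<Longrightarrow> dist x y \<le> 1 / 2 ^ m"
proof (induction m arbitrary: C x y)
  case 0 then show ?case using dist_sg_le by (simp add: sg_cells_0)
next
  case (Suc m)
  then obtain i D x' y' where *: "D \<in> sg_cells m" "x' \<in> D" "y' \<in> D" "x = sg_map i x'" "y = sg_map i y'"
    unfolding sg_cells_Suc by blast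
  then show ?case using Suc.IH[of D x' y'] by (simp add: dist_sg_map)
qed

lemma sg_cells_Int:
  "C \<in> sg_cells m \<Longrightarrow> D \<in> sg_cells n \<Longrightarrow> m \<le> n \<Longrightarrow> C \<inter> D = D \<or> finite (C \<inter> D)"
proof (induction m arbitrary: C D n)
  case 0 then show ?case using sg_cells_subset by (auto simp: sg_cells_0)
next
  case (Suc m)
  then obtain n' where n': "n = Suc n'" by (cases n) auto
  obtain i C' where C: "i \<in> idx" "C' \<in> sg_cells m" "C = sg_map i ` C'"
    using Suc.prems unfolding sg_cells_Suc by blast
  obtain j D' where D: "j \<in> idx" "D' \<in> sg_cells n'" "D = sg_map j ` D'"
    using Suc.prems unfolding n' sg_cells_Suc by blast
  show ?case
  proof (cases "i = j")
    case True
    have "C \<inter> D = sg_map i ` (C' \<inter> D')" by (auto simp: C(3) D(3) True sg_map_inject)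
    moreover have "C' \<inter> D' = D' \<or> finite (C' \<inter> D')"
      using Suc.IH[OF C(2) D(2)] Suc.prems(3) n' by simp
    ultimately show ?thesis using D(3) True by auto
  next
    case False
    have "C \<inter> D \<subseteq> {sg_map i (corner j)}"
    proof
      fix z assume "z \<in> C \<inter> D"
      then obtain x y where "x \<in> C'" "y \<in> D'" "z = sg_map i x" "sg_map i x = sg_map j y"
        using C(3) D(3) by blast
      then show "z \<in> {sg_map i (corner j)}"
        using sg_map_overlap(1)[OF _ _ C(1) D(1) False] sg_cells_subset[OF C(2)] sg_cells_subset[OF D(2)] by blast
    qed
    then show ?thesis using finite_subset by blast
  qed
qed

definition sg_generator :: "(real ^ 2) set set" where
  "sg_generator = (\<Union>m. sg_cells m) \<union> {S. finite S \<and> S \<subseteq> sg}"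

lemma Int_stable_sg_generator: "Int_stable sg_generator"
proof (rule Int_stableI)
  fix A B assume A: "A \<in> sg_generator" and B: "B \<in> sg_generator"
  have sub: "A \<subseteq> sg" "B \<subseteq> sg" using A B sg_cells_subset by (auto simp: sg_generator_def)
  show "A \<inter> B \<in> sg_generator"
  proof (cases "finite A \<or> finite B")
    case True then show ?thesis using sub by (auto simp: sg_generator_def)
  next
    case False
    then obtain m n where mn: "A \<in> sg_cells m" "B \<in> sg_cells n" using A B by (auto simp: sg_generator_def)
    have "A \<inter> B = A \<or> A \<inter> B = B \<or> finite (A \<inter> B)"
      using sg_cells_Int[OF mn] sg_cells_Int[OF mn(2,1)] by (metis Int_commute nat_le_linear)
    then show ?thesis using A B sub by (auto simp: sg_generator_def)
  qed
qed

lemma sets_restrict_borel_sg: "sets (restrict_space borel sg) = sigma_sets sg sg_generator"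
proof
  show "sigma_sets sg sg_generator \<subseteq> sets (restrict_space borel sg)"
  proof -
    have "sg_generator \<subseteq> sets (restrict_space borel sg)"
    proof
      fix A assume "A \<in> sg_generator"
      then consider m where "A \<in> sg_cells m" | "finite A" "A \<subseteq> sg" by (auto simp: sg_generator_def)
      then show "A \<in> sets (restrict_space borel sg)"
      proof cases
        case 2
        then have "A \<in> sets borel" by (intro borel_closed finite_imp_closed)
        then show ?thesis using 2 by (simp add: sets_restrict_space_iff borel_sg)
      qed (rule sg_cell_in_sets)
    qed
    then show ?thesis
      using sets.sigma_sets_subset[of sg_generator "restrict_space borel sg"] by (simp add: space_restrict_space)
  qed
  have "sets (restrict_space borel sg) = (\<inter>) sg ` sigma_sets UNIV {S. open S}"
    by (simp add: sets_restrict_space borel_def)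
  also have "\<dots> = sigma_sets sg ((\<inter>) sg ` {S. open S})"
    by (rule sigma_sets_Int) (use borel_sg in \<open>simp_all add: borel_def\<close>)
  also have "\<dots> \<subseteq> sigma_sets sg sg_generator"
  proof (rule sigma_sets_mono, safe)
    fix U :: "(real ^ 2) set" assume U: "open U"
    define \<C> where "\<C> = {C \<in> (\<Union>m. sg_cells m). C \<subseteq> U}"
    have "sg \<inter> U = \<Union>\<C>"
    proof
      show "\<Union>\<C> \<subseteq> sg \<inter> U" using sg_cells_subset by (auto simp: \<C>_def)
      show "sg \<inter> U \<subseteq> \<Union>\<C>"
      proof
        fix x assume x: "x \<in> sg \<inter> U"
        then obtain e where e: "e > 0" "ball x e \<subseteq> U" using U openE by blast
        obtain m where m: "1 / 2 ^ m < e" using half_power_less[OF e(1)] by blast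
        obtain C where C: "C \<in> sg_cells m" "x \<in> C" using sg_cells_cover[of x m] x by blast
        have "C \<subseteq> ball x e"
        proof
          fix y assume "y \<in> C"
          from dist_sg_cell_le[OF C this] m show "y \<in> ball x e" by simp
        qed
        then show "x \<in> \<Union>\<C>" using C e(2) by (auto simp: \<C>_def)
      qed
    qed
    moreover have "countable \<C>"
    proof (rule countable_subset)
      show "\<C> \<subseteq> (\<Union>m. sg_cells m)" unfolding \<C>_def by (rule Collect_restrict)
      show "countable (\<Union>m. sg_cells m)"
        by (rule countable_UN) (simp_all add: countable_finite finite_sg_cells)
    qed
    moreover have "\<C> \<subseteq> sigma_sets sg sg_generator"
      by (auto simp: \<C>_def sg_generator_def intro: sigma_sets.Basic)
    ultimately show "sg \<inter> U \<in> sigma_sets sg sg_generator"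
      using sigma_sets_UNION[of \<C> sg sg_generator] by auto
  qed
  finally show "sets (restrict_space borel sg) \<subseteq> sigma_sets sg sg_generator" .
qed

lemma sg_measure_eq_distr: "sg_measure = sg_distr"
  unfolding sg_measure_def
proof (rule the_equality)
  show 1: "sets sg_distr = sets (restrict_space borel sg) \<and> prob_space sg_distr \<and>
      (\<forall>m. \<forall>C\<in>sg_cells m. measure sg_distr C = 1 / 3 ^ m)"
    using sets_sg_distr prob_space_sg_distr measure_sg_distr_cell by blast
  fix M :: "(real ^ 2) measure"
  assume 2: "sets M = sets (restrict_space borel sg) \<and> prob_space M \<and>
      (\<forall>m. \<forall>C\<in>sg_cells m. measure M C = 1 / 3 ^ m)"
  have null: "emeasure N S = 0" if N: "sets N = sets (restrict_space borel sg) \<and> prob_space N \<and>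
      (\<forall>m. \<forall>C\<in>sg_cells m. measure N C = 1 / 3 ^ m)" and S: "finite S" "S \<subseteq> sg" for N S
  proof -
    interpret prob_space N using N by simp
    have "measure N {x} \<le> 1 / 3 ^ m" if x: "x \<in> sg" for x m
    proof -
      obtain C where C: "C \<in> sg_cells m" "x \<in> C" using sg_cells_cover[OF x, of m] by blast
      then have "measure N {x} \<le> measure N C"
        using N sg_cell_in_sets by (intro finite_measure_mono) auto
      then show ?thesis using N C by simp
    qed
    moreover have "(\<lambda>m. 1 / 3 ^ m :: real) \<longlonglongrightarrow> 0"
      using LIMSEQ_power_zero[of "1/3 :: real"] by (simp add: power_divide)
    ultimately have "measure N {x} \<le> 0" if "x \<in> sg" for x
      using that by (intro LIMSEQ_le_const[of "\<lambda>m. 1 / 3 ^ m :: real"]) blast+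
    then have x: "{x} \<in> null_sets N" if "x \<in> sg" for x
      using that N singleton_in_sets by (auto simp: null_sets_def emeasure_eq_measure measure_le_0_iff)
    have "(\<Union>x\<in>S. {x}) \<in> null_sets N"
      using S x by (intro null_sets_UN' countable_finite) auto
    then show ?thesis by auto
  qed
  show "M = sg_distr"
  proof (rule measure_eqI_generator_eq[OF Int_stable_sg_generator, of sg])
    show "sg_generator \<subseteq> Pow sg" using sg_cells_subset by (auto simp: sg_generator_def)
    fix X assume "X \<in> sg_generator"
    then consider m where "X \<in> sg_cells m" | "finite X" "X \<subseteq> sg" by (auto simp: sg_generator_def)
    then show "emeasure M X = emeasure sg_distr X"
    proof cases
      case 1
      interpret M: prob_space M using 2 by simp
      interpret D: prob_space sg_distr by (rule prob_space_sg_distr)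
      show ?thesis using 1 2 measure_sg_distr_cell by (simp add: M.emeasure_eq_measure D.emeasure_eq_measure)
    next
      case 2
      then show ?thesis using null[OF 1] null[OF \<open>sets M = _ \<and> _\<close>] by simp
    qed
  next
    show "sets M = sigma_sets sg sg_generator" "sets sg_distr = sigma_sets sg sg_generator"
      using 2 sets_sg_distr sets_restrict_borel_sg by simp_all
    show "range (\<lambda>_::nat. sg) \<subseteq> sg_generator"
      using sg_cells_0 by (auto simp: sg_generator_def)
    interpret M: prob_space M using 2 by simp
    show "emeasure M sg \<noteq> \<infinity>" by (simp add: M.emeasure_eq_measure)
  qed simp
qed

lemma prob_space_sg_measure: "prob_space sg_measure"
  by (simp add: sg_measure_eq_distr prob_space_sg_distr)

lemma space_sg_measure [simp]: "space sg_measure = sg"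
  by (simp add: sg_measure_eq_distr space_sg_distr)

lemma sets_sg_measure: "sets sg_measure = sets (restrict_space borel sg)"
  by (simp add: sg_measure_eq_distr sets_sg_distr)

lemma measurable_sg_continuous: "continuous_on sg g \<Longrightarrow> g \<in> borel_measurable sg_measure"
  using borel_measurable_continuous_on_restrict[of sg g] measurable_cong_sets[OF sets_sg_measure refl] by blast

lemma sg_continuous_bounded:
  fixes g :: "real ^ 2 \<Rightarrow> real"
  assumes "continuous_on sg g"
  obtains K where "K \<ge> 0" "\<And>x. x \<in> sg \<Longrightarrow> \<bar>g x\<bar> \<le> K"
proof -
  have "bounded (g ` sg)" by (intro compact_imp_bounded compact_continuous_image assms compact_sg)
  then obtain K where "\<And>x. x \<in> sg \<Longrightarrow> \<bar>g x\<bar> \<le> K" by (auto simp: bounded_iff)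
  then show ?thesis using that[of "max K 0"] by fastforce
qed

lemma integrable_sg:
  fixes g :: "real ^ 2 \<Rightarrow> real"
  assumes "continuous_on sg g"
  shows "integrable sg_measure g"
proof -
  interpret prob_space sg_measure by (rule prob_space_sg_measure)
  obtain K where "\<And>x. x \<in> sg \<Longrightarrow> \<bar>g x\<bar> \<le> K" using sg_continuous_bounded[OF assms] by blast
  then show ?thesis
    using measurable_sg_continuous[OF assms] by (intro integrable_const_bound[of _ K]) auto
qed

lemma continuous_on_sg_comp:
  "i \<in> idx \<Longrightarrow> continuous_on sg g \<Longrightarrow> continuous_on sg (\<lambda>x. g (sg_map i x))"
  using sg_map_in_sg by (intro continuous_on_compose2[OF _ continuous_on_sg_map, of sg]) auto

lemma integral_sg_self_similar:
  fixes g :: "real ^ 2 \<Rightarrow> real"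
  assumes g: "continuous_on sg g"
  shows "(LINT x|sg_measure. g x) = (\<Sum>i\<in>idx. LINT x|sg_measure. g (sg_map i x)) / 3"
proof -
  interpret prob_space sg_measure by (rule prob_space_sg_measure)
  obtain K where K: "K \<ge> 0" "\<And>x. x \<in> sg \<Longrightarrow> \<bar>g x\<bar> \<le> K" using sg_continuous_bounded[OF g] by blast
  define h where "h = (\<lambda>x. g x + K)"
  have h: "continuous_on sg h" unfolding h_def by (intro continuous_intros g)
  have h0: "x \<in> sg \<Longrightarrow> 0 \<le> h x" for x using K(2)[of x] by (simp add: h_def)
  have nn: "(\<integral>\<^sup>+x. ennreal (k x) \<partial>sg_measure) = ennreal (LINT x|sg_measure. k x)"
    if "continuous_on sg k" "\<And>x. x \<in> sg \<Longrightarrow> 0 \<le> k x" for k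
    using that by (intro nn_integral_eq_integral integrable_sg) auto
  have hi: "continuous_on sg (\<lambda>x. h (sg_map i x))" "\<And>x. x \<in> sg \<Longrightarrow> 0 \<le> h (sg_map i x)" if "i \<in> idx" for i
    using continuous_on_sg_comp[OF that h] h0 sg_map_in_sg[OF that] by auto
  have pos: "0 \<le> (LINT x|sg_measure. h (sg_map i x))" if "i \<in> idx" for i
    using hi(2)[OF that] by (intro integral_nonneg_AE) auto
  have "ennreal (LINT x|sg_measure. h x) = (\<integral>\<^sup>+x. ennreal (h x) \<partial>sg_measure)"
    by (rule nn[symmetric]) (use h h0 in auto)
  also have "\<dots> = (\<Sum>i\<in>idx. \<integral>\<^sup>+x. ennreal (h (sg_map i x)) \<partial>sg_measure) / 3"
    unfolding sg_measure_eq_distr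
    by (rule nn_integral_sg_distr)
       (use borel_measurable_continuous_on_restrict[OF h] in measurable)
  also have "(\<Sum>i\<in>idx. \<integral>\<^sup>+x. ennreal (h (sg_map i x)) \<partial>sg_measure)
      = (\<Sum>i\<in>idx. ennreal (LINT x|sg_measure. h (sg_map i x)))"
    by (intro sum.cong refl nn hi) auto
  also have "\<dots> = ennreal (\<Sum>i\<in>idx. LINT x|sg_measure. h (sg_map i x))"
    by (rule sum_ennreal) (rule pos)
  also have "\<dots> / 3 = ennreal ((\<Sum>i\<in>idx. LINT x|sg_measure. h (sg_map i x)) / 3)"
    using pos by (subst divide_ennreal[symmetric]) (auto intro!: add_nonneg_nonneg)
  finally have *: "(LINT x|sg_measure. h x) = (\<Sum>i\<in>idx. LINT x|sg_measure. h (sg_map i x)) / 3"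
    using h0 pos by (subst (asm) ennreal_inj) (auto intro!: add_nonneg_nonneg integral_nonneg_AE)
  have "(LINT x|sg_measure. h x) = (LINT x|sg_measure. g x) + K"
    unfolding h_def by (subst Bochner_Integration.integral_add) (auto intro: integrable_sg g simp: prob_space[unfolded space_sg_measure])
  moreover have "(LINT x|sg_measure. h (sg_map i x)) = (LINT x|sg_measure. g (sg_map i x)) + K" if "i \<in> idx" for i
    unfolding h_def by (subst Bochner_Integration.integral_add)
      (auto intro: integrable_sg continuous_on_sg_comp[OF that] g simp: prob_space[unfolded space_sg_measure])
  ultimately show ?thesis using * by simp
qed

lemma measure_sg_measure_cell: "C \<in> sg_cells m \<Longrightarrow> measure sg_measure C = 1 / 3 ^ m"
  by (simp add: sg_measure_eq_distr measure_sg_distr_cell)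

lemma integral_sg_eq_0_imp:
  fixes g :: "real ^ 2 \<Rightarrow> real"
  assumes g: "continuous_on sg g" "\<And>x. x \<in> sg \<Longrightarrow> 0 \<le> g x" and zero: "(LINT x|sg_measure. g x) = 0"
    and x: "x \<in> sg"
  shows "g x = 0"
proof (rule ccontr)
  interpret prob_space sg_measure by (rule prob_space_sg_measure)
  assume "g x \<noteq> 0"
  then have gx: "g x > 0" using g(2)[OF x] by simp
  obtain e where e: "e > 0" "\<And>y. y \<in> sg \<Longrightarrow> dist y x < e \<Longrightarrow> dist (g y) (g x) < g x / 2"
    using g(1)[unfolded continuous_on_iff, rule_format, OF x half_gt_zero[OF gx]] by blast
  obtain m where m: "1 / 2 ^ m < e" using half_power_less[OF e(1)] by blast
  obtain C where C: "C \<in> sg_cells m" "x \<in> C" using sg_cells_cover[of x m] x by blast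
  have meas: "C \<in> sets sg_measure" using sg_cell_in_sets[OF C(1)] by (simp add: sets_sg_measure)
  have le: "g x / 2 * indicator C y \<le> g y" if "y \<in> sg" for y
  proof (cases "y \<in> C")
    case True
    have "dist y x \<le> 1 / 2 ^ m" using dist_sg_cell_le[OF C(1) True C(2)] .
    also have "\<dots> < e" by (rule m)
    finally have "\<bar>g y - g x\<bar> < g x / 2" using e(2)[OF that] by (simp add: dist_real_def)
    then have "g x / 2 \<le> g y" by linarith
    then show ?thesis using True by simp
  qed (use g(2)[OF that] in simp)
  have "(LINT y|sg_measure. g x / 2 * indicator C y) \<le> (LINT y|sg_measure. g y)"
  proof (rule integral_mono[OF _ integrable_sg[OF g(1)]])
    show "integrable sg_measure (\<lambda>y. g x / 2 * indicator C y)"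
      using meas by (intro integrable_mult_right integrable_real_indicator) (simp_all add: emeasure_eq_measure)
  qed (use le in simp)
  moreover have "(LINT y|sg_measure. g x / 2 * indicator C y) = g x / 2 * (1 / 3 ^ m)"
    using sg_cells_subset[OF C(1)] by (simp add: measure_sg_measure_cell[OF C(1)] Int_absorb2)
  moreover have "g x / 2 * (1 / 3 ^ m) > 0" using gx by simp
  ultimately show False using zero by linarith
qed

section \<open>The pre-Hilbert space of continuous functions on the gasket\<close>

typedef sgfun = "{u :: real ^ 2 \<Rightarrow> real. continuous_on sg u \<and> (\<forall>x. x \<notin> sg \<longrightarrow> u x = 0)}"
  morphisms val Sgfun
  by (rule exI[of _ "\<lambda>_. 0"]) simp

definition mk :: "(real ^ 2 \<Rightarrow> real) \<Rightarrow> sgfun" where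
  "mk g = Sgfun (\<lambda>x. if x \<in> sg then g x else 0)"

lemma val_mk: "continuous_on sg g \<Longrightarrow> val (mk g) = (\<lambda>x. if x \<in> sg then g x else 0)"
  unfolding mk_def by (rule Sgfun_inverse) (auto cong: continuous_on_cong)

lemma continuous_on_val [continuous_intros]: "continuous_on sg (val u)"
  using val[of u] by simp

lemma val_outside: "x \<notin> sg \<Longrightarrow> val u x = 0"
  using val[of u] by simp

lemma sgfun_eqI: "(\<And>x. x \<in> sg \<Longrightarrow> val u x = val v x) \<Longrightarrow> u = v"
  using val_inject[of u v] val_outside by (metis ext)

instantiation sgfun :: real_inner
begin

definition zero_sgfun :: sgfun where "zero_sgfun = mk (\<lambda>_. 0)"
definition plus_sgfun :: "sgfun \<Rightarrow> sgfun \<Rightarrow> sgfun" where "plus_sgfun u v = mk (\<lambda>x. val u x + val v x)"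
definition minus_sgfun :: "sgfun \<Rightarrow> sgfun \<Rightarrow> sgfun" where "minus_sgfun u v = mk (\<lambda>x. val u x - val v x)"
definition uminus_sgfun :: "sgfun \<Rightarrow> sgfun" where "uminus_sgfun u = mk (\<lambda>x. - val u x)"
definition scaleR_sgfun :: "real \<Rightarrow> sgfun \<Rightarrow> sgfun" where "scaleR_sgfun c u = mk (\<lambda>x. c * val u x)"
definition inner_sgfun :: "sgfun \<Rightarrow> sgfun \<Rightarrow> real" where "inner_sgfun u v = (LINT x|sg_measure. val u x * val v x)"
definition norm_sgfun :: "sgfun \<Rightarrow> real" where "norm_sgfun u = sqrt (inner u u)"
definition sgn_sgfun :: "sgfun \<Rightarrow> sgfun" where "sgn_sgfun u = scaleR (inverse (norm u)) u"
definition dist_sgfun :: "sgfun \<Rightarrow> sgfun \<Rightarrow> real" where "dist_sgfun u v = norm (u - v)"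
definition uniformity_sgfun :: "(sgfun \<times> sgfun) filter" where
  "uniformity_sgfun = (INF e\<in>{0<..}. principal {(x, y). dist x y < e})"
definition open_sgfun :: "sgfun set \<Rightarrow> bool" where
  "open_sgfun U \<longleftrightarrow> (\<forall>x\<in>U. eventually (\<lambda>(x', y). x' = x \<longrightarrow> y \<in> U) uniformity)"

lemma val_simps:
  "val 0 x = 0" "val (u + v) x = val u x + val v x" "val (u - v) x = val u x - val v x"
  "val (- u) x = - val u x" "val (c *\<^sub>R u) x = c * val u x"
  by (simp_all add: zero_sgfun_def plus_sgfun_def minus_sgfun_def uminus_sgfun_def scaleR_sgfun_def
      val_mk continuous_intros val_outside)

instance
proof
  fix u v w :: sgfun and a b r :: real
  show "u + v + w = u + (v + w)" "u + v = v + u" "0 + u = u" "- u + u = 0" "u - v = u + - v"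
    "a *\<^sub>R (u + v) = a *\<^sub>R u + a *\<^sub>R v" "(a + b) *\<^sub>R u = a *\<^sub>R u + b *\<^sub>R u"
    "a *\<^sub>R b *\<^sub>R u = (a * b) *\<^sub>R u" "1 *\<^sub>R u = u"
    by (rule sgfun_eqI; simp add: val_simps algebra_simps)+
  show "inner u v = inner v u" by (simp add: inner_sgfun_def mult.commute)
  show "inner (u + v) w = inner u w + inner v w"
    unfolding inner_sgfun_def val_simps distrib_right
    by (intro Bochner_Integration.integral_add integrable_sg continuous_intros)
  show "inner (r *\<^sub>R u) v = r * inner u v"
    unfolding inner_sgfun_def val_simps by (simp add: mult.assoc)
  show "0 \<le> inner u u" unfolding inner_sgfun_def by (intro integral_nonneg_AE) simp
  show "inner u u = 0 \<longleftrightarrow> u = 0"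
  proof
    assume "inner u u = 0"
    then have "val u x * val u x = 0" if "x \<in> sg" for x
      using integral_sg_eq_0_imp[of "\<lambda>x. val u x * val u x" x] that
      by (simp add: inner_sgfun_def continuous_intros)
    then show "u = 0" by (intro sgfun_eqI) (simp add: val_simps)
  qed (simp add: inner_sgfun_def val_simps)
qed (simp_all add: norm_sgfun_def sgn_sgfun_def dist_sgfun_def uniformity_sgfun_def open_sgfun_def)

end

lemma val_sum: "val (\<Sum>i\<in>A. f i) x = (\<Sum>i\<in>A. val (f i) x)"
  by (induction A rule: infinite_finite_induct) (simp_all add: val_simps)

lemma sg_map_in_sg_any: "x \<in> sg \<Longrightarrow> sg_map i x \<in> sg"
  using idx_normalize[of i] sg_map_in_sg by metis

definition pull :: "nat \<Rightarrow> sgfun \<Rightarrow> sgfun" where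
  "pull i u = mk (\<lambda>x. val u (sg_map i x))"

lemma continuous_on_val_sg_map [continuous_intros]: "continuous_on sg (\<lambda>x. val u (sg_map i x))"
  by (rule continuous_on_compose2[OF continuous_on_val continuous_on_sg_map])
     (use sg_map_in_sg_any in auto)

lemma val_pull: "x \<in> sg \<Longrightarrow> val (pull i u) x = val u (sg_map i x)"
  by (simp add: pull_def val_mk continuous_on_val_sg_map)

lemma linear_pull: "linear (pull i)"
  by (rule linearI; rule sgfun_eqI) (simp_all add: val_pull val_simps)

lemma pull_0: "pull i 0 = 0" and pull_add: "pull i (u + v) = pull i u + pull i v"
  and pull_diff: "pull i (u - v) = pull i u - pull i v" and pull_scaleR: "pull i (c *\<^sub>R u) = c *\<^sub>R pull i u"
  by (simp_all add: linear_0 linear_add linear_diff linear_scale linear_pull)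

lemma pull_sum: "pull i (\<Sum>k\<in>A. f k) = (\<Sum>k\<in>A. pull i (f k))"
  by (rule linear_sum[OF linear_pull])

lemma sgfun_eqI_pull:
  assumes "\<And>i. i \<in> idx \<Longrightarrow> pull i u = pull i v"
  shows "u = v"
proof (rule sgfun_eqI)
  fix x assume "x \<in> sg"
  then obtain i y where y: "i \<in> idx" "y \<in> sg" "x = sg_map i y" by (rule sg_cases)
  then show "val u x = val v x" using assms[OF y(1)] val_pull[OF y(2), of i] by metis
qed

lemma inner_pull: "inner u v = (\<Sum>i\<in>idx. inner (pull i u) (pull i v)) / 3"
proof -
  have "inner (pull i u) (pull i v) = (LINT x|sg_measure. val u (sg_map i x) * val v (sg_map i x))" for i
    unfolding inner_sgfun_def by (rule Bochner_Integration.integral_cong) (simp_all add: val_pull)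
  then show ?thesis
    unfolding inner_sgfun_def[of u v]
    by (subst integral_sg_self_similar) (simp_all add: continuous_intros)
qed

lemma norm_pull_le: "i \<in> idx \<Longrightarrow> norm (pull i u) \<le> 2 * norm u"
proof -
  assume "i \<in> idx"
  then have "inner (pull i u) (pull i u) \<le> (\<Sum>i\<in>idx. inner (pull i u) (pull i u))"
    by (intro member_le_sum) auto
  also have "\<dots> = 3 * inner u u" using inner_pull[of u u] by simp
  also have "\<dots> \<le> (2 * norm u)\<^sup>2" by (simp add: dot_square_norm power_mult_distrib)
  finally have "(norm (pull i u))\<^sup>2 \<le> (2 * norm u)\<^sup>2" by (simp only: dot_square_norm)
  then show ?thesis by (rule power2_le_imp_le) simp
qed

lemma norm_le_if_bounded:
  assumes "\<And>x. x \<in> sg \<Longrightarrow> \<bar>val u x\<bar> \<le> K"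
  shows "norm u \<le> K"
proof -
  interpret prob_space sg_measure by (rule prob_space_sg_measure)
  have K: "K \<ge> 0" using assms[OF corner_in_sg[of 1]] by simp
  have "inner u u \<le> (LINT x|sg_measure. K * K)"
    unfolding inner_sgfun_def
  proof (rule integral_mono)
    fix x assume "x \<in> space sg_measure"
    then have "\<bar>val u x\<bar> * \<bar>val u x\<bar> \<le> K * K" using assms K by (intro mult_mono) auto
    then show "val u x * val u x \<le> K * K" by simp
  qed (auto intro!: integrable_sg continuous_intros)
  then have "inner u u \<le> K * K" by (simp add: prob_space[unfolded space_sg_measure])
  then have "(norm u)\<^sup>2 \<le> K\<^sup>2" by (simp only: dot_square_norm power2_eq_square[of K])
  then show ?thesis using K by (rule power2_le_imp_le)
qed

definition compatible :: "(nat \<Rightarrow> sgfun) \<Rightarrow> bool" where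
  "compatible v \<longleftrightarrow> (\<forall>i\<in>idx. \<forall>j\<in>idx. val (v i) (corner j) = val (v j) (corner i))"

definition glue :: "(nat \<Rightarrow> sgfun) \<Rightarrow> sgfun" where
  "glue v = mk (\<lambda>x. if x \<in> sg_map 1 ` sg then val (v 1) (2 *\<^sub>R x - corner 1)
                    else if x \<in> sg_map 2 ` sg then val (v 2) (2 *\<^sub>R x - corner 2)
                    else val (v 3) (2 *\<^sub>R x - corner 3))"

lemma sg_map_inverse: "2 *\<^sub>R sg_map i x - corner i = x"
  by (simp add: sg_map_eq)

lemma pull_glue:
  assumes "compatible v" "i \<in> idx"
  shows "pull i (glue v) = v i"
proof -
  define G where "G = (\<lambda>x. if x \<in> sg_map 1 ` sg then val (v 1) (2 *\<^sub>R x - corner 1)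
                    else if x \<in> sg_map 2 ` sg then val (v 2) (2 *\<^sub>R x - corner 2)
                    else val (v 3) (2 *\<^sub>R x - corner 3))"
  have same: "val (v i) x = val (v j) y" if "i \<in> idx" "j \<in> idx" "x \<in> sg" "y \<in> sg" "sg_map i x = sg_map j y" for i j x y
  proof (cases "i = j")
    case True then show ?thesis using that by (simp add: sg_map_inject)
  next
    case False
    then show ?thesis
      using sg_map_overlap[OF that(3,4,1,2) False that(5)] assms(1) that(1,2) unfolding compatible_def by metis
  qed
  have G: "G (sg_map i x) = val (v i) x" if i: "i \<in> idx" and x: "x \<in> sg" for i x
  proof -
    obtain j y where j: "j \<in> idx" "y \<in> sg" "sg_map i x = sg_map j y"
      "G (sg_map i x) = val (v j) (2 *\<^sub>R sg_map i x - corner j)"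
    proof (cases "sg_map i x \<in> sg_map 1 ` sg")
      case True
      then obtain y where "y \<in> sg" "sg_map i x = sg_map 1 y" by blast
      then show ?thesis using True by (intro that[of 1 y]) (simp_all add: G_def)
    next
      case F1: False
      show ?thesis
      proof (cases "sg_map i x \<in> sg_map 2 ` sg")
        case True
        then obtain y where "y \<in> sg" "sg_map i x = sg_map 2 y" by blast
        then show ?thesis using True F1 by (intro that[of 2 y]) (simp_all add: G_def)
      next
        case False
        then have "i = 3" using F1 i x by auto
        then show ?thesis using False F1 x by (intro that[of 3 x]) (simp_all add: G_def)
      qed
    qed
    then have "G (sg_map i x) = val (v j) y" using sg_map_inverse[of j y] by simp
    then show ?thesis using same[OF i j(1) x j(2,3)] by simp
  qed
  have "continuous_on (\<Union>i\<in>idx. sg_map i ` sg) G"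
  proof (rule continuous_on_closed_Union)
    fix i assume i: "i \<in> idx"
    show "closed (sg_map i ` sg)"
      by (intro compact_imp_closed compact_continuous_image continuous_on_sg_map compact_sg)
    have "continuous_on (sg_map i ` sg) (\<lambda>x. val (v i) (2 *\<^sub>R x - corner i))"
      by (rule continuous_on_compose2[OF continuous_on_val]) (auto intro!: continuous_intros simp: sg_map_inverse)
    then show "continuous_on (sg_map i ` sg) G"
      by (rule continuous_on_eq) (auto simp: sg_map_inverse G[OF i])
  qed simp
  then have cont: "continuous_on sg G" using sg_eq_Union by simp
  show ?thesis
  proof (rule sgfun_eqI)
    fix x assume x: "x \<in> sg"
    have "val (pull i (glue v)) x = G (sg_map i x)"
      using x sg_map_in_sg[OF assms(2) x] unfolding val_pull[OF x] glue_def G_def[symmetric] val_mk[OF cont] by simp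
    then show "val (pull i (glue v)) x = val (v i) x" using G[OF assms(2) x] by simp
  qed
qed

lemma val_glue: "compatible v \<Longrightarrow> i \<in> idx \<Longrightarrow> x \<in> sg \<Longrightarrow> val (glue v) (sg_map i x) = val (v i) x"
  using pull_glue val_pull by metis

lemma sup_Cauchy_limit:
  assumes "\<And>e. e > 0 \<Longrightarrow> \<exists>N. \<forall>m\<ge>N. \<forall>n\<ge>N. \<forall>x\<in>sg. \<bar>val (f m) x - val (f n) x\<bar> < e"
  shows "\<exists>g. (\<forall>x\<in>sg. (\<lambda>n. val (f n) x) \<longlonglongrightarrow> val g x) \<and> f \<longlonglongrightarrow> g"
proof -
  have "uniformly_convergent_on sg (\<lambda>n. val (f n))"
  proof (rule Cauchy_uniformly_convergent, unfold uniformly_Cauchy_on_def, intro allI impI)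
    fix e :: real assume "e > 0"
    from assms[OF this] obtain N where "\<forall>m\<ge>N. \<forall>n\<ge>N. \<forall>x\<in>sg. \<bar>val (f m) x - val (f n) x\<bar> < e" by blast
    then show "\<exists>M. \<forall>x\<in>sg. \<forall>m\<ge>M. \<forall>n\<ge>M. dist (val (f m) x) (val (f n) x) < e"
      by (intro exI[of _ N]) (simp add: dist_real_def)
  qed
  then obtain l where l: "uniform_limit sg (\<lambda>n. val (f n)) l sequentially"
    by (auto simp: uniformly_convergent_on_def)
  have cont: "continuous_on sg l"
    by (rule uniform_limit_theorem[OF _ l]) (simp_all add: continuous_on_val)
  define g where "g = mk l"
  have g: "val g x = l x" if "x \<in> sg" for x using that by (simp add: g_def val_mk[OF cont])
  have "f \<longlonglongrightarrow> g"
  proof (rule LIMSEQ_I)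
    fix r :: real assume "r > 0"
    then have "\<forall>\<^sub>F n in sequentially. \<forall>x\<in>sg. dist (val (f n) x) (l x) < r / 2"
      using l unfolding uniform_limit_iff by (meson half_gt_zero)
    then obtain N where N: "\<And>n x. n \<ge> N \<Longrightarrow> x \<in> sg \<Longrightarrow> dist (val (f n) x) (l x) < r / 2"
      unfolding eventually_sequentially by blast
    have "norm (f n - g) \<le> r / 2" if "n \<ge> N" for n
      by (rule norm_le_if_bounded) (use N[OF that] in \<open>force simp: val_simps g dist_real_def\<close>)
    then show "\<exists>N. \<forall>n\<ge>N. norm (f n - g) < r" using \<open>r > 0\<close> by (intro exI[of _ N]) force
  qed
  moreover have "(\<lambda>n. val (f n) x) \<longlonglongrightarrow> val g x" if "x \<in> sg" for x
    using tendsto_uniform_limitI[OF l that] g[OF that] by simp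
  ultimately show ?thesis by blast
qed

lemma geometric_increments:
  fixes a :: "nat \<Rightarrow> real"
  assumes "\<And>n. \<bar>a (Suc n) - a n\<bar> \<le> C * q ^ n" "0 \<le> q" "q < 1"
  shows "\<bar>a (n + k) - a n\<bar> \<le> C * q ^ n / (1 - q)"
proof -
  have "\<bar>a (n + k) - a n\<bar> \<le> C * q ^ n * (1 - q ^ k) / (1 - q)" for k
  proof (induction k)
    case (Suc k)
    have "\<bar>a (n + Suc k) - a n\<bar> \<le> \<bar>a (Suc (n + k)) - a (n + k)\<bar> + \<bar>a (n + k) - a n\<bar>" by simp
    also have "\<dots> \<le> C * q ^ (n + k) + C * q ^ n * (1 - q ^ k) / (1 - q)"
      by (intro add_mono assms(1) Suc)
    also have "\<dots> = C * q ^ n * (1 - q ^ Suc k) / (1 - q)"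
      using assms(3) by (simp add: field_simps power_add)
    finally show ?case .
  qed simp
  also have "C * q ^ n * (1 - q ^ k) / (1 - q) \<le> C * q ^ n / (1 - q)"
  proof -
    have "C \<ge> 0" using assms(1)[of 0] by simp
    then have "C * q ^ n * (1 - q ^ k) \<le> C * q ^ n * 1"
      using assms(2) by (intro mult_left_mono) auto
    then show ?thesis using assms(3) by (simp add: divide_right_mono)
  qed
  finally show ?thesis .
qed

lemma sup_geometric_limit:
  assumes "\<And>n x. x \<in> sg \<Longrightarrow> \<bar>val (f (Suc n)) x - val (f n) x\<bar> \<le> C * q ^ n" "0 \<le> q" "q < 1"
  shows "\<exists>g. (\<forall>x\<in>sg. (\<lambda>n. val (f n) x) \<longlonglongrightarrow> val g x) \<and> f \<longlonglongrightarrow> g \<and>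
    (\<forall>x\<in>sg. \<bar>val g x - val (f 0) x\<bar> \<le> C / (1 - q))"
proof -
  have inc: "\<bar>val (f (n + k)) x - val (f n) x\<bar> \<le> C * q ^ n / (1 - q)" if "x \<in> sg" for n k x
    by (rule geometric_increments[of "\<lambda>n. val (f n) x"]) (use assms that in auto)
  have "\<exists>g. (\<forall>x\<in>sg. (\<lambda>n. val (f n) x) \<longlonglongrightarrow> val g x) \<and> f \<longlonglongrightarrow> g"
  proof (rule sup_Cauchy_limit)
    fix e :: real assume "e > 0"
    have "(\<lambda>n. C * q ^ n / (1 - q)) \<longlonglongrightarrow> C * 0 / (1 - q)"
      using assms(2,3) by (intro tendsto_intros LIMSEQ_power_zero) auto
    then have "(\<lambda>n. C * q ^ n / (1 - q)) \<longlonglongrightarrow> 0" by simp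
    from LIMSEQ_D[OF this half_gt_zero[OF \<open>e > 0\<close>]]
    obtain N where "\<forall>n\<ge>N. norm (C * q ^ n / (1 - q) - 0) < e / 2" by blast
    then have N: "\<bar>C * q ^ n / (1 - q)\<bar> < e / 2" if "n \<ge> N" for n
      using that by (metis diff_zero real_norm_def)
    have "\<bar>val (f m) x - val (f n) x\<bar> < e" if "m \<ge> N" "n \<ge> N" "x \<in> sg" for m n x
    proof -
      have "C * q ^ N / (1 - q) < e / 2" using N[of N] by linarith
      moreover have "\<bar>val (f m) x - val (f N) x\<bar> \<le> C * q ^ N / (1 - q)"
        "\<bar>val (f n) x - val (f N) x\<bar> \<le> C * q ^ N / (1 - q)"
        using inc[OF that(3), of N "m - N"] inc[OF that(3), of N "n - N"] that by simp_all
      ultimately show ?thesis by linarith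
    qed
    then show "\<exists>N. \<forall>m\<ge>N. \<forall>n\<ge>N. \<forall>x\<in>sg. \<bar>val (f m) x - val (f n) x\<bar> < e" by blast
  qed
  then obtain g where g: "\<forall>x\<in>sg. (\<lambda>n. val (f n) x) \<longlonglongrightarrow> val g x" "f \<longlonglongrightarrow> g" by blast
  have "\<bar>val g x - val (f 0) x\<bar> \<le> C / (1 - q)" if "x \<in> sg" for x
  proof (rule LIMSEQ_le_const2)
    show "(\<lambda>n. \<bar>val (f n) x - val (f 0) x\<bar>) \<longlonglongrightarrow> \<bar>val g x - val (f 0) x\<bar>"
      using g(1) that by (intro tendsto_intros) auto
    show "\<exists>N. \<forall>n\<ge>N. \<bar>val (f n) x - val (f 0) x\<bar> \<le> C / (1 - q)" using inc[OF that, of 0] by auto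
  qed
  then show ?thesis using g by blast
qed

section \<open>Harmonic functions\<close>

text \<open>The value of the \<open>k\<close>-th harmonic function at the midpoint of corners \<open>i\<close> and \<open>j\<close>
  (the \<open>1/5\<close>-\<open>2/5\<close> rule).\<close>

definition harm_coeff :: "nat \<Rightarrow> nat \<Rightarrow> nat \<Rightarrow> real" where
  "harm_coeff k i j = (if i = j then (if k = i then 1 else 0) else if k = i \<or> k = j then 2/5 else 1/5)"

lemma harm_coeff_commute: "harm_coeff k i j = harm_coeff k j i"
  by (auto simp: harm_coeff_def)

primrec harm_approx :: "nat \<Rightarrow> nat \<Rightarrow> sgfun" where
  "harm_approx 0 k = mk (bary k)"
| "harm_approx (Suc n) k = glue (\<lambda>i. \<Sum>j\<in>idx. harm_coeff k i j *\<^sub>R harm_approx n j)"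

lemma continuous_on_bary: "continuous_on S (bary k)"
  unfolding bary_def by (cases "k = 1"; cases "k = 2") (auto intro!: continuous_intros)

lemma harm_sum_corner:
  assumes "\<And>j. j \<in> idx \<Longrightarrow> val (w j) (corner l) = (if j = l then 1 else 0)" "l \<in> idx"
  shows "val (\<Sum>j\<in>idx. harm_coeff k i j *\<^sub>R w j) (corner l) = harm_coeff k i l"
proof -
  have "val (\<Sum>j\<in>idx. harm_coeff k i j *\<^sub>R w j) (corner l) = (\<Sum>j\<in>idx. if j = l then harm_coeff k i j else 0)"
    unfolding val_sum val_simps using assms(1) by (intro sum.cong) auto
  then show ?thesis using assms(2) by (simp only: sum.delta finite.intros if_True)
qed

lemma harm_compatible:
  assumes "\<And>j l. j \<in> idx \<Longrightarrow> l \<in> idx \<Longrightarrow> val (w j) (corner l) = (if j = l then 1 else 0)"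
  shows "compatible (\<lambda>i. \<Sum>j\<in>idx. harm_coeff k i j *\<^sub>R w j)"
proof -
  have *: "val (\<Sum>j\<in>idx. harm_coeff k i j *\<^sub>R w j) (corner l) = harm_coeff k i l" if "l \<in> idx" for i l
    by (rule harm_sum_corner) (use assms that in auto)
  show ?thesis unfolding compatible_def
  proof (intro ballI)
    fix i j assume "i \<in> idx" "j \<in> idx"
    then show "val (\<Sum>l\<in>idx. harm_coeff k i l *\<^sub>R w l) (corner j) = val (\<Sum>l\<in>idx. harm_coeff k j l *\<^sub>R w l) (corner i)"
      by (simp only: * harm_coeff_commute[of k i j])
  qed
qed

lemma harm_approx_corner:
  "k \<in> idx \<Longrightarrow> l \<in> idx \<Longrightarrow> val (harm_approx n k) (corner l) = (if k = l then 1 else 0)"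
proof (induction n arbitrary: k l)
  case 0
  then show ?case
    using corner_in_sg[OF 0(2)] bary_corner[OF 0] by (simp only: harm_approx.simps val_mk continuous_on_bary if_True)
next
  case (Suc n)
  have c: "compatible (\<lambda>i. \<Sum>j\<in>idx. harm_coeff k i j *\<^sub>R harm_approx n j)"
    by (rule harm_compatible) (rule Suc.IH)
  have "val (harm_approx (Suc n) k) (sg_map l (corner l)) = harm_coeff k l l"
    unfolding harm_approx.simps val_glue[OF c Suc.prems(2) corner_in_sg[OF Suc.prems(2)]]
    by (rule harm_sum_corner) (use Suc in auto)
  moreover have "harm_coeff k l l = (if k = l then 1 else 0)" by (simp add: harm_coeff_def)
  ultimately show ?case by (simp only: sg_map_corner_self)
qed

lemma val_harm_approx_Suc:
  assumes "i \<in> idx" "x \<in> sg"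
  shows "val (harm_approx (Suc n) k) (sg_map i x) = (\<Sum>j\<in>idx. harm_coeff k i j * val (harm_approx n j) x)"
  unfolding harm_approx.simps
  by (subst val_glue[OF harm_compatible assms]) (auto simp only: harm_approx_corner val_sum val_simps)

lemma harm_approx_nonneg: "x \<in> sg \<Longrightarrow> k \<in> idx \<Longrightarrow> 0 \<le> val (harm_approx n k) x"
proof (induction n arbitrary: k x)
  case 0
  then show ?case using bary_sg_nonneg by (simp only: harm_approx.simps val_mk[OF continuous_on_bary] if_True)
next
  case (Suc n)
  from Suc.prems(1) obtain i y where y: "i \<in> idx" "y \<in> sg" "x = sg_map i y" by (rule sg_cases)
  show ?case unfolding y(3) val_harm_approx_Suc[OF y(1,2)]
    by (intro sum_nonneg mult_nonneg_nonneg Suc.IH y) (simp_all only: harm_coeff_def split: if_split, simp)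
qed

lemma sum_harm_coeff: "i \<in> idx \<Longrightarrow> j \<in> idx \<Longrightarrow> (\<Sum>k\<in>idx. harm_coeff k i j) = 1"
  by (auto simp: harm_coeff_def)

lemma harm_approx_sum: "x \<in> sg \<Longrightarrow> (\<Sum>k\<in>idx. val (harm_approx n k) x) = 1"
proof (induction n arbitrary: x)
  case 0
  then show ?case using bary_sum[of x] by (simp add: val_mk continuous_on_bary)
next
  case (Suc n)
  from Suc.prems obtain i y where y: "i \<in> idx" "y \<in> sg" "x = sg_map i y" by (rule sg_cases)
  have "(\<Sum>k\<in>idx. val (harm_approx (Suc n) k) x) = (\<Sum>j\<in>idx. \<Sum>k\<in>idx. harm_coeff k i j * val (harm_approx n j) y)"
    unfolding y(3) val_harm_approx_Suc[OF y(1,2)] by (rule sum.swap)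
  also have "\<dots> = (\<Sum>j\<in>idx. val (harm_approx n j) y)"
    unfolding sum_distrib_right[symmetric] using sum_harm_coeff[OF y(1)] by (intro sum.cong) auto
  finally show ?case using Suc.IH[OF y(2)] by simp
qed

lemma harm_contraction:
  fixes D :: "nat \<Rightarrow> real"
  assumes "(\<Sum>j\<in>idx. D j) = 0" "\<And>j. j \<in> idx \<Longrightarrow> \<bar>D j\<bar> \<le> M" "i \<in> idx" "k \<in> idx"
  shows "\<bar>\<Sum>j\<in>idx. harm_coeff k i j * D j\<bar> \<le> 3/5 * M"
proof -
  have s: "D 1 + D 2 + D 3 = 0" using assms(1) by simp
  have b: "- M \<le> D 1" "D 1 \<le> M" "- M \<le> D 2" "D 2 \<le> M" "- M \<le> D 3" "D 3 \<le> M"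
    using assms(2)[of 1] assms(2)[of 2] assms(2)[of 3] by auto
  have *: "(\<Sum>j\<in>idx. harm_coeff k i j * D j) = harm_coeff k i 1 * D 1 + harm_coeff k i 2 * D 2 + harm_coeff k i 3 * D 3"
    by simp
  have ik: "i = 1 \<or> i = 2 \<or> i = 3" "k = 1 \<or> k = 2 \<or> k = 3" using assms(3,4) by auto
  show ?thesis
    unfolding * abs_le_iff by (insert ik s b; elim disjE; simp add: harm_coeff_def; linarith)
qed

lemma harm_approx_increment:
  assumes "x \<in> sg" "k \<in> idx"
  shows "\<bar>val (harm_approx (Suc n) k) x - val (harm_approx n k) x\<bar> \<le> 1 * (3/5) ^ n"
  using assms
proof (induction n arbitrary: k x)
  case 0
  have b: "0 \<le> val (harm_approx n k) x \<and> val (harm_approx n k) x \<le> 1" for n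
  proof -
    have "val (harm_approx n k) x \<le> (\<Sum>k\<in>idx. val (harm_approx n k) x)"
      using 0 harm_approx_nonneg by (intro member_le_sum) auto
    then show ?thesis using harm_approx_sum[OF 0(1)] harm_approx_nonneg[OF 0] by simp
  qed
  show ?case using b[of "Suc 0"] b[of 0] by (simp only: power_0 abs_le_iff, linarith)
next
  case (Suc n)
  from Suc.prems(1) obtain i y where y: "i \<in> idx" "y \<in> sg" "x = sg_map i y" by (rule sg_cases)
  let ?D = "\<lambda>j. val (harm_approx (Suc n) j) y - val (harm_approx n j) y"
  have "\<bar>\<Sum>j\<in>idx. harm_coeff k i j * ?D j\<bar> \<le> 3/5 * (1 * (3/5) ^ n)"
  proof (rule harm_contraction)
    show "(\<Sum>j\<in>idx. ?D j) = 0"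
      unfolding sum_subtractf harm_approx_sum[OF y(2)] by simp
  qed (use Suc.IH[OF y(2)] y Suc.prems in auto)
  also have "(\<Sum>j\<in>idx. harm_coeff k i j * ?D j) = val (harm_approx (Suc (Suc n)) k) x - val (harm_approx (Suc n) k) x"
    unfolding y(3) val_harm_approx_Suc[OF y(1,2)] by (simp only: right_diff_distrib sum_subtractf)
  finally show ?case by simp
qed

definition harmonic :: "nat \<Rightarrow> sgfun" where
  "harmonic k = (SOME g. \<forall>x\<in>sg. (\<lambda>n. val (harm_approx n k) x) \<longlonglongrightarrow> val g x)"

lemma harm_limit:
  assumes "k \<in> idx" "x \<in> sg"
  shows "(\<lambda>n. val (harm_approx n k) x) \<longlonglongrightarrow> val (harmonic k) x"
proof -
  have "\<exists>g. \<forall>x\<in>sg. (\<lambda>n. val (harm_approx n k) x) \<longlonglongrightarrow> val g x"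
    using sup_geometric_limit[of "\<lambda>n. harm_approx n k" 1 "3/5"] harm_approx_increment[OF _ assms(1)] by auto
  from someI_ex[OF this] show ?thesis using assms(2) unfolding harmonic_def by blast
qed

lemma harm_corner: "k \<in> idx \<Longrightarrow> l \<in> idx \<Longrightarrow> val (harmonic k) (corner l) = (if k = l then 1 else 0)"
  using harm_limit[of k "corner l"] corner_in_sg[of l]
  by (simp only: harm_approx_corner LIMSEQ_const_iff)

lemma harm_nonneg: "k \<in> idx \<Longrightarrow> x \<in> sg \<Longrightarrow> 0 \<le> val (harmonic k) x"
  by (rule LIMSEQ_le_const[OF harm_limit]) (auto simp only: harm_approx_nonneg)

lemma harm_sum:
  assumes "x \<in> sg"
  shows "(\<Sum>k\<in>idx. val (harmonic k) x) = 1"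
proof -
  have "(\<lambda>n. \<Sum>k\<in>idx. val (harm_approx n k) x) \<longlonglongrightarrow> (\<Sum>k\<in>idx. val (harmonic k) x)"
    by (intro tendsto_sum harm_limit assms)
  then show ?thesis by (simp only: harm_approx_sum[OF assms] LIMSEQ_const_iff)
qed

lemma harm_le_1: "k \<in> idx \<Longrightarrow> x \<in> sg \<Longrightarrow> val (harmonic k) x \<le> 1"
  using member_le_sum[of k idx "\<lambda>k. val (harmonic k) x"] harm_nonneg harm_sum by auto

lemma pull_harm:
  assumes "k \<in> idx" "i \<in> idx"
  shows "pull i (harmonic k) = (\<Sum>j\<in>idx. harm_coeff k i j *\<^sub>R harmonic j)"
proof (rule sgfun_eqI)
  fix x assume x: "x \<in> sg"
  have "(\<lambda>n. val (harm_approx (Suc n) k) (sg_map i x)) \<longlonglongrightarrow> val (harmonic k) (sg_map i x)"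
    by (rule LIMSEQ_Suc[OF harm_limit[OF assms(1) sg_map_in_sg[OF assms(2) x]]])
  moreover have "(\<lambda>n. val (harm_approx (Suc n) k) (sg_map i x)) \<longlonglongrightarrow> (\<Sum>j\<in>idx. harm_coeff k i j * val (harmonic j) x)"
    unfolding val_harm_approx_Suc[OF assms(2) x] by (intro tendsto_intros harm_limit x)
  ultimately show "val (pull i (harmonic k)) x = val (\<Sum>j\<in>idx. harm_coeff k i j *\<^sub>R harmonic j) x"
    unfolding val_pull[OF x] val_sum val_simps by (rule LIMSEQ_unique)
qed

definition one_sg :: sgfun where "one_sg = mk (\<lambda>_. 1)"

lemma val_one_sg: "x \<in> sg \<Longrightarrow> val one_sg x = 1"
  by (simp add: one_sg_def val_mk)

lemma pull_one_sg: "pull i one_sg = one_sg"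
  by (rule sgfun_eqI) (simp add: val_pull val_one_sg sg_map_in_sg_any)

lemma harm_sum_one_sg: "(\<Sum>k\<in>idx. harmonic k) = one_sg"
  by (rule sgfun_eqI) (simp only: val_sum harm_sum val_one_sg)

lemma inner_one_sg: "inner one_sg one_sg = 1"
proof -
  interpret prob_space sg_measure by (rule prob_space_sg_measure)
  have "inner one_sg one_sg = (LINT x|sg_measure. 1)"
    unfolding inner_sgfun_def by (rule Bochner_Integration.integral_cong) (simp_all add: val_one_sg)
  then show ?thesis by (simp add: prob_space[unfolded space_sg_measure])
qed

lemma inner_harm_one_sg:
  assumes "k \<in> idx"
  shows "inner (harmonic k) one_sg = 1/3"
proof -
  define I where "I = (\<lambda>k. inner (harmonic k) one_sg)"
  have sum: "(\<Sum>j\<in>idx. I j) = 1"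
    unfolding I_def inner_sum_left[symmetric] harm_sum_one_sg by (rule inner_one_sg)
  have "I k = (\<Sum>i\<in>idx. \<Sum>j\<in>idx. harm_coeff k i j * I j) / 3"
    unfolding I_def by (subst inner_pull)
      (simp only: pull_harm[OF assms] pull_one_sg inner_sum_left inner_scaleR_left cong: sum.cong)
  with sum have "I k = 1/3" using assms by (auto simp: harm_coeff_def)
  then show ?thesis by (simp add: I_def)
qed

definition tent :: "nat \<Rightarrow> sgfun" where
  "tent k = glue (\<lambda>i. if i = k then 0 else harmonic (6 - i - k))"

lemma third_idx: "i \<in> idx \<Longrightarrow> k \<in> idx \<Longrightarrow> i \<noteq> k \<Longrightarrow> 6 - i - k \<in> idx"
  by auto

lemma compatible_tent: "k \<in> idx \<Longrightarrow> compatible (\<lambda>i. if i = k then 0 else harmonic (6 - i - k))"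
  unfolding compatible_def by (auto simp: harm_corner val_simps)

lemma pull_tent: "k \<in> idx \<Longrightarrow> i \<in> idx \<Longrightarrow> pull i (tent k) = (if i = k then 0 else harmonic (6 - i - k))"
  unfolding tent_def by (rule pull_glue[OF compatible_tent])

lemma tent_corner:
  assumes "k \<in> idx" "j \<in> idx"
  shows "val (tent k) (corner j) = 0"
proof -
  have "val (tent k) (sg_map j (corner j)) = val (pull j (tent k)) (corner j)"
    by (simp only: val_pull[OF corner_in_sg[OF assms(2)]])
  also have "\<dots> = 0" unfolding pull_tent[OF assms] using assms by (auto simp: harm_corner val_simps)
  finally show ?thesis by (simp only: sg_map_corner_self)
qed

lemma tent_bounds:
  assumes "k \<in> idx" "x \<in> sg"
  shows "0 \<le> val (tent k) x" "val (tent k) x \<le> 1"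
proof -
  from assms(2) obtain i y where y: "i \<in> idx" "y \<in> sg" "x = sg_map i y" by (rule sg_cases)
  have "val (tent k) x = val (if i = k then 0 else harmonic (6 - i - k)) y"
    unfolding y(3) val_pull[OF y(2), symmetric] pull_tent[OF assms(1) y(1)] ..
  then show "0 \<le> val (tent k) x" "val (tent k) x \<le> 1"
    using harm_nonneg[OF third_idx[OF y(1) assms(1)] y(2)] harm_le_1[OF third_idx[OF y(1) assms(1)] y(2)]
    by (simp_all add: val_simps)
qed

lemma norm_tent_le: "k \<in> idx \<Longrightarrow> norm (tent k) \<le> 1"
  by (rule norm_le_if_bounded) (use tent_bounds in force)

section \<open>Green's operator\<close>

text \<open>The coefficients come from inverting the level-one graph Laplacian \<open>4 I - (J - I)\<close>
  on the three midpoints, where \<open>J\<close> is the all-ones matrix.\<close>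

definition tent_coeff :: "nat \<Rightarrow> sgfun \<Rightarrow> real" where
  "tent_coeff k u = 3/50 * (2 * inner u (tent k) + (\<Sum>l\<in>idx. inner u (tent l)))"

definition green1 :: "sgfun \<Rightarrow> sgfun" where
  "green1 u = (\<Sum>k\<in>idx. tent_coeff k u *\<^sub>R tent k)"

definition vanishes :: "sgfun \<Rightarrow> bool" where
  "vanishes u \<longleftrightarrow> (\<forall>j\<in>idx. val u (corner j) = 0)"

definition cellwise :: "(sgfun \<Rightarrow> sgfun) \<Rightarrow> sgfun \<Rightarrow> sgfun" where
  "cellwise T u = glue (\<lambda>i. (1/5) *\<^sub>R T (pull i u))"

definition admissible :: "(sgfun \<Rightarrow> sgfun) \<Rightarrow> bool" where
  "admissible T \<longleftrightarrow> form_symmetric T \<and> (\<forall>u. 0 \<le> inner (T u) u) \<and> (\<forall>u. vanishes (T u))"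

lemma compatible_vanishes: "(\<And>i. i \<in> idx \<Longrightarrow> vanishes (v i)) \<Longrightarrow> compatible v"
  unfolding compatible_def vanishes_def by simp

lemma vanishes_scaleR: "vanishes u \<Longrightarrow> vanishes (c *\<^sub>R u)"
  by (simp add: vanishes_def val_simps)

lemma vanishes_add: "vanishes u \<Longrightarrow> vanishes v \<Longrightarrow> vanishes (u + v)"
  by (simp add: vanishes_def val_simps)

lemma vanishes_0: "vanishes 0"
  by (simp add: vanishes_def val_simps)

lemma vanishes_glue:
  assumes "\<And>i. i \<in> idx \<Longrightarrow> vanishes (v i)"
  shows "vanishes (glue v)"
  unfolding vanishes_def
proof
  fix j assume j: "j \<in> idx"
  have c: "compatible v" by (rule compatible_vanishes) (rule assms)
  have "val (glue v) (sg_map j (corner j)) = 0"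
    unfolding val_glue[OF c j corner_in_sg[OF j]]
    using assms[OF j] j unfolding vanishes_def by blast
  then show "val (glue v) (corner j) = 0" by (simp only: sg_map_corner_self)
qed

lemma pull_cellwise: "(\<And>u. vanishes (T u)) \<Longrightarrow> i \<in> idx \<Longrightarrow> pull i (cellwise T u) = (1/5) *\<^sub>R T (pull i u)"
  unfolding cellwise_def by (rule pull_glue) (auto intro: compatible_vanishes vanishes_scaleR)

lemma inner_cellwise:
  assumes "\<And>u. vanishes (T u)"
  shows "inner (cellwise T u) v = (\<Sum>i\<in>idx. inner (T (pull i u)) (pull i v)) / 15"
  by (subst inner_pull) (simp add: pull_cellwise assms)

lemma admissible_cellwise:
  assumes "admissible T"
  shows "admissible (cellwise T)"
proof -
  have T: "linear T" "\<And>u v. inner (T u) v = inner u (T v)" "\<And>u. 0 \<le> inner (T u) u" "\<And>u. vanishes (T u)"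
    using assms unfolding admissible_def form_symmetric_def by blast+
  have "linear (cellwise T)"
    by (rule linearI; rule sgfun_eqI_pull)
       (simp_all only: pull_cellwise T(4) pull_add pull_scaleR linear_add[OF T(1)] linear_scale[OF T(1)]
         scaleR_add_right scaleR_scaleR mult.commute)
  moreover have "inner (cellwise T u) v = inner u (cellwise T v)" for u v
  proof -
    have "inner (cellwise T u) v = (\<Sum>i\<in>idx. inner (T (pull i u)) (pull i v)) / 15"
      by (rule inner_cellwise[OF T(4)])
    also have "\<dots> = (\<Sum>i\<in>idx. inner (T (pull i v)) (pull i u)) / 15"
      by (intro arg_cong2[where f = "(/)"] sum.cong refl) (metis T(2) inner_commute)
    also have "\<dots> = inner (cellwise T v) u" by (rule inner_cellwise[OF T(4), symmetric])
    finally show ?thesis by (simp only: inner_commute)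
  qed
  moreover have "0 \<le> inner (cellwise T u) u" for u
    unfolding inner_cellwise[OF T(4)] by (intro divide_nonneg_nonneg sum_nonneg T(3)) simp
  moreover have "vanishes (cellwise T u)" for u
    unfolding cellwise_def by (intro vanishes_glue vanishes_scaleR T(4))
  ultimately show ?thesis unfolding admissible_def form_symmetric_def by blast
qed

lemma admissible_green1: "admissible green1"
proof -
  have "linear green1"
    by (rule linearI) (simp_all add: green1_def tent_coeff_def inner_add_left algebra_simps)
  moreover have "inner (green1 u) v = inner u (green1 v)" for u v
    by (simp add: green1_def tent_coeff_def inner_add inner_commute[of _ v] algebra_simps)
  moreover have "0 \<le> inner (green1 u) u" for u
  proof -
    have "inner (green1 u) u = 3/50 * (2 * ((inner u (tent 1))\<^sup>2 + (inner u (tent 2))\<^sup>2 + (inner u (tent 3))\<^sup>2)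
        + (inner u (tent 1) + inner u (tent 2) + inner u (tent 3))\<^sup>2)"
      by (simp add: green1_def tent_coeff_def inner_add inner_commute[of _ u] power2_eq_square algebra_simps)
    then show ?thesis by (simp only: ) (intro mult_nonneg_nonneg add_nonneg_nonneg; simp)
  qed
  moreover have "vanishes (green1 u)" for u
    unfolding vanishes_def green1_def by (simp add: val_simps tent_corner)
  ultimately show ?thesis unfolding admissible_def form_symmetric_def by blast
qed

lemma admissible_add:
  assumes "admissible S" "admissible T"
  shows "admissible (\<lambda>u. S u + T u)"
  using assms unfolding admissible_def form_symmetric_def
  by (auto simp: inner_add vanishes_add intro!: linear_compose_add add_nonneg_nonneg)

lemma tent_coeff_le: "k \<in> idx \<Longrightarrow> \<bar>tent_coeff k u\<bar> \<le> 3/10 * norm u"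
proof -
  assume k: "k \<in> idx"
  have t: "\<bar>inner u (tent k)\<bar> \<le> norm u" if "k \<in> idx" for k
    using Cauchy_Schwarz_ineq2[of u "tent k"] mult_left_mono[OF norm_tent_le[OF that], of "norm u"] by simp
  show ?thesis
    using t[OF k] t[of 1] t[of 2] t[of 3] by (simp add: tent_coeff_def abs_le_iff)
qed

lemma val_green1_le: "x \<in> sg \<Longrightarrow> \<bar>val (green1 u) x\<bar> \<le> norm u"
proof -
  assume x: "x \<in> sg"
  have "\<bar>val (green1 u) x\<bar> \<le> (\<Sum>k\<in>idx. \<bar>tent_coeff k u * val (tent k) x\<bar>)"
    unfolding green1_def val_sum val_simps by (rule sum_abs)
  also have "\<dots> \<le> (\<Sum>k\<in>idx. 3/10 * norm u * 1)"
  proof (rule sum_mono)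
    fix k assume k: "k \<in> idx"
    show "\<bar>tent_coeff k u * val (tent k) x\<bar> \<le> 3/10 * norm u * 1"
      unfolding abs_mult using tent_coeff_le[OF k] tent_bounds[OF k x] by (intro mult_mono) auto
  qed
  also have "\<dots> \<le> norm u" by simp
  finally show ?thesis .
qed

primrec green_approx :: "nat \<Rightarrow> sgfun \<Rightarrow> sgfun" where
  "green_approx 0 = (\<lambda>u. 0)"
| "green_approx (Suc n) = (\<lambda>u. cellwise (green_approx n) u + green1 u)"

lemma admissible_green_approx: "admissible (green_approx n)"
proof (induction n)
  case 0
  then show ?case by (simp add: admissible_def form_symmetric_def linear_zero vanishes_0)
next
  case (Suc n)
  then show ?case
    unfolding green_approx.simps by (intro admissible_add admissible_cellwise admissible_green1)
qed

lemma green_approx_vanishes: "vanishes (green_approx n u)"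
  using admissible_green_approx by (simp add: admissible_def)

lemma val_green_approx_Suc:
  "i \<in> idx \<Longrightarrow> x \<in> sg \<Longrightarrow> val (green_approx (Suc n) u) (sg_map i x)
    = (1/5) * val (green_approx n (pull i u)) x + val (pull i (green1 u)) x"
  by (simp only: green_approx.simps val_pull[symmetric] pull_add pull_cellwise[OF green_approx_vanishes] val_simps)

lemma green_approx_increment:
  "x \<in> sg \<Longrightarrow> \<bar>val (green_approx (Suc n) u) x - val (green_approx n u) x\<bar> \<le> norm u * (2/5) ^ n"
proof (induction n arbitrary: u x)
  case 0
  have "cellwise (\<lambda>u. 0) u = 0"
    by (rule sgfun_eqI_pull) (simp only: pull_cellwise vanishes_0 pull_0 scaleR_zero_right)
  then show ?case using val_green1_le[OF 0] by (simp add: val_simps)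
next
  case (Suc n)
  from Suc.prems obtain i y where y: "i \<in> idx" "y \<in> sg" "x = sg_map i y" by (rule sg_cases)
  have "\<bar>val (green_approx (Suc (Suc n)) u) x - val (green_approx (Suc n) u) x\<bar>
      = (1/5) * \<bar>val (green_approx (Suc n) (pull i u)) y - val (green_approx n (pull i u)) y\<bar>"
    unfolding y(3) val_green_approx_Suc[OF y(1,2)] by (simp add: abs_if field_simps)
  also have "\<dots> \<le> (1/5) * (norm (pull i u) * (2/5) ^ n)"
    by (intro mult_left_mono Suc.IH y(2)) simp
  also have "\<dots> \<le> (1/5) * ((2 * norm u) * (2/5) ^ n)"
    by (intro mult_left_mono mult_right_mono norm_pull_le y(1)) simp_all
  finally show ?case by simp
qed

definition green :: "sgfun \<Rightarrow> sgfun" where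
  "green u = (SOME g. (\<forall>x\<in>sg. (\<lambda>n. val (green_approx n u) x) \<longlonglongrightarrow> val g x) \<and>
     (\<lambda>n. green_approx n u) \<longlonglongrightarrow> g \<and> (\<forall>x\<in>sg. \<bar>val g x\<bar> \<le> 2 * norm u))"

lemma green_props:
  "x \<in> sg \<Longrightarrow> (\<lambda>n. val (green_approx n u) x) \<longlonglongrightarrow> val (green u) x"
  "(\<lambda>n. green_approx n u) \<longlonglongrightarrow> green u"
  "x \<in> sg \<Longrightarrow> \<bar>val (green u) x\<bar> \<le> 2 * norm u"
proof -
  have "\<exists>g. (\<forall>x\<in>sg. (\<lambda>n. val (green_approx n u) x) \<longlonglongrightarrow> val g x) \<and>
     (\<lambda>n. green_approx n u) \<longlonglongrightarrow> g \<and> (\<forall>x\<in>sg. \<bar>val g x - val (green_approx 0 u) x\<bar> \<le> norm u / (1 - 2/5))"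
    by (rule sup_geometric_limit[of "\<lambda>n. green_approx n u" "norm u" "2/5"])
       (use green_approx_increment in auto)
  then obtain g where g: "\<And>x. x \<in> sg \<Longrightarrow> (\<lambda>n. val (green_approx n u) x) \<longlonglongrightarrow> val g x"
     "(\<lambda>n. green_approx n u) \<longlonglongrightarrow> g" "\<And>x. x \<in> sg \<Longrightarrow> \<bar>val g x - val (green_approx 0 u) x\<bar> \<le> norm u / (1 - 2/5)"
    by blast
  have "\<bar>val g x\<bar> \<le> 2 * norm u" if "x \<in> sg" for x
    using g(3)[OF that] norm_ge_zero[of u] by (simp add: val_simps)
  with g(1,2) have "\<exists>g. (\<forall>x\<in>sg. (\<lambda>n. val (green_approx n u) x) \<longlonglongrightarrow> val g x) \<and>
     (\<lambda>n. green_approx n u) \<longlonglongrightarrow> g \<and> (\<forall>x\<in>sg. \<bar>val g x\<bar> \<le> 2 * norm u)" by blast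
  from someI_ex[OF this, folded green_def]
  show "x \<in> sg \<Longrightarrow> (\<lambda>n. val (green_approx n u) x) \<longlonglongrightarrow> val (green u) x"
    "(\<lambda>n. green_approx n u) \<longlonglongrightarrow> green u" "x \<in> sg \<Longrightarrow> \<bar>val (green u) x\<bar> \<le> 2 * norm u" by blast+
qed

lemma pull_green:
  assumes "i \<in> idx"
  shows "pull i (green u) = (1/5) *\<^sub>R green (pull i u) + pull i (green1 u)"
proof (rule sgfun_eqI)
  fix x assume x: "x \<in> sg"
  have "(\<lambda>n. val (green_approx (Suc n) u) (sg_map i x)) \<longlonglongrightarrow> val (green u) (sg_map i x)"
    by (rule LIMSEQ_Suc[OF green_props(1)[OF sg_map_in_sg[OF assms x]]])
  moreover have "(\<lambda>n. val (green_approx (Suc n) u) (sg_map i x)) \<longlonglongrightarrow>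
      (1/5) * val (green (pull i u)) x + val (pull i (green1 u)) x"
    unfolding val_green_approx_Suc[OF assms x] by (intro tendsto_intros green_props(1) x)
  ultimately show "val (pull i (green u)) x = val ((1/5) *\<^sub>R green (pull i u) + pull i (green1 u)) x"
    unfolding val_pull[OF x] val_simps by (rule LIMSEQ_unique)
qed

lemma admissible_green: "admissible green"
proof -
  have A: "linear (green_approx n)" "\<And>u v. inner (green_approx n u) v = inner u (green_approx n v)"
    "\<And>u. 0 \<le> inner (green_approx n u) u" "\<And>u. vanishes (green_approx n u)" for n
    using admissible_green_approx[of n] unfolding admissible_def form_symmetric_def by blast+
  have "linear green"
  proof (rule linearI)
    fix u v :: sgfun and c :: real
    have "(\<lambda>n. green_approx n (u + v)) \<longlonglongrightarrow> green u + green v"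
      unfolding linear_add[OF A(1)] by (intro tendsto_add green_props(2))
    then show "green (u + v) = green u + green v" using green_props(2) LIMSEQ_unique by blast
    have "(\<lambda>n. green_approx n (c *\<^sub>R u)) \<longlonglongrightarrow> c *\<^sub>R green u"
      unfolding linear_scale[OF A(1)] by (intro tendsto_scaleR tendsto_const green_props(2))
    then show "green (c *\<^sub>R u) = c *\<^sub>R green u" using green_props(2) LIMSEQ_unique by blast
  qed
  moreover have "inner (green u) v = inner u (green v)" for u v
  proof (rule LIMSEQ_unique)
    show "(\<lambda>n. inner (green_approx n u) v) \<longlonglongrightarrow> inner (green u) v"
      by (intro tendsto_inner tendsto_const green_props(2))
    show "(\<lambda>n. inner (green_approx n u) v) \<longlonglongrightarrow> inner u (green v)"
      unfolding A(2) by (intro tendsto_inner tendsto_const green_props(2))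
  qed
  moreover have "0 \<le> inner (green u) u" for u
    by (rule LIMSEQ_le_const[of "\<lambda>n. inner (green_approx n u) u"])
       (use A(3) in \<open>auto intro!: tendsto_inner green_props(2)\<close>)
  moreover have "vanishes (green u)" for u
    unfolding vanishes_def
  proof
    fix j assume j: "j \<in> idx"
    have "val (green_approx n u) (corner j) = 0" for n using A(4) j unfolding vanishes_def by blast
    then show "val (green u) (corner j) = 0"
      using green_props(1)[OF corner_in_sg[OF j], of u] by (simp only: LIMSEQ_const_iff)
  qed
  ultimately show ?thesis unfolding admissible_def form_symmetric_def by blast
qed

lemma form_symmetric_green: "form_symmetric green"
  and linear_green: "linear green"
  and green_psd: "0 \<le> inner (green u) u"
  and vanishes_green: "vanishes (green u)"
  using admissible_green unfolding admissible_def form_symmetric_def by blast+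

lemma green_eq: "green u = cellwise green u + green1 u"
  by (rule sgfun_eqI_pull) (simp only: pull_add pull_green pull_cellwise[OF vanishes_green])

lemma norm_cellwise_le:
  assumes "\<And>u. vanishes (T u)"
  shows "norm (cellwise T u) \<le> (1/8) * (\<Sum>i\<in>idx. norm (T (pull i u)))"
proof -
  let ?S = "\<Sum>i\<in>idx. norm (T (pull i u))"
  have "inner (cellwise T u) (cellwise T u) = (\<Sum>i\<in>idx. (norm (T (pull i u)))\<^sup>2) / 75"
    by (subst inner_cellwise[OF assms]) (simp add: pull_cellwise[OF assms] dot_square_norm)
  also have "(\<Sum>i\<in>idx. (norm (T (pull i u)))\<^sup>2) \<le> ?S\<^sup>2"
    by (simp add: power2_eq_square algebra_simps)
  also have "?S\<^sup>2 / 75 \<le> ((1/8) * ?S)\<^sup>2"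
    by (simp add: power_mult_distrib power_divide)
  finally have "(norm (cellwise T u))\<^sup>2 \<le> ((1/8) * ?S)\<^sup>2" by (simp only: dot_square_norm)
  then show ?thesis by (rule power2_le_imp_le) (simp add: sum_nonneg)
qed

lemma bounded_linear_pull: "i \<in> idx \<Longrightarrow> bounded_linear (pull i)"
  by (rule bounded_linear_intro[where K = 2]) (use norm_pull_le in \<open>simp_all add: pull_add pull_scaleR mult.commute\<close>)

lemma bounded_linear_tent_coeff: "bounded_linear (tent_coeff k)"
proof -
  have "bounded_linear (\<lambda>u. inner u ((3/50) *\<^sub>R (2 *\<^sub>R tent k + (\<Sum>l\<in>idx. tent l))))"
    by (rule bounded_linear_inner_left)
  moreover have "(\<lambda>u. inner u ((3/50) *\<^sub>R (2 *\<^sub>R tent k + (\<Sum>l\<in>idx. tent l)))) = tent_coeff k"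
    by (simp add: fun_eq_iff tent_coeff_def inner_add_right)
  ultimately show ?thesis by simp
qed

lemma norm_green1_le: "norm (green1 u) \<le> (\<Sum>k\<in>idx. \<bar>tent_coeff k u\<bar>)"
proof -
  have "norm (green1 u) \<le> (\<Sum>k\<in>idx. norm (tent_coeff k u *\<^sub>R tent k))"
    unfolding green1_def by (rule norm_sum)
  also have "\<dots> \<le> (\<Sum>k\<in>idx. \<bar>tent_coeff k u\<bar>)"
    using mult_left_mono[OF norm_tent_le] by (intro sum_mono) fastforce
  finally show ?thesis .
qed

definition finite_rank_bound :: "real \<Rightarrow> (sgfun \<Rightarrow> sgfun) \<Rightarrow> bool" where
  "finite_rank_bound e T \<longleftrightarrow> (\<exists>C K. finite C \<and> (\<forall>c\<in>C. bounded_linear c) \<and> K > 0 \<and>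
     (\<forall>u. norm (T u) \<le> e * norm u + K * (\<Sum>c\<in>C. \<bar>c u :: real\<bar>)))"

lemma finite_rank_bound_green_step:
  assumes "finite_rank_bound e green" "e \<ge> 0"
  shows "finite_rank_bound (3/4 * e) green"
proof -
  obtain C K where C: "finite C" "\<And>c. c \<in> C \<Longrightarrow> bounded_linear c" "K > 0"
      "\<And>u. norm (green u) \<le> e * norm u + K * (\<Sum>c\<in>C. \<bar>c u :: real\<bar>)"
    using assms(1) unfolding finite_rank_bound_def by blast
  define D where "D = (\<lambda>i. (\<lambda>c u. c (pull i u)) ` C)"
  define E where "E = D 1 \<union> D 2 \<union> D 3 \<union> tent_coeff ` idx"
  define s where "s = (\<lambda>u. \<Sum>c\<in>E. \<bar>c u\<bar>)"
  have fin: "finite E" unfolding E_def D_def using C(1) by simp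
  have bl: "bounded_linear c" if "c \<in> E" for c
    using that C(2) bounded_linear_tent_coeff bounded_linear_compose[OF _ bounded_linear_pull]
    unfolding E_def D_def by auto
  have le: "(\<Sum>c\<in>A. \<bar>c u\<bar>) \<le> s u" if "A \<subseteq> E" for A u
    unfolding s_def by (rule sum_mono2[OF fin that]) simp
  have p: "(\<Sum>c\<in>C. \<bar>c (pull i u)\<bar>) \<le> of_nat (card C) * s u" if i: "i \<in> idx" for i u
  proof -
    have "\<bar>c (pull i u)\<bar> \<le> s u" if "c \<in> C" for c
    proof -
      have "(\<lambda>u. c (pull i u)) \<in> E" using that i unfolding E_def D_def by auto
      then show ?thesis unfolding s_def using fin by (intro member_le_sum[of _ E "\<lambda>c. \<bar>c u\<bar>"]) auto
    qed
    then show ?thesis by (rule sum_bounded_above)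
  qed
  have t: "(\<Sum>k\<in>idx. \<bar>tent_coeff k u\<bar>) \<le> 3 * s u" for u
  proof -
    have "\<bar>tent_coeff k u\<bar> \<le> s u" if "k \<in> idx" for k
      unfolding s_def using fin that by (intro member_le_sum[of _ E "\<lambda>c. \<bar>c u\<bar>"]) (auto simp: E_def)
    from sum_bounded_above[of idx, OF this] show ?thesis by simp
  qed
  define K' where "K' = K * of_nat (card C) + 3"
  have "norm (green u) \<le> 3/4 * e * norm u + K' * s u" for u
  proof -
    have "norm (green u) \<le> norm (cellwise green u) + norm (green1 u)"
      by (subst green_eq) (rule norm_triangle_ineq)
    also have "norm (cellwise green u) \<le> (1/8) * (\<Sum>i\<in>idx. norm (green (pull i u)))"
      by (rule norm_cellwise_le[OF vanishes_green])
    also have "\<dots> \<le> (1/8) * (\<Sum>i\<in>idx. e * (2 * norm u) + K * (of_nat (card C) * s u))"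
    proof (intro mult_left_mono sum_mono)
      fix i assume i: "i \<in> idx"
      have "norm (green (pull i u)) \<le> e * norm (pull i u) + K * (\<Sum>c\<in>C. \<bar>c (pull i u)\<bar>)" by (rule C(4))
      also have "\<dots> \<le> e * (2 * norm u) + K * (of_nat (card C) * s u)"
        using assms(2) C(3) by (intro add_mono mult_left_mono norm_pull_le p i) auto
      finally show "norm (green (pull i u)) \<le> e * (2 * norm u) + K * (of_nat (card C) * s u)" .
    qed simp
    also have "\<dots> = 3/4 * e * norm u + 3/8 * (K * of_nat (card C) * s u)" by simp
    also have "norm (green1 u) \<le> 3 * s u" using norm_green1_le t order_trans by blast
    finally have "norm (green u) \<le> 3/4 * e * norm u + 3/8 * (K * of_nat (card C) * s u) + 3 * s u" by simp
    moreover have "0 \<le> K * of_nat (card C) * s u" unfolding s_def using C(3) by (simp add: sum_nonneg)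
    ultimately show ?thesis by (simp add: K'_def distrib_right)
  qed
  moreover have "K' > 0" using C(3) by (simp add: K'_def add_nonneg_pos)
  ultimately show ?thesis
    unfolding finite_rank_bound_def s_def using fin bl by blast
qed

lemma finite_rank_bound_green: "finite_rank_bound (2 * (3/4) ^ n) green"
proof (induction n)
  case 0
  have "norm (green u) \<le> 2 * norm u" for u
    by (rule norm_le_if_bounded) (rule green_props(3))
  then show ?case unfolding finite_rank_bound_def by (intro exI[of _ "{}"] exI[of _ 1]) simp
next
  case (Suc n)
  from finite_rank_bound_green_step[OF this] show ?case by (simp add: mult.left_commute)
qed

lemma compact_psd_green: "compact_psd green"
proof
  show "form_symmetric green" by (rule form_symmetric_green)
  show "0 \<le> inner (green u) u" for u by (rule green_psd)
next
  fix e :: real assume "e > 0"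
  then obtain n where n: "(3/4) ^ n < e / 2" using real_arch_pow_inv[of "e / 2" "3/4"] by auto
  obtain C K where C: "finite C" "\<And>c. c \<in> C \<Longrightarrow> bounded_linear c" "K > 0"
      "\<And>u. norm (green u) \<le> (2 * (3/4) ^ n) * norm u + K * (\<Sum>c\<in>C. \<bar>c u :: real\<bar>)"
    using finite_rank_bound_green[of n] unfolding finite_rank_bound_def by blast
  define D where "D = (\<lambda>c u. K * c u) ` C"
  have inj: "inj_on (\<lambda>(c :: sgfun \<Rightarrow> real) u. K * c u) C"
    using C(3) by (auto simp: inj_on_def fun_eq_iff)
  have "norm (green u) \<le> e * norm u + (\<Sum>c\<in>D. \<bar>c u\<bar>)" for u
  proof -
    have "norm (green u) \<le> (2 * (3/4) ^ n) * norm u + K * (\<Sum>c\<in>C. \<bar>c u\<bar>)" by (rule C(4))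
    also have "K * (\<Sum>c\<in>C. \<bar>c u\<bar>) = (\<Sum>c\<in>D. \<bar>c u\<bar>)"
      unfolding D_def sum.reindex[OF inj] using C(3) by (simp add: sum_distrib_left abs_mult)
    also have "(2 * (3/4) ^ n) * norm u \<le> e * norm u" using n by (intro mult_right_mono) auto
    finally show ?thesis by simp
  qed
  moreover have "bounded_linear c" if "c \<in> D" for c
    using that C(2) bounded_linear_const_mult unfolding D_def by blast
  moreover have "finite D" unfolding D_def using C(1) by simp
  ultimately show "\<exists>C. finite C \<and> (\<forall>c\<in>C. bounded_linear c) \<and>
      (\<forall>u. norm (green u) \<le> e * norm u + (\<Sum>c\<in>C. \<bar>c u :: real\<bar>))" by blast
next
  fix u :: "nat \<Rightarrow> sgfun" assume u: "Cauchy u"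
  have "\<exists>g. (\<forall>x\<in>sg. (\<lambda>n. val (green (u n)) x) \<longlonglongrightarrow> val g x) \<and> (\<lambda>n. green (u n)) \<longlonglongrightarrow> g"
  proof (rule sup_Cauchy_limit)
    fix e :: real assume "e > 0"
    then obtain N where N: "\<And>m n. m \<ge> N \<Longrightarrow> n \<ge> N \<Longrightarrow> norm (u m - u n) < e / 2"
      using u unfolding Cauchy_iff by (meson half_gt_zero)
    have "\<bar>val (green (u m)) x - val (green (u n)) x\<bar> < e" if "m \<ge> N" "n \<ge> N" "x \<in> sg" for m n x
      using green_props(3)[OF that(3), of "u m - u n"] N[OF that(1,2)]
      by (simp add: linear_diff[OF linear_green] val_simps)
    then show "\<exists>N. \<forall>m\<ge>N. \<forall>n\<ge>N. \<forall>x\<in>sg. \<bar>val (green (u m)) x - val (green (u n)) x\<bar> < e" by blast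
  qed
  then show "convergent (\<lambda>n. green (u n))" by (auto simp: convergent_def)
qed

section \<open>The Laplacian of a Green potential\<close>

definition nderiv :: "nat \<Rightarrow> nat \<Rightarrow> sgfun \<Rightarrow> real" where
  "nderiv m j u = nbr_sum m (val u) (corner j) - 2 * val u (corner j)"

lemma graph_laplacian_nbr_sum: "graph_laplacian m u x = nbr_sum m u x - 4 * u x"
  by (simp add: graph_laplacian_def nbr_sum_def)

lemma nbr_sum_cong: "(\<And>y. y \<in> sg \<Longrightarrow> u y = v y) \<Longrightarrow> nbr_sum m u x = nbr_sum m v x"
  unfolding nbr_sum_def by (intro sum.cong) (auto dest: sg_adjD)

lemma linear_nbr_sum: "linear (\<lambda>u. nbr_sum m (val u) x)"
  by (rule linearI) (simp_all add: nbr_sum_def val_simps sum.distrib sum_distrib_left)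

lemma linear_nderiv: "linear (nderiv m j)"
proof -
  have "linear (\<lambda>u. val u (corner j))" by (rule linearI) (simp_all add: val_simps)
  then show ?thesis
    unfolding nderiv_def[abs_def] using linear_nbr_sum[of m "corner j"]
    by (intro linear_compose_sub) (auto intro: linearI simp: linear_add linear_scale val_simps)
qed

lemma linear_graph_laplacian: "linear (\<lambda>u. graph_laplacian m (val u) x)"
  by (rule linearI) (simp_all add: graph_laplacian_def val_simps sum.distrib sum_distrib_left algebra_simps)

lemma nbr_sum_pull: "nbr_sum m (\<lambda>y. val u (sg_map i y)) x = nbr_sum m (val (pull i u)) x"
  by (rule nbr_sum_cong) (simp add: val_pull)

lemma graph_laplacian_interior:
  assumes "i \<in> idx" "x \<in> sg" "x \<notin> sg_vertices 0"
  shows "graph_laplacian (Suc m) (val u) (sg_map i x) = graph_laplacian m (val (pull i u)) x"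
  unfolding graph_laplacian_nbr_sum nbr_sum_interior[OF assms] nbr_sum_pull val_pull[OF assms(2)] ..

lemma nderiv_Suc: "j \<in> idx \<Longrightarrow> nderiv (Suc m) j u = nderiv m j (pull j u)"
  unfolding nderiv_def nbr_sum_corner nbr_sum_pull
  by (simp only: nbr_sum_corner nbr_sum_pull val_pull[OF corner_in_sg] sg_map_corner_self)

lemma graph_laplacian_midpoint:
  assumes "i \<in> idx" "j \<in> idx" "i \<noteq> j"
  shows "graph_laplacian (Suc m) (val u) (sg_map i (corner j)) = nderiv m j (pull i u) + nderiv m i (pull j u)"
  unfolding graph_laplacian_nbr_sum nderiv_def nbr_sum_midpoint[OF assms] nbr_sum_pull
  by (simp add: val_pull[OF corner_in_sg[OF assms(1)]] val_pull[OF corner_in_sg[OF assms(2)]] sg_map_corner_swap[of j i])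

lemma nderiv_0: "j \<in> idx \<Longrightarrow> nderiv 0 j u = val u (corner 1) + val u (corner 2) + val u (corner 3) - 3 * val u (corner j)"
  unfolding nderiv_def by (simp only: nbr_sum_0)

lemma nderiv_harmonic:
  "j \<in> idx \<Longrightarrow> l \<in> idx \<Longrightarrow> nderiv m j (harmonic l) = (3/5) ^ m * (if l = j then - 2 else 1)"
proof (induction m arbitrary: l)
  case 0
  then show ?case by (auto simp: nderiv_0 harm_corner)
next
  case (Suc m)
  have "nderiv (Suc m) j (harmonic l) = (\<Sum>k\<in>idx. harm_coeff l j k * nderiv m j (harmonic k))"
    unfolding nderiv_Suc[OF Suc.prems(1)] pull_harm[OF Suc.prems(2,1)] linear_sum[OF linear_nderiv]
      linear_scale[OF linear_nderiv] by simp
  also have "\<dots> = (\<Sum>k\<in>idx. harm_coeff l j k * ((3/5) ^ m * (if k = j then - 2 else 1)))"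
    by (intro sum.cong refl arg_cong2[where f = "(*)"] Suc.IH Suc.prems)
  also have "\<dots> = (3/5) ^ Suc m * (if l = j then - 2 else 1)"
    using Suc.prems by (auto simp: harm_coeff_def)
  finally show ?case .
qed

lemma sg_vertices_cases:
  assumes "x \<in> sg_vertices (Suc m) - sg_vertices 0"
  obtains (interior) i y where "i \<in> idx" "y \<in> sg_vertices m - sg_vertices 0" "x = sg_map i y"
  | (midpoint) i j where "i \<in> idx" "j \<in> idx" "i \<noteq> j" "x = sg_map i (corner j)"
proof -
  obtain i y where y: "i \<in> idx" "y \<in> sg_vertices m" "x = sg_map i y" using assms by auto
  show thesis
  proof (cases "y \<in> sg_vertices 0")
    case True
    then obtain j where j: "j \<in> idx" "y = corner j" unfolding sg_vertices_0 by blast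
    have "i \<noteq> j"
    proof
      assume "i = j"
      then have "x = corner j" using y j by (simp only: sg_map_corner_self)
      then show False using assms corner_in_sg_vertices[OF j(1), of 0] by blast
    qed
    then show thesis using midpoint y j by blast
  next
    case False
    then show thesis using interior y by blast
  qed
qed

lemma harm_coeff_balance:
  assumes "i \<in> idx" "j \<in> idx" "l \<in> idx" "i \<noteq> j"
  shows "(\<Sum>k\<in>idx. harm_coeff l i k * (if k = j then - 2 else 1)) + (\<Sum>k\<in>idx. harm_coeff l j k * (if k = i then - 2 else 1)) = 0"
proof -
  have "i = 1 \<or> i = 2 \<or> i = 3" "j = 1 \<or> j = 2 \<or> j = 3" "l = 1 \<or> l = 2 \<or> l = 3" using assms by auto
  moreover note assms(4)
  ultimately show ?thesis by (elim disjE) (simp_all add: harm_coeff_def)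
qed

lemma graph_laplacian_harmonic:
  assumes "x \<in> sg_vertices m - sg_vertices 0" "l \<in> idx"
  shows "graph_laplacian m (val (harmonic l)) x = 0"
  using assms
proof (induction m arbitrary: x l)
  case 0 then show ?case by simp
next
  case (Suc m)
  from Suc.prems(1) show ?case
  proof (cases rule: sg_vertices_cases)
    case (interior i y)
    have "y \<in> sg" using interior(2) sg_vertices_subset_sg by blast
    moreover have "y \<notin> sg_vertices 0" using interior(2) by blast
    ultimately show ?thesis
      unfolding interior(3) graph_laplacian_interior[OF interior(1) \<open>y \<in> sg\<close> \<open>y \<notin> sg_vertices 0\<close>]
        pull_harm[OF Suc.prems(2) interior(1)] linear_sum[OF linear_graph_laplacian]
        linear_scale[OF linear_graph_laplacian]
      using Suc.IH[OF interior(2)] by simp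
  next
    case (midpoint i j)
    have nd: "nderiv m j' (pull i' (harmonic l)) = (3/5) ^ m * (\<Sum>k\<in>idx. harm_coeff l i' k * (if k = j' then - 2 else 1))"
      if "i' \<in> idx" "j' \<in> idx" for i' j'
    proof -
      have "nderiv m j' (pull i' (harmonic l)) = (\<Sum>k\<in>idx. harm_coeff l i' k * nderiv m j' (harmonic k))"
        unfolding pull_harm[OF Suc.prems(2) that(1)] linear_sum[OF linear_nderiv] linear_scale[OF linear_nderiv] by simp
      also have "\<dots> = (\<Sum>k\<in>idx. (3/5) ^ m * (harm_coeff l i' k * (if k = j' then - 2 else 1)))"
        by (intro sum.cong refl) (use nderiv_harmonic[OF that(2)] in auto)
      finally show ?thesis by (simp only: sum_distrib_left)
    qed
    have "(\<Sum>k\<in>idx. harm_coeff l i k * (if k = j then - 2 else 1)) + (\<Sum>k\<in>idx. harm_coeff l j k * (if k = i then - 2 else 1)) = 0"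
      by (rule harm_coeff_balance[OF midpoint(1,2) Suc.prems(2) midpoint(3)])
    then show ?thesis
      unfolding midpoint(4) graph_laplacian_midpoint[OF midpoint(1-3)] nd[OF midpoint(1,2)] nd[OF midpoint(2,1)]
      by (simp only: distrib_left[symmetric] mult_zero_right)
  qed
qed

lemma inner_harmonic_expand:
  assumes "j \<in> idx"
  shows "inner u (harmonic j) = (\<Sum>i\<in>idx. \<Sum>l\<in>idx. harm_coeff j i l * inner (pull i u) (harmonic l)) / 3"
  by (subst inner_pull) (simp only: pull_harm[OF assms] inner_sum_right inner_scaleR_right cong: sum.cong)

lemma inner_tent_expand:
  assumes "k \<in> idx"
  shows "inner u (tent k) = (\<Sum>i\<in>idx. if i = k then 0 else inner (pull i u) (harmonic (6 - i - k))) / 3"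
proof -
  have "inner u (tent k) = (\<Sum>i\<in>idx. inner (pull i u) (pull i (tent k))) / 3" by (rule inner_pull)
  also have "\<dots> = (\<Sum>i\<in>idx. if i = k then 0 else inner (pull i u) (harmonic (6 - i - k))) / 3"
    by (intro arg_cong2[where f = "(/)"] sum.cong refl) (simp only: pull_tent[OF assms] inner_zero_right split: if_split, simp)
  finally show ?thesis .
qed

lemma linear_pull_green1:
  assumes "linear L" "i \<in> idx"
  shows "L (pull i (green1 u)) = (\<Sum>k\<in>idx. tent_coeff k u * (if i = k then 0 else (L (harmonic (6 - i - k)) :: real)))"
proof -
  have "L (pull i (green1 u)) = (\<Sum>k\<in>idx. tent_coeff k u * L (pull i (tent k)))"
    unfolding green1_def pull_sum pull_scaleR linear_sum[OF assms(1)] linear_scale[OF assms(1)] by simp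
  also have "\<dots> = (\<Sum>k\<in>idx. tent_coeff k u * (if i = k then 0 else L (harmonic (6 - i - k))))"
    by (intro sum.cong refl arg_cong2[where f = "(*)"]) (simp only: pull_tent[OF _ assms(2)] linear_0[OF assms(1)] split: if_split, simp)
  finally show ?thesis .
qed

lemma nderiv_pull_green:
  assumes "i \<in> idx" "j \<in> idx"
  shows "nderiv m j (pull i (green u)) = (1/5) * nderiv m j (green (pull i u)) +
    (3/5) ^ m * (\<Sum>k\<in>idx. tent_coeff k u * (if i = k then 0 else if 6 - i - k = j then - 2 else 1))"
proof -
  have "nderiv m j (pull i (green u)) = (1/5) * nderiv m j (green (pull i u)) +
      (\<Sum>k\<in>idx. tent_coeff k u * (if i = k then 0 else nderiv m j (harmonic (6 - i - k))))"
    unfolding pull_green[OF assms(1)] linear_add[OF linear_nderiv] linear_scale[OF linear_nderiv]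
      linear_pull_green1[OF linear_nderiv assms(1)] by simp
  also have "(\<Sum>k\<in>idx. tent_coeff k u * (if i = k then 0 else nderiv m j (harmonic (6 - i - k)))) =
      (\<Sum>k\<in>idx. (3/5) ^ m * (tent_coeff k u * (if i = k then 0 else if 6 - i - k = j then - 2 else 1)))"
    by (intro sum.cong refl) (use nderiv_harmonic[OF assms(2) third_idx[OF assms(1)]] in auto)
  finally show ?thesis by (simp only: sum_distrib_left)
qed

lemma nderiv_green:
  assumes "j \<in> idx"
  shows "nderiv m j (green u) = (3/5) ^ m * (inner u (harmonic j) - (1/3) ^ m * inner ((pull j ^^ m) u) (harmonic j))"
proof (induction m arbitrary: u)
  case 0
  have "val (green u) (corner l) = 0" if "l \<in> idx" for l
    using vanishes_green that unfolding vanishes_def by blast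
  then show ?case using assms by (simp add: nderiv_0)
next
  case (Suc m)
  have key: "(1/5) * inner (pull j u) (harmonic j) +
      (\<Sum>k\<in>idx. tent_coeff k u * (if j = k then 0 else if 6 - j - k = j then - 2 else 1)) = 3/5 * inner u (harmonic j)"
  proof -
    have "j = 1 \<or> j = 2 \<or> j = 3" using assms by auto
    then show ?thesis
      unfolding tent_coeff_def inner_harmonic_expand[OF assms, of u]
      by (elim disjE) (simp_all add: inner_tent_expand harm_coeff_def field_simps)
  qed
  have "nderiv (Suc m) j (green u) = (1/5) * ((3/5) ^ m * (inner (pull j u) (harmonic j)
        - (1/3) ^ m * inner ((pull j ^^ m) (pull j u)) (harmonic j)))
      + (3/5) ^ m * (3/5 * inner u (harmonic j) - (1/5) * inner (pull j u) (harmonic j))"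
    unfolding nderiv_Suc[OF assms] nderiv_pull_green[OF assms assms] Suc.IH key[symmetric] by simp
  also have "\<dots> = (3/5) ^ Suc m * (inner u (harmonic j) - (1/3) ^ Suc m * inner ((pull j ^^ Suc m) u) (harmonic j))"
    by (simp add: funpow_Suc_right algebra_simps del: funpow.simps)
  finally show ?case .
qed

lemma graph_laplacian_green_midpoint:
  assumes "i \<in> idx" "j \<in> idx" "i \<noteq> j"
  shows "5 ^ Suc m * graph_laplacian (Suc m) (val (green u)) (sg_map i (corner j)) =
    - (inner ((pull j ^^ m) (pull i u)) (harmonic j) + inner ((pull i ^^ m) (pull j u)) (harmonic i))"
proof -
  let ?S = "\<lambda>i j. \<Sum>k\<in>idx. tent_coeff k u * (if i = k then 0 else if 6 - i - k = j then - 2 else 1)"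
  have key: "(1/5) * (inner (pull i u) (harmonic j) + inner (pull j u) (harmonic i)) + (?S i j + ?S j i) = 0"
  proof -
    have "i = 1 \<or> i = 2 \<or> i = 3" "j = 1 \<or> j = 2 \<or> j = 3" using assms by auto
    moreover note assms(3)
    ultimately show ?thesis
      unfolding tent_coeff_def by (elim disjE) (simp_all add: inner_tent_expand field_simps)
  qed
  have "graph_laplacian (Suc m) (val (green u)) (sg_map i (corner j)) =
     (3/5) ^ m * ((1/5) * (inner (pull i u) (harmonic j) + inner (pull j u) (harmonic i)) + (?S i j + ?S j i))
     - (1/5) * (3/5) ^ m * (1/3) ^ m * (inner ((pull j ^^ m) (pull i u)) (harmonic j) + inner ((pull i ^^ m) (pull j u)) (harmonic i))"
    unfolding graph_laplacian_midpoint[OF assms] nderiv_pull_green[OF assms(1,2)] nderiv_pull_green[OF assms(2,1)]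
      nderiv_green[OF assms(2)] nderiv_green[OF assms(1)]
    by (simp only: algebra_simps)
  also have "(1/5) * (3/5) ^ m * (1/3 :: real) ^ m = 1 / 5 ^ Suc m"
    by (simp add: power_divide)
  finally show ?thesis unfolding key by (simp add: field_simps)
qed

lemma val_pull_funpow: "x \<in> sg \<Longrightarrow> val ((pull j ^^ m) u) x = val u ((sg_map j ^^ m) x)"
proof (induction m arbitrary: u)
  case (Suc m)
  have "(sg_map j ^^ m) x \<in> sg" by (induction m) (use Suc.prems sg_map_in_sg_any in auto)
  then show ?case using Suc by (simp add: funpow_Suc_right val_pull del: funpow.simps) (simp add: funpow_swap1)
qed simp

lemma dist_sg_map_funpow: "dist ((sg_map j ^^ m) x) ((sg_map j ^^ m) y) = dist x y / 2 ^ m"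
  by (induction m) (simp_all add: dist_sg_map)

lemma sg_map_funpow_corner: "(sg_map j ^^ m) (corner j) = corner j"
  by (induction m) (simp_all add: sg_map_corner_self)

lemma inner_nonneg:
  assumes "\<And>x. x \<in> sg \<Longrightarrow> 0 \<le> val u x" "\<And>x. x \<in> sg \<Longrightarrow> 0 \<le> val v x"
  shows "0 \<le> inner u v"
  unfolding inner_sgfun_def by (intro integral_nonneg_AE AE_I2) (simp add: assms)

lemma inner_harmonic_near:
  assumes "\<And>y. y \<in> sg \<Longrightarrow> \<bar>val w y - c\<bar> \<le> e" "j \<in> idx"
  shows "\<bar>inner w (harmonic j) - c / 3\<bar> \<le> e / 3"
proof -
  have "0 \<le> inner (w - (c - e) *\<^sub>R one_sg) (harmonic j)"
    using assms(1) harm_nonneg[OF assms(2)] by (intro inner_nonneg) (force simp: val_simps val_one_sg)+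
  moreover have "0 \<le> inner ((c + e) *\<^sub>R one_sg - w) (harmonic j)"
    using assms(1) harm_nonneg[OF assms(2)] by (intro inner_nonneg) (force simp: val_simps val_one_sg)+
  moreover have "inner one_sg (harmonic j) = 1/3"
    using inner_harm_one_sg[OF assms(2)] by (simp add: inner_commute)
  ultimately have "0 \<le> inner w (harmonic j) - (c - e) * (1/3)" "0 \<le> (c + e) * (1/3) - inner w (harmonic j)"
    by (simp_all only: inner_diff_left inner_scaleR_left)
  then show ?thesis unfolding abs_le_iff by (auto simp: field_simps)
qed

lemma graph_laplacian_green_error:
  assumes "x \<in> sg_vertices m - sg_vertices 0"
    "\<And>y z. y \<in> sg \<Longrightarrow> z \<in> sg \<Longrightarrow> dist y z \<le> 1 / 2 ^ m \<Longrightarrow> \<bar>val u y - val u z\<bar> \<le> e"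
  shows "\<bar>3/2 * 5 ^ m * graph_laplacian m (val (green u)) x + val u x\<bar> \<le> e"
  using assms
proof (induction m arbitrary: u x)
  case 0 then show ?case by simp
next
  case (Suc m)
  from Suc.prems(1) show ?case
  proof (cases rule: sg_vertices_cases)
    case (interior i y)
    have y: "y \<in> sg" "y \<notin> sg_vertices 0" using interior(2) sg_vertices_subset_sg by blast+
    have "3/2 * 5 ^ Suc m * graph_laplacian (Suc m) (val (green u)) x = 3/2 * 5 ^ m * graph_laplacian m (val (green (pull i u))) y"
    proof -
      have "(\<Sum>k\<in>idx. tent_coeff k u * (if i = k then 0 else graph_laplacian m (val (harmonic (6 - i - k))) y)) = 0"
      proof (rule sum.neutral, rule ballI)
        fix k assume k: "k \<in> idx"
        show "tent_coeff k u * (if i = k then 0 else graph_laplacian m (val (harmonic (6 - i - k))) y) = 0"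
          using graph_laplacian_harmonic[OF interior(2) third_idx[OF interior(1) k]] by (cases "i = k") simp_all
      qed
      then show ?thesis
        unfolding interior(3) graph_laplacian_interior[OF interior(1) y] pull_green[OF interior(1)]
          linear_add[OF linear_graph_laplacian] linear_scale[OF linear_graph_laplacian]
          linear_pull_green1[OF linear_graph_laplacian interior(1)] by simp
    qed
    moreover have "\<bar>3/2 * 5 ^ m * graph_laplacian m (val (green (pull i u))) y + val (pull i u) y\<bar> \<le> e"
    proof (rule Suc.IH[OF interior(2)])
      fix a b assume "a \<in> sg" "b \<in> sg" "dist a b \<le> 1 / 2 ^ m"
      then show "\<bar>val (pull i u) a - val (pull i u) b\<bar> \<le> e"
        unfolding val_pull[OF \<open>a \<in> sg\<close>] val_pull[OF \<open>b \<in> sg\<close>]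
        by (intro Suc.prems(2) sg_map_in_sg[OF interior(1)]) (simp_all add: dist_sg_map)
    qed
    moreover have "val (pull i u) y = val u x" by (simp only: val_pull[OF y(1)] interior(3))
    ultimately show ?thesis by (simp only:)
  next
    case (midpoint i j)
    have near: "\<bar>inner ((pull j' ^^ m) (pull i' u)) (harmonic j') - val u (sg_map i' (corner j')) / 3\<bar> \<le> e / 3"
      if i': "i' \<in> idx" and j': "j' \<in> idx" for i' j'
    proof (rule inner_harmonic_near[OF _ j'])
      fix y assume y: "y \<in> sg"
      have f: "(sg_map j' ^^ m) y \<in> sg" by (induction m) (use y sg_map_in_sg_any in auto)
      have "dist ((sg_map j' ^^ m) y) ((sg_map j' ^^ m) (corner j')) \<le> 1 / 2 ^ m"
        unfolding dist_sg_map_funpow using dist_sg_le[OF y corner_in_sg[OF j']] by (simp add: divide_right_mono)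
      then have "dist (sg_map i' ((sg_map j' ^^ m) y)) (sg_map i' (corner j')) \<le> 1 / 2 ^ Suc m"
        unfolding sg_map_funpow_corner by (simp add: dist_sg_map)
      then show "\<bar>val ((pull j' ^^ m) (pull i' u)) y - val u (sg_map i' (corner j'))\<bar> \<le> e"
        unfolding val_pull_funpow[OF y] val_pull[OF f]
        by (intro Suc.prems(2) sg_map_in_sg_any f corner_in_sg[OF j'])
    qed
    let ?A = "inner ((pull j ^^ m) (pull i u)) (harmonic j)" and ?B = "inner ((pull i ^^ m) (pull j u)) (harmonic i)"
    have "3/2 * 5 ^ Suc m * graph_laplacian (Suc m) (val (green u)) x = 3/2 * - (?A + ?B)"
      unfolding midpoint(4) graph_laplacian_green_midpoint[OF midpoint(1-3), symmetric] by simp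
    moreover have "\<bar>?A - val u x / 3\<bar> \<le> e / 3" using near[OF midpoint(1,2)] by (simp only: midpoint(4))
    moreover have "\<bar>?B - val u x / 3\<bar> \<le> e / 3"
      using near[OF midpoint(2,1)] by (simp only: midpoint(4) sg_map_corner_swap[of j i])
    moreover have "\<bar>G + c\<bar> \<le> e" if "G = 3/2 * - (A + B)" "\<bar>A - c / 3\<bar> \<le> e / 3" "\<bar>B - c / 3\<bar> \<le> e / 3"
      for G A B c :: real
    proof -
      have "- (e / 3) \<le> A - c / 3" "A - c / 3 \<le> e / 3" "- (e / 3) \<le> B - c / 3" "B - c / 3 \<le> e / 3"
        using that(2,3) by linarith+
      then show ?thesis unfolding that(1) abs_le_iff by (auto simp: field_simps)
    qed
    ultimately show ?thesis by blast
  qed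
qed

lemma has_laplacian_green: "has_laplacian (val (green u)) (\<lambda>x. - val u x)"
  unfolding has_laplacian_def
proof (intro conjI allI impI)
  fix e :: real assume e: "e > 0"
  have "uniformly_continuous_on sg (val u)"
    by (rule compact_uniformly_continuous[OF continuous_on_val compact_sg])
  then obtain d where d: "d > 0" "\<And>x y. x \<in> sg \<Longrightarrow> y \<in> sg \<Longrightarrow> dist y x < d \<Longrightarrow> dist (val u y) (val u x) < e / 2"
    unfolding uniformly_continuous_on_def using half_gt_zero[OF e] by blast
  obtain N where N: "1 / 2 ^ N < d" using half_power_less[OF d(1)] by blast
  have "\<bar>3/2 * 5 ^ m * graph_laplacian m (val (green u)) x - - val u x\<bar> < e"
    if "m \<ge> N" "x \<in> sg_vertices m - sg_vertices 0" for m x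
  proof -
    have "(1 :: real) / 2 ^ m \<le> 1 / 2 ^ N" using that(1) by (simp add: frac_le)
    then have "\<bar>val u y - val u z\<bar> \<le> e / 2" if "y \<in> sg" "z \<in> sg" "dist y z \<le> 1 / 2 ^ m" for y z
      using d(2)[OF that(2,1)] that(3) N by (simp add: dist_real_def)
    from graph_laplacian_green_error[OF that(2) this] show ?thesis using e by simp
  qed
  then show "\<exists>N. \<forall>m\<ge>N. \<forall>x\<in>sg_vertices m - sg_vertices 0.
      \<bar>3/2 * 5 ^ m * graph_laplacian m (val (green u)) x - - val u x\<bar> < e" by blast
qed (intro continuous_intros)+

lemma graph_laplacian_one_sg:
  assumes "x \<in> sg_vertices m - sg_vertices 0"
  shows "graph_laplacian m (val one_sg) x = 0"
  unfolding harm_sum_one_sg[symmetric] linear_sum[OF linear_graph_laplacian]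
  using graph_laplacian_harmonic[OF assms] by simp

lemma discrete_max_principle:
  assumes pos: "\<And>x. x \<in> sg_vertices m - sg_vertices 0 \<Longrightarrow> graph_laplacian m (val z) x > 0"
    and "vanishes z" "x \<in> sg_vertices m"
  shows "val z x \<le> 0"
proof -
  let ?M = "Max (val z ` sg_vertices m)"
  have fin: "finite (val z ` sg_vertices m)" using finite_sg_vertices by simp
  have le: "val z y \<le> ?M" if "y \<in> sg_vertices m" for y using fin that by (intro Max_ge) auto
  have "?M \<in> val z ` sg_vertices m" using fin assms(3) by (intro Max_in) auto
  then obtain a where a: "a \<in> sg_vertices m" "?M = val z a" by blast
  have "a \<in> sg_vertices 0"
  proof (rule ccontr)
    assume "a \<notin> sg_vertices 0"
    then have a': "a \<in> sg_vertices m - sg_vertices 0" using a(1) by blast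
    have asg: "a \<in> sg" using a(1) sg_vertices_subset_sg by blast
    have "nbr_sum m (val z) a \<le> (\<Sum>y | sg_adj m a y. val z a * val one_sg y)"
      unfolding nbr_sum_def
    proof (rule sum_mono)
      fix y assume "y \<in> {y. sg_adj m a y}"
      then have "y \<in> sg" "y \<in> sg_vertices m" using sg_adjD by blast+
      then show "val z y \<le> val z a * val one_sg y" using le[of y] a(2) by (simp add: val_one_sg)
    qed
    also have "\<dots> = val z a * nbr_sum m (val one_sg) a" by (simp add: nbr_sum_def sum_distrib_left)
    also have "nbr_sum m (val one_sg) a = 4"
      using graph_laplacian_one_sg[OF a'] by (simp add: graph_laplacian_nbr_sum val_one_sg[OF asg])
    finally show False using pos[OF a'] by (simp add: graph_laplacian_nbr_sum)
  qed
  then have "val z a = 0" using assms(2) unfolding vanishes_def sg_vertices_0 by auto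
  then show ?thesis using le[OF assms(3)] a(2) by simp
qed

lemma harmonic_vanishing_eq_0:
  assumes van: "vanishes w"
    and small: "\<And>e. e > 0 \<Longrightarrow> \<exists>N. \<forall>m\<ge>N. \<forall>x\<in>sg_vertices m - sg_vertices 0. \<bar>3/2 * 5 ^ m * graph_laplacian m (val w) x\<bar> < e"
  shows "w = 0"
proof (rule sgfun_eqI)
  define G where "G = green one_sg"
  have G: "3/2 * 5 ^ m * graph_laplacian m (val G) x = - 1" if "x \<in> sg_vertices m - sg_vertices 0" for m x
  proof -
    have "x \<in> sg" using that sg_vertices_subset_sg by blast
    have "\<bar>3/2 * 5 ^ m * graph_laplacian m (val G) x + val one_sg x\<bar> \<le> 0"
      unfolding G_def by (rule graph_laplacian_green_error[OF that]) (simp add: val_one_sg)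
    then show ?thesis using val_one_sg[OF \<open>x \<in> sg\<close>] by simp
  qed
  have G2: "val G x \<le> 2" if "x \<in> sg" for x
    using green_props(3)[OF that, of one_sg] inner_one_sg by (simp add: G_def norm_eq_1[symmetric])
  have vG: "vanishes G" by (simp add: G_def vanishes_green)
  fix x assume x: "x \<in> sg"
  have "\<bar>val w x\<bar> \<le> e" if e: "e > 0" for e
  proof -
    define r where "r = e / 4"
    have r: "r > 0" using e by (simp add: r_def)
    obtain N where N: "\<And>m x. m \<ge> N \<Longrightarrow> x \<in> sg_vertices m - sg_vertices 0 \<Longrightarrow> \<bar>3/2 * 5 ^ m * graph_laplacian m (val w) x\<bar> < r"
      using small[OF r] by blast
    have bound: "\<bar>val w y\<bar> \<le> 2 * r" if m: "m \<ge> N" and y: "y \<in> sg_vertices m" for m y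
    proof -
      have one: "val (s *\<^sub>R w - r *\<^sub>R G) y \<le> 0" if s: "\<bar>s\<bar> = 1" for s
      proof (rule discrete_max_principle[OF _ _ y])
        show "vanishes (s *\<^sub>R w - r *\<^sub>R G)" using van vG by (simp add: vanishes_def val_simps)
        fix a assume a: "a \<in> sg_vertices m - sg_vertices 0"
        have "3/2 * 5 ^ m * graph_laplacian m (val (s *\<^sub>R w - r *\<^sub>R G)) a =
            s * (3/2 * 5 ^ m * graph_laplacian m (val w) a) - r * (3/2 * 5 ^ m * graph_laplacian m (val G) a)"
          by (simp add: linear_diff[OF linear_graph_laplacian] linear_scale[OF linear_graph_laplacian] algebra_simps)
        also have "\<dots> = s * (3/2 * 5 ^ m * graph_laplacian m (val w) a) + r" by (simp only: G[OF a])
        also have "\<dots> > 0"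
        proof -
          have "s = 1 \<or> s = - 1" using s by linarith
          then show ?thesis using N[OF m a] by (auto simp: abs_less_iff)
        qed
        finally show "graph_laplacian m (val (s *\<^sub>R w - r *\<^sub>R G)) a > 0"
          by (simp add: zero_less_mult_iff)
      qed
      have "y \<in> sg" using y sg_vertices_subset_sg by blast
      then have "r * val G y \<le> r * 2" using r G2 by (intro mult_left_mono) auto
      then show ?thesis using one[of 1] one[of "-1"] by (simp add: val_simps abs_le_iff)
    qed
    obtain d where d: "d > 0" "\<And>y. y \<in> sg \<Longrightarrow> dist y x < d \<Longrightarrow> dist (val w y) (val w x) < r"
      using continuous_on_val[of w, unfolded continuous_on_iff, rule_format, OF x r] by blast
    obtain k where k: "1 / 2 ^ k < d" using half_power_less[OF d(1)] by blast
    define m where "m = max N k"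
    obtain y where y: "y \<in> sg_vertices m" "dist x y \<le> 1 / 2 ^ m" using sg_vertices_dense[OF x] by blast
    have "(1 :: real) / 2 ^ m \<le> 1 / 2 ^ k" by (simp add: m_def frac_le)
    then have "dist y x < d" using y(2) k by (simp add: dist_commute)
    then have "\<bar>val w y - val w x\<bar> < r" using d(2)[of y] y(1) sg_vertices_subset_sg by (auto simp: dist_real_def)
    moreover have "\<bar>val w y\<bar> \<le> 2 * r" by (rule bound[OF _ y(1)]) (simp add: m_def)
    ultimately show ?thesis unfolding r_def by linarith
  qed
  then have "\<bar>val w x\<bar> \<le> 0" by (rule field_le_epsilon[of "\<bar>val w x\<bar>" 0, unfolded add_0])
  then show "val w x = val 0 x" by (simp add: val_simps)
qed

lemma has_laplacian_imp_green:
  assumes h: "has_laplacian u g" and zero: "\<And>x. x \<in> sg_vertices 0 \<Longrightarrow> u x = 0"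
  shows "mk u = - green (mk g)"
proof -
  have cu: "continuous_on sg u" "continuous_on sg g" using h by (simp_all add: has_laplacian_def)
  define w where "w = mk u + green (mk g)"
  have "w = 0"
  proof (rule harmonic_vanishing_eq_0)
    show "vanishes w"
      unfolding vanishes_def
    proof
      fix j assume j: "j \<in> idx"
      have "u (corner j) = 0" by (rule zero[OF corner_in_sg_vertices[OF j]])
      moreover have "val (green (mk g)) (corner j) = 0" using vanishes_green j unfolding vanishes_def by blast
      ultimately show "val w (corner j) = 0"
        using corner_in_sg[OF j] by (simp add: w_def val_simps val_mk[OF cu(1)])
    qed
    fix e :: real assume e: "e > 0"
    obtain N1 where N1: "\<And>m x. m \<ge> N1 \<Longrightarrow> x \<in> sg_vertices m - sg_vertices 0 \<Longrightarrow>
        \<bar>3/2 * 5 ^ m * graph_laplacian m u x - g x\<bar> < e / 2"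
      using h half_gt_zero[OF e] unfolding has_laplacian_def by blast
    obtain N2 where N2: "\<And>m x. m \<ge> N2 \<Longrightarrow> x \<in> sg_vertices m - sg_vertices 0 \<Longrightarrow>
        \<bar>3/2 * 5 ^ m * graph_laplacian m (val (green (mk g))) x - - val (mk g) x\<bar> < e / 2"
      using has_laplacian_green[of "mk g"] half_gt_zero[OF e] unfolding has_laplacian_def by blast
    have "\<bar>3/2 * 5 ^ m * graph_laplacian m (val w) x\<bar> < e"
      if m: "m \<ge> max N1 N2" and x: "x \<in> sg_vertices m - sg_vertices 0" for m x
    proof -
      have xs: "x \<in> sg" using x sg_vertices_subset_sg by blast
      have "graph_laplacian m (val (mk u)) x = graph_laplacian m u x"
      proof -
        have "nbr_sum m (val (mk u)) x = nbr_sum m u x"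
          by (rule nbr_sum_cong) (simp add: val_mk[OF cu(1)])
        then show ?thesis using xs by (simp add: graph_laplacian_nbr_sum val_mk[OF cu(1)])
      qed
      then have "3/2 * 5 ^ m * graph_laplacian m (val w) x =
         (3/2 * 5 ^ m * graph_laplacian m u x - g x) + (3/2 * 5 ^ m * graph_laplacian m (val (green (mk g))) x - - val (mk g) x)"
        using xs by (simp add: w_def linear_add[OF linear_graph_laplacian] val_mk[OF cu(2)] algebra_simps)
      moreover have "\<bar>3/2 * 5 ^ m * graph_laplacian m u x - g x\<bar> < e / 2"
        by (rule N1[OF _ x]) (use m in simp)
      moreover have "\<bar>3/2 * 5 ^ m * graph_laplacian m (val (green (mk g))) x - - val (mk g) x\<bar> < e / 2"
        by (rule N2[OF _ x]) (use m in simp)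
      ultimately show ?thesis by linarith
    qed
    then show "\<exists>N. \<forall>m\<ge>N. \<forall>x\<in>sg_vertices m - sg_vertices 0. \<bar>3/2 * 5 ^ m * graph_laplacian m (val w) x\<bar> < e"
      by blast
  qed
  then show ?thesis by (simp add: w_def eq_neg_iff_add_eq_0)
qed

lemma dirichlet_eigenfunction_iff:
  "dirichlet_eigenfunction l u \<longleftrightarrow> (\<exists>v. u = val v \<and> v \<noteq> 0 \<and> v = l *\<^sub>R green v)"
proof
  assume "dirichlet_eigenfunction l u"
  then obtain g where g: "\<And>x. x \<notin> sg \<Longrightarrow> u x = 0" "u \<noteq> 0" "has_laplacian u g"
    "\<And>x. x \<in> sg \<Longrightarrow> - g x = l * u x" "\<And>x. x \<in> sg_vertices 0 \<Longrightarrow> u x = 0"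
    unfolding dirichlet_eigenfunction_def by blast
  have cu: "continuous_on sg u" "continuous_on sg g" using g(3) by (simp_all add: has_laplacian_def)
  have u: "u = val (mk u)" using g(1) by (auto simp: val_mk[OF cu(1)])
  have "mk g = - l *\<^sub>R mk u"
    by (rule sgfun_eqI) (use g(4) in \<open>force simp: val_mk[OF cu(1)] val_mk[OF cu(2)] val_simps\<close>)
  then have "mk u = l *\<^sub>R green (mk u)"
    using has_laplacian_imp_green[OF g(3,5)] by (simp add: linear_scale[OF linear_green] linear_neg[OF linear_green])
  moreover have "mk u \<noteq> 0"
  proof
    assume "mk u = 0"
    then have "u = val 0" using u by simp
    then show False using g(2) by (simp add: fun_eq_iff val_simps)
  qed
  ultimately show "\<exists>v. u = val v \<and> v \<noteq> 0 \<and> v = l *\<^sub>R green v" using u by blast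
next
  assume "\<exists>v. u = val v \<and> v \<noteq> 0 \<and> v = l *\<^sub>R green v"
  then obtain v where v: "u = val v" "v \<noteq> 0" "v = l *\<^sub>R green v" by blast
  have "has_laplacian u (\<lambda>x. - val (l *\<^sub>R v) x)"
    using has_laplacian_green[of "l *\<^sub>R v"] v by (simp add: linear_scale[OF linear_green])
  moreover have "u \<noteq> 0"
  proof
    assume "u = 0"
    then have "v = 0" by (intro sgfun_eqI) (simp add: v(1)[symmetric] val_simps)
    then show False using v(2) by simp
  qed
  moreover have "u x = 0" if "x \<in> sg_vertices 0" for x
  proof -
    from that have "x \<in> corner ` idx" by (simp only: sg_vertices_0)
    then obtain j where j: "j \<in> idx" "x = corner j" by (rule imageE)
    have "vanishes (l *\<^sub>R green v)" by (intro vanishes_scaleR vanishes_green)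
    then have "vanishes v" by (simp only: v(3)[symmetric])
    then have "val v (corner j) = 0" using j(1) unfolding vanishes_def by (rule bspec)
    then show ?thesis by (simp only: v(1) j(2))
  qed
  ultimately show "dirichlet_eigenfunction l u"
    unfolding dirichlet_eigenfunction_def using val_outside
    by (intro conjI exI[of _ "\<lambda>x. - val (l *\<^sub>R v) x"]) (auto simp: v(1) val_simps)
qed

section \<open>Localisation to cells\<close>

definition emb :: "nat \<Rightarrow> sgfun \<Rightarrow> sgfun" where
  "emb i u = sqrt 3 *\<^sub>R glue (\<lambda>j. if j = i then u else 0)"

lemma pull_emb: "vanishes u \<Longrightarrow> j \<in> idx \<Longrightarrow> pull j (emb i u) = (if j = i then sqrt 3 *\<^sub>R u else 0)"
  unfolding emb_def pull_scaleR
  by (subst pull_glue) (auto intro: compatible_vanishes simp: vanishes_0)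

lemma vanishes_emb: "vanishes u \<Longrightarrow> vanishes (emb i u)"
  unfolding emb_def by (intro vanishes_scaleR vanishes_glue) (simp add: vanishes_0)

lemma inner_emb:
  assumes "vanishes u" "i \<in> idx"
  shows "inner v (emb i u) = inner (pull i v) u / sqrt 3"
proof -
  have "inner v (emb i u) = (\<Sum>j\<in>idx. if j = i then sqrt 3 * inner (pull i v) u else 0) / 3"
    by (subst inner_pull) (intro arg_cong2[where f = "(/)"] sum.cong refl, simp add: pull_emb[OF assms(1)])
  also have "\<dots> = sqrt 3 * inner (pull i v) u / 3" using assms(2) by (subst sum.delta) auto
  also have "\<dots> = inner (pull i v) u / sqrt 3"
    by (simp add: field_simps)
  finally show ?thesis .
qed

lemma inner_emb_emb:
  assumes "vanishes u" "vanishes v" "i \<in> idx" "j \<in> idx"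
  shows "inner (emb i u) (emb j v) = (if i = j then inner u v else 0)"
  unfolding inner_emb[OF assms(2,4)] pull_emb[OF assms(1,4)] by simp

lemma cellwise_emb:
  assumes "admissible T" "vanishes u"
  shows "cellwise T (emb i u) = (1/5) *\<^sub>R emb i (T u)"
proof -
  have T: "linear T" "\<And>u. vanishes (T u)" using assms(1) unfolding admissible_def form_symmetric_def by blast+
  show ?thesis
    by (rule sgfun_eqI_pull)
       (simp add: pull_cellwise[OF T(2)] pull_scaleR pull_emb[OF assms(2)] pull_emb[OF T(2)] linear_scale[OF T(1)] linear_0[OF T(1)])
qed

definition spread :: "sgfun set \<Rightarrow> sgfun set" where
  "spread Q = (\<Union>i\<in>idx. emb i ` Q)"

lemma orthonormal_spread:
  assumes "orthonormal Q" "\<And>q. q \<in> Q \<Longrightarrow> vanishes q"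
  shows "orthonormal (spread Q)"
proof -
  have self: "inner (emb i q) (emb i q) = 1" if "i \<in> idx" "q \<in> Q" for i q
    using inner_emb_emb[OF assms(2)[OF that(2)] assms(2)[OF that(2)] that(1,1)] orthonormalD(2)[OF assms(1) that(2)] by simp
  have "inner a b = (if a = b then 1 else 0)" if a: "a \<in> spread Q" and b: "b \<in> spread Q" for a b
  proof -
    obtain i q where q: "i \<in> idx" "q \<in> Q" "a = emb i q" using a unfolding spread_def by blast
    obtain j p where p: "j \<in> idx" "p \<in> Q" "b = emb j p" using b unfolding spread_def by blast
    have ab: "inner a b = (if i = j then inner q p else 0)"
      unfolding q(3) p(3) by (rule inner_emb_emb) (use assms(2) q p in auto)
    have aa: "inner a a = 1" using self q by simp
    show ?thesis
    proof (cases "i = j \<and> q = p")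
      case True then show ?thesis using aa q p by simp
    next
      case False
      then have "inner a b = 0" using ab orthonormalD(3)[OF assms(1) q(2) p(2)] by auto
      then show ?thesis using aa by auto
    qed
  qed
  moreover have "finite (spread Q)" unfolding spread_def using orthonormalD(1)[OF assms(1)] by simp
  ultimately show ?thesis unfolding orthonormal_def by blast
qed

lemma emb_inj_on:
  assumes "\<And>q. q \<in> Q \<Longrightarrow> vanishes q" "i \<in> idx"
  shows "inj_on (emb i) Q"
proof (rule inj_onI)
  fix q p assume "q \<in> Q" "p \<in> Q" "emb i q = emb i p"
  then have "pull i (emb i q) = pull i (emb i p)" by (simp only:)
  then show "q = p"
    unfolding pull_emb[OF assms(1)[OF \<open>q \<in> Q\<close>] assms(2)] pull_emb[OF assms(1)[OF \<open>p \<in> Q\<close>] assms(2)] by simp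
qed

lemma sum_spread:
  assumes "orthonormal Q" "\<And>q. q \<in> Q \<Longrightarrow> vanishes q"
  shows "(\<Sum>q\<in>spread Q. g q) = (\<Sum>i\<in>idx. \<Sum>q\<in>Q. g (emb i q))"
proof -
  have "(\<Sum>q\<in>spread Q. g q) = (\<Sum>i\<in>idx. \<Sum>q\<in>emb i ` Q. g q)"
    unfolding spread_def
  proof (rule sum.UNION_disjoint)
    show "\<forall>i\<in>idx. \<forall>j\<in>idx. i \<noteq> j \<longrightarrow> emb i ` Q \<inter> emb j ` Q = {}"
    proof (intro ballI impI equals0I)
      fix i j a assume ij: "i \<in> idx" "j \<in> idx" "i \<noteq> j" "a \<in> emb i ` Q \<inter> emb j ` Q"
      then obtain q p where qp: "q \<in> Q" "p \<in> Q" "a = emb i q" "a = emb j p" by blast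
      have "inner a a = 0"
        using inner_emb_emb[OF assms(2)[OF qp(1)] assms(2)[OF qp(2)] ij(1,2)] ij(3) qp(3,4) by simp
      moreover have "inner a a = 1"
        using inner_emb_emb[OF assms(2)[OF qp(1)] assms(2)[OF qp(1)] ij(1,1)] orthonormalD(2)[OF assms(1) qp(1)] qp(3) by simp
      ultimately show False by simp
    qed
  qed (use orthonormalD(1)[OF assms(1)] in auto)
  also have "\<dots> = (\<Sum>i\<in>idx. \<Sum>q\<in>Q. g (emb i q))"
    by (rule sum.cong[OF refl], subst sum.reindex) (use emb_inj_on[OF assms(2)] in \<open>auto simp: o_def\<close>)
  finally show ?thesis .
qed

lemma card_spread:
  assumes "orthonormal Q" "\<And>q. q \<in> Q \<Longrightarrow> vanishes q"
  shows "card (spread Q) = 3 * card Q"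
  using sum_spread[OF assms, of "\<lambda>_. 1 :: nat"] by simp

lemma spectral_family_spread:
  assumes adm: "admissible T" and sf: "spectral_family T \<kappa> Q" and van: "\<And>q. q \<in> Q \<Longrightarrow> vanishes q"
  shows "spectral_family (cellwise T) (\<kappa> / 5) (spread Q)"
proof -
  have T: "\<And>u. vanishes (T u)" "linear T" using adm unfolding admissible_def form_symmetric_def by blast+
  have ef: "eigen_family T \<kappa> Q" using sf by (simp add: spectral_family_def)
  have on: "orthonormal Q" using ef by (simp add: eigen_family_def)
  have ons: "orthonormal (spread Q)" by (rule orthonormal_spread[OF on van])
  have "cellwise T b = inner (cellwise T b) b *\<^sub>R b \<and> inner (cellwise T b) b \<ge> \<kappa> / 5" if b: "b \<in> spread Q" for b
  proof -
    obtain i q where q: "i \<in> idx" "q \<in> Q" "b = emb i q" using b unfolding spread_def by blast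
    have Tq: "T q = inner (T q) q *\<^sub>R q" "inner (T q) q \<ge> \<kappa>" using ef q(2) unfolding eigen_family_def by blast+
    have lin: "emb i (c *\<^sub>R q) = c *\<^sub>R emb i q" for c
      by (rule sgfun_eqI_pull) (simp add: pull_scaleR pull_emb van[OF q(2)] vanishes_scaleR)
    have "cellwise T b = (1/5) *\<^sub>R emb i (T q)" unfolding q(3) by (rule cellwise_emb[OF adm van[OF q(2)]])
    also have "\<dots> = (inner (T q) q / 5) *\<^sub>R b" by (subst Tq(1)) (simp add: lin q(3))
    finally have *: "cellwise T b = (inner (T q) q / 5) *\<^sub>R b" .
    then have "inner (cellwise T b) b = inner (T q) q / 5 * inner b b" by simp
    then have "inner (cellwise T b) b = inner (T q) q / 5" unfolding orthonormalD(2)[OF ons b] by simp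
    then show ?thesis using * Tq(2) by (simp only:) simp
  qed
  moreover have "inner (cellwise T u) u < \<kappa> / 5 * inner u u" if u: "\<forall>b\<in>spread Q. inner u b = 0" "u \<noteq> 0" for u
  proof -
    have perp: "\<forall>q\<in>Q. inner (pull i u) q = 0" if i: "i \<in> idx" for i
    proof
      fix q assume q: "q \<in> Q"
      then have "emb i q \<in> spread Q" using i unfolding spread_def by blast
      then have "inner (pull i u) q / sqrt 3 = 0" using u(1) inner_emb[OF van[OF q] i, of u] by auto
      then show "inner (pull i u) q = 0" by simp
    qed
    have lt: "inner (T (pull i u)) (pull i u) < \<kappa> * inner (pull i u) (pull i u)" if "i \<in> idx" "pull i u \<noteq> 0" for i
      using sf perp[OF that(1)] that(2) unfolding spectral_family_def by blast
    have le: "inner (T (pull i u)) (pull i u) \<le> \<kappa> * inner (pull i u) (pull i u)" if "i \<in> idx" for i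
      using lt[OF that] by (cases "pull i u = 0") (auto simp: linear_0[OF T(2)])
    have "\<exists>i\<in>idx. pull i u \<noteq> 0"
    proof (rule ccontr)
      assume "\<not> ?thesis"
      then have "\<And>i. i \<in> idx \<Longrightarrow> pull i u = pull i 0" by (simp only: pull_0) blast
      then have "u = 0" by (rule sgfun_eqI_pull)
      then show False using u(2) by simp
    qed
    then have "(\<Sum>i\<in>idx. inner (T (pull i u)) (pull i u)) < (\<Sum>i\<in>idx. \<kappa> * inner (pull i u) (pull i u))"
      using lt le by (intro sum_strict_mono_ex1) blast+
    also have "\<dots> = \<kappa> * (3 * inner u u)"
      unfolding sum_distrib_left[symmetric] inner_pull[of u u] by simp
    finally show ?thesis unfolding inner_cellwise[OF T(1)] by simp
  qed
  ultimately show ?thesis using ons unfolding spectral_family_def eigen_family_def by blast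
qed

definition loc :: "nat \<Rightarrow> sgfun \<Rightarrow> sgfun" where
  "loc N = (cellwise ^^ N) green"

lemma loc_0: "loc 0 = green" and loc_Suc: "loc (Suc N) = cellwise (loc N)"
  by (simp_all add: loc_def)

lemma admissible_loc: "admissible (loc N)"
  by (induction N) (simp_all add: loc_0 loc_Suc admissible_green admissible_cellwise)

lemma form_symmetric_loc: "form_symmetric (loc N)" and loc_psd: "0 \<le> inner (loc N u) u"
  and vanishes_loc: "vanishes (loc N u)"
  using admissible_loc unfolding admissible_def by blast+

lemma loc_le_green: "inner (loc N u) u \<le> inner (green u) u"
proof (induction N arbitrary: u)
  case (Suc N)
  have "inner (loc (Suc N) u) u \<le> inner (cellwise green u) u"
    unfolding loc_Suc inner_cellwise[OF vanishes_loc] inner_cellwise[OF vanishes_green]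
    by (intro divide_right_mono sum_mono Suc) simp
  also have "\<dots> \<le> inner (green u) u"
  proof -
    have "0 \<le> inner (green1 u) u" using admissible_green1 unfolding admissible_def by blast
    then show ?thesis unfolding green_eq[of u] inner_add_left by simp
  qed
  finally show ?case .
qed (simp add: loc_0)

lemma loc_finite_rank:
  "\<exists>C. finite C \<and> 2 * card C + 3 \<le> 3 * 3 ^ N \<and> (\<forall>c\<in>C. linear (c :: sgfun \<Rightarrow> real)) \<and>
    (\<forall>u. (\<forall>c\<in>C. c u = 0) \<longrightarrow> green u = loc N u)"
proof (induction N)
  case 0
  then show ?case by (intro exI[of _ "{}"]) (simp add: loc_0)
next
  case (Suc N)
  then obtain C where C: "finite C" "2 * card C + 3 \<le> 3 * 3 ^ N" "\<And>c. c \<in> C \<Longrightarrow> linear (c :: sgfun \<Rightarrow> real)"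
    "\<And>u. (\<And>c. c \<in> C \<Longrightarrow> c u = 0) \<Longrightarrow> green u = loc N u" by blast
  define D where "D = (\<lambda>i. (\<lambda>c u. c (pull i u)) ` C)"
  define E where "E = tent_coeff ` idx \<union> (D 1 \<union> (D 2 \<union> D 3))"
  have cD: "card (D i) \<le> card C" for i unfolding D_def by (rule card_image_le[OF C(1)])
  have "card E \<le> card (tent_coeff ` idx) + (card (D 1) + (card (D 2) + card (D 3)))"
    unfolding E_def by (intro order_trans[OF card_Un_le] add_left_mono order_refl)
  also have "card (tent_coeff ` idx) \<le> card idx" by (rule card_image_le) simp
  finally have "card E \<le> 3 + 3 * card C" using cD[of 1] cD[of 2] cD[of 3] by simp
  then have "2 * card E + 3 \<le> 3 * 3 ^ Suc N" using C(2) by simp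
  moreover have "finite E" unfolding E_def D_def using C(1) by simp
  moreover have "linear c" if "c \<in> E" for c
  proof -
    have "linear (\<lambda>u. c (pull i u))" if "c \<in> C" for c i
      using linear_compose[OF linear_pull C(3)[OF that]] by (simp add: o_def)
    then show ?thesis
      using that bounded_linear.linear[OF bounded_linear_tent_coeff] unfolding E_def D_def by blast
  qed
  moreover have "green u = loc (Suc N) u" if u: "\<forall>c\<in>E. c u = 0" for u
  proof (rule sgfun_eqI_pull)
    fix i assume i: "i \<in> idx"
    have "tent_coeff k u = 0" if "k \<in> idx" for k using u that unfolding E_def by blast
    then have "green1 u = 0" unfolding green1_def by simp
    moreover have "green (pull i u) = loc N (pull i u)"
    proof (rule C(4))
      fix c assume "c \<in> C"
      then have "(\<lambda>u. c (pull i u)) \<in> E" using i unfolding E_def D_def by auto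
      from bspec[OF u this] show "c (pull i u) = 0" .
    qed
    ultimately show "pull i (green u) = pull i (loc (Suc N) u)"
      unfolding pull_green[OF i] loc_Suc pull_cellwise[OF vanishes_loc i] by (simp add: pull_0)
  qed
  ultimately show ?case by blast
qed

primrec qfam :: "nat \<Rightarrow> sgfun set \<Rightarrow> sgfun set" where
  "qfam 0 B = B"
| "qfam (Suc N) B = spread (qfam N B)"

lemma spectral_family_vanishes:
  assumes "spectral_family green \<kappa> B" "\<kappa> > 0" "b \<in> B"
  shows "vanishes b"
proof -
  have "green b = inner (green b) b *\<^sub>R b" "inner (green b) b > 0"
    using assms unfolding spectral_family_def eigen_family_def by force+
  then have "b = (1 / inner (green b) b) *\<^sub>R green b"
    by (metis less_irrefl nonzero_divide_eq_eq scaleR_one scaleR_scaleR times_divide_eq_left mult_1)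
  then show ?thesis using vanishes_scaleR[OF vanishes_green] by metis
qed

lemma qfam_props:
  assumes "spectral_family green \<kappa> B" "\<kappa> > 0"
  shows "spectral_family (loc N) (\<kappa> / 5 ^ N) (qfam N B)" "card (qfam N B) = 3 ^ N * card B"
    "q \<in> qfam N B \<Longrightarrow> vanishes q"
proof -
  have "spectral_family (loc N) (\<kappa> / 5 ^ N) (qfam N B) \<and> card (qfam N B) = 3 ^ N * card B \<and>
    (\<forall>q\<in>qfam N B. vanishes q)"
  proof (induction N)
    case 0
    then show ?case using assms spectral_family_vanishes[OF assms] by (simp add: loc_0)
  next
    case (Suc N)
    then have sf: "spectral_family (loc N) (\<kappa> / 5 ^ N) (qfam N B)" and van: "\<And>q. q \<in> qfam N B \<Longrightarrow> vanishes q" by auto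
    have on: "orthonormal (qfam N B)" using sf by (simp add: spectral_family_def eigen_family_def)
    have "vanishes q" if "q \<in> spread (qfam N B)" for q
      using that van vanishes_emb unfolding spread_def by blast
    then show ?case
      using spectral_family_spread[OF admissible_loc sf van] card_spread[OF on van] Suc by (simp add: loc_Suc mult.commute)
  qed
  then show "spectral_family (loc N) (\<kappa> / 5 ^ N) (qfam N B)" "card (qfam N B) = 3 ^ N * card B"
    "q \<in> qfam N B \<Longrightarrow> vanishes q" by blast+
qed

lemma emb_support:
  assumes "vanishes u" "i \<in> idx" "x \<in> sg" "val (emb i u) x \<noteq> 0"
  obtains y where "y \<in> sg" "x = sg_map i y" "val u y \<noteq> 0"
proof -
  from assms(3) obtain k y where y: "k \<in> idx" "y \<in> sg" "x = sg_map k y" by (rule sg_cases)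
  have *: "val (emb i u) x = val (if k = i then sqrt 3 *\<^sub>R u else 0) y"
    unfolding y(3) val_pull[OF y(2), symmetric] pull_emb[OF assms(1) y(1)] ..
  have "k = i"
  proof (rule ccontr)
    assume "k \<noteq> i" then show False using * assms(4) by (simp add: val_simps)
  qed
  then show thesis using that[of y] y * assms(4) by (simp add: val_simps)
qed

context
  fixes \<kappa> :: real and B :: "sgfun set"
  assumes sf: "spectral_family green \<kappa> B" and pos: "\<kappa> > 0"
begin

lemma qfam_support:
  assumes "q \<in> qfam N B" "x \<in> sg" "y \<in> sg" "val q x \<noteq> 0" "val q y \<noteq> 0"
  shows "dist x y \<le> 1 / 2 ^ N"
  using assms
proof (induction N arbitrary: q x y)
  case 0 then show ?case using dist_sg_le by simp
next
  case (Suc N)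
  obtain i p where p: "i \<in> idx" "p \<in> qfam N B" "q = emb i p" using Suc.prems(1) unfolding qfam.simps spread_def by blast
  have van: "vanishes p" by (rule qfam_props(3)[OF sf pos p(2)])
  obtain x' where x': "x' \<in> sg" "x = sg_map i x'" "val p x' \<noteq> 0"
    using emb_support[OF van p(1) Suc.prems(2)] Suc.prems(4) p(3) by blast
  obtain y' where y': "y' \<in> sg" "y = sg_map i y'" "val p y' \<noteq> 0"
    using emb_support[OF van p(1) Suc.prems(3)] Suc.prems(5) p(3) by blast
  show ?case using Suc.IH[OF p(2) x'(1) y'(1) x'(3) y'(3)] by (simp add: x'(2) y'(2) dist_sg_map)
qed

lemma qfam_equidistribution:
  fixes \<phi> :: "real ^ 2 \<Rightarrow> real" and \<delta> :: real
  assumes "continuous_on sg \<phi>"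
    "\<And>x y. x \<in> sg \<Longrightarrow> y \<in> sg \<Longrightarrow> dist x y \<le> 1 / 2 ^ N \<Longrightarrow> \<bar>\<phi> x - \<phi> y\<bar> \<le> \<delta>"
    "\<And>q. q \<in> qfam N B \<Longrightarrow> pt q \<in> sg \<and> val q (pt q) \<noteq> 0"
  shows "\<bar>(\<Sum>q\<in>qfam N B. \<phi> (pt q)) - card (qfam N B) * (LINT x|sg_measure. \<phi> x)\<bar> \<le> card (qfam N B) * \<delta>"
  using assms
proof (induction N arbitrary: \<phi> pt)
  case 0
  interpret prob_space sg_measure by (rule prob_space_sg_measure)
  have b: "\<bar>\<phi> x - \<phi> y\<bar> \<le> \<delta>" if "x \<in> sg" "y \<in> sg" for x y
    using 0(2)[OF that] dist_sg_le[OF that] by simp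
  have one: "\<bar>\<phi> x - (LINT y|sg_measure. \<phi> y)\<bar> \<le> \<delta>" if x: "x \<in> sg" for x
  proof -
    have "(LINT y|sg_measure. \<phi> y) \<le> (LINT y|sg_measure. \<phi> x + \<delta>)"
      using b[OF x] by (intro integral_mono integrable_sg 0(1)) (force simp: abs_le_iff)+
    moreover have "(LINT y|sg_measure. \<phi> x - \<delta>) \<le> (LINT y|sg_measure. \<phi> y)"
      using b[OF x] by (intro integral_mono integrable_sg 0(1)) (force simp: abs_le_iff)+
    ultimately show ?thesis by (simp add: prob_space[unfolded space_sg_measure] abs_le_iff)
  qed
  have "\<bar>(\<Sum>q\<in>B. \<phi> (pt q)) - card B * (LINT x|sg_measure. \<phi> x)\<bar> = \<bar>\<Sum>q\<in>B. \<phi> (pt q) - (LINT x|sg_measure. \<phi> x)\<bar>"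
    by (simp add: sum_subtractf)
  also have "\<dots> \<le> (\<Sum>q\<in>B. \<bar>\<phi> (pt q) - (LINT x|sg_measure. \<phi> x)\<bar>)" by (rule sum_abs)
  also have "\<dots> \<le> (\<Sum>q\<in>B. \<delta>)" using 0(3) by (intro sum_mono one) auto
  finally show ?case by simp
next
  case (Suc N)
  note props = qfam_props[OF sf pos, where N = N]
  have on: "orthonormal (qfam N B)" using props(1) by (simp add: spectral_family_def eigen_family_def)
  define n where "n = real (card (qfam N B))"
  define p where "p = (\<lambda>i q. 2 *\<^sub>R pt (emb i q) - corner i)"
  have p: "p i q \<in> sg \<and> val q (p i q) \<noteq> 0 \<and> sg_map i (p i q) = pt (emb i q)" if i: "i \<in> idx" and q: "q \<in> qfam N B" for i q
  proof -
    have "emb i q \<in> qfam (Suc N) B" using i q unfolding qfam.simps spread_def by blast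
    from Suc.prems(3)[OF this] obtain y where "y \<in> sg" "pt (emb i q) = sg_map i y" "val q y \<noteq> 0"
      using emb_support[OF props(3)[OF q] i] by blast
    then show ?thesis by (simp add: p_def sg_map_inverse)
  qed
  have IH: "\<bar>(\<Sum>q\<in>qfam N B. \<phi> (pt (emb i q))) - n * (LINT x|sg_measure. \<phi> (sg_map i x))\<bar> \<le> n * \<delta>" if i: "i \<in> idx" for i
  proof -
    have "\<bar>(\<Sum>q\<in>qfam N B. \<phi> (sg_map i (p i q))) - n * (LINT x|sg_measure. \<phi> (sg_map i x))\<bar> \<le> n * \<delta>"
      unfolding n_def
    proof (rule Suc.IH)
      show "continuous_on sg (\<lambda>x. \<phi> (sg_map i x))" by (rule continuous_on_sg_comp[OF i Suc.prems(1)])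
      show "\<bar>\<phi> (sg_map i x) - \<phi> (sg_map i y)\<bar> \<le> \<delta>" if "x \<in> sg" "y \<in> sg" "dist x y \<le> 1 / 2 ^ N" for x y
        by (rule Suc.prems(2)) (use that sg_map_in_sg[OF i] in \<open>auto simp: dist_sg_map\<close>)
    qed (use p[OF i] in blast)
    moreover have "(\<Sum>q\<in>qfam N B. \<phi> (sg_map i (p i q))) = (\<Sum>q\<in>qfam N B. \<phi> (pt (emb i q)))"
      using p[OF i] by (intro sum.cong) auto
    ultimately show ?thesis by simp
  qed
  have c: "real (card (qfam (Suc N) B)) = 3 * n"
  proof -
    have "card (spread (qfam N B)) = 3 * card (qfam N B)" by (rule card_spread[OF on]) (rule props(3))
    then show ?thesis by (simp add: n_def)
  qed
  have s: "(\<Sum>q\<in>qfam (Suc N) B. \<phi> (pt q)) = (\<Sum>i\<in>idx. \<Sum>q\<in>qfam N B. \<phi> (pt (emb i q)))"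
    unfolding qfam.simps by (rule sum_spread[OF on]) (rule props(3))
  have "3 * n * (LINT x|sg_measure. \<phi> x) = (\<Sum>i\<in>idx. n * (LINT x|sg_measure. \<phi> (sg_map i x)))"
    unfolding integral_sg_self_similar[OF Suc.prems(1)] sum_distrib_left[symmetric] by simp
  then have "\<bar>(\<Sum>q\<in>qfam (Suc N) B. \<phi> (pt q)) - 3 * n * (LINT x|sg_measure. \<phi> x)\<bar>
      = \<bar>\<Sum>i\<in>idx. (\<Sum>q\<in>qfam N B. \<phi> (pt (emb i q))) - n * (LINT x|sg_measure. \<phi> (sg_map i x))\<bar>"
    unfolding s sum_subtractf by simp
  also have "\<dots> \<le> (\<Sum>i\<in>idx. \<bar>(\<Sum>q\<in>qfam N B. \<phi> (pt (emb i q))) - n * (LINT x|sg_measure. \<phi> (sg_map i x))\<bar>)"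
    by (rule sum_abs)
  also have "\<dots> \<le> (\<Sum>i\<in>idx. n * \<delta>)" by (rule sum_mono) (rule IH)
  finally show ?case unfolding c by simp
qed

end

section \<open>Comparison of spectral projections\<close>

lemma inner_sum_orthonormal:
  assumes "orthonormal B" "c \<in> B"
  shows "inner (\<Sum>b\<in>B. g b *\<^sub>R b) c = g c"
proof -
  have "inner (\<Sum>b\<in>B. g b *\<^sub>R b) c = (\<Sum>b\<in>B. if b = c then g b else 0)"
    unfolding inner_sum_left using assms by (intro sum.cong) (auto simp: orthonormal_def)
  then show ?thesis using assms by (simp add: orthonormal_def)
qed

lemma eigen_family_pos:
  "eigen_family T \<kappa> B \<Longrightarrow> \<kappa> > 0 \<Longrightarrow> b \<in> B \<Longrightarrow> inner (T b) b > 0"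
  unfolding eigen_family_def by force

text \<open>The form of \<open>S\<inverse>\<close> dominates that of \<open>T\<inverse>\<close> when \<open>S \<le> T\<close>; the test vector below
  is \<open>T\<inverse> q\<close> with the inverse truncated at \<open>1/\<kappa>\<close> off the span of \<open>B\<close>.\<close>

lemma energy_estimate:
  assumes sf: "spectral_family T \<kappa> B" and sT: "form_symmetric T" and sS: "form_symmetric S"
    and psd: "\<And>u. 0 \<le> inner (S u) u" and le: "\<And>u. inner (S u) u \<le> inner (T u) u"
    and \<kappa>: "\<kappa> > 0" and q: "S q = \<mu> *\<^sub>R q" "\<mu> > 0" "inner q q = 1"
  shows "1 / \<kappa> - 1 / \<mu> \<le> (\<Sum>b\<in>B. (1 / \<kappa> - 1 / inner (T b) b) * (inner q b)\<^sup>2)"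
proof -
  have ef: "eigen_family T \<kappa> B" using sf by (simp add: spectral_family_def)
  have on: "orthonormal B" using ef by (simp add: eigen_family_def)
  have lT: "linear T" using sT by (simp add: form_symmetric_def)
  define l where "l = (\<lambda>b. 1 / inner (T b) b)"
  define w where "w = q - proj_on B q"
  define p where "p = (\<Sum>b\<in>B. (l b * inner q b) *\<^sub>R b)"
  define h where "h = p + (1 / \<kappa>) *\<^sub>R w"
  have wb: "inner w b = 0" if "b \<in> B" for b unfolding w_def by (rule inner_diff_proj_on_basis[OF on that])
  have ww: "inner w w = 1 - (\<Sum>b\<in>B. (inner q b)\<^sup>2)"
    using inner_self_pythagoras[OF on, of q] q(3) by (simp add: w_def)
  have wq: "inner w q = inner w w"
    using inner_span_eq_0[OF wb proj_on_in_span[of B q]] by (simp add: w_def inner_diff_right)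
  have hb: "inner h b = l b * inner q b" if "b \<in> B" for b
    unfolding h_def inner_add_left p_def inner_sum_orthonormal[OF on that] by (simp add: wb[OF that])
  have "proj_on B h = p"
    unfolding proj_on_def p_def by (intro sum.cong refl) (simp add: hb)
  then have hw: "h - proj_on B h = (1 / \<kappa>) *\<^sub>R w" by (simp add: h_def)
  define X where "X = (\<Sum>b\<in>B. l b * (inner q b)\<^sup>2) + (1 / \<kappa>) * inner w w"
  have hq: "inner h q = X"
    unfolding h_def p_def X_def inner_add_left inner_sum_left
    using wq by (simp add: inner_commute[of _ q] power2_eq_square mult.assoc)
  have "inner (T h) h = (\<Sum>b\<in>B. inner (T b) b * (l b * inner q b)\<^sup>2) + (1 / \<kappa>)\<^sup>2 * inner (T w) w"
    unfolding form_split[OF ef sT, of h] hw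
    by (simp add: hb linear_scale[OF lT] power2_eq_square)
  also have "(\<Sum>b\<in>B. inner (T b) b * (l b * inner q b)\<^sup>2) = (\<Sum>b\<in>B. l b * (inner q b)\<^sup>2)"
  proof (rule sum.cong[OF refl])
    fix b assume "b \<in> B"
    from eigen_family_pos[OF ef \<kappa> this] show "inner (T b) b * (l b * inner q b)\<^sup>2 = l b * (inner q b)\<^sup>2"
      by (simp add: l_def power2_eq_square)
  qed
  also have "(1 / \<kappa>)\<^sup>2 * inner (T w) w \<le> (1 / \<kappa>)\<^sup>2 * (\<kappa> * inner w w)"
  proof (rule mult_left_mono)
    show "inner (T w) w \<le> \<kappa> * inner w w"
    proof (cases "w = 0")
      case True then show ?thesis by (simp add: linear_0[OF lT])
    next
      case False then show ?thesis using sf wb unfolding spectral_family_def by fastforce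
    qed
  qed simp
  also have "(1 / \<kappa>)\<^sup>2 * (\<kappa> * inner w w) = (1 / \<kappa>) * inner w w" using \<kappa> by (simp add: power2_eq_square)
  finally have Th: "inner (T h) h \<le> X" by (simp add: X_def)
  have "(inner (S q) h)\<^sup>2 \<le> inner (S q) q * inner (S h) h"
    by (rule form_cauchy_schwarz[OF sS subspace_UNIV psd]) auto
  also have "\<dots> = \<mu> * inner (S h) h" using q by simp
  also have "\<dots> \<le> \<mu> * X" using le[of h] Th q(2) by (intro mult_left_mono) auto
  also have "inner (S q) h = \<mu> * X" using hq q(1) by (simp add: inner_commute)
  finally have *: "(\<mu> * X) * (\<mu> * X) \<le> 1 * (\<mu> * X)" by (simp add: power2_eq_square)
  have "\<mu> * X \<le> 1"
  proof (cases "\<mu> * X > 0")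
    case True then show ?thesis using * by (subst (asm) mult_le_cancel_right) simp
  qed simp
  then have "X \<le> 1 / \<mu>" using q(2) by (simp add: field_simps)
  moreover have "X = 1 / \<kappa> - (\<Sum>b\<in>B. (1 / \<kappa> - 1 / inner (T b) b) * (inner q b)\<^sup>2)"
    unfolding X_def ww l_def by (simp add: left_diff_distrib sum_subtractf sum_distrib_left right_diff_distrib)
  ultimately show ?thesis by linarith
qed

lemma trace_deficit:
  assumes sf: "spectral_family T \<kappa> B" "spectral_family S \<kappa> Q"
    and sT: "form_symmetric T" and sS: "form_symmetric S"
    and psd: "\<And>u. 0 \<le> inner (S u) u" and le: "\<And>u. inner (S u) u \<le> inner (T u) u" and \<kappa>: "\<kappa> > 0"
  shows "(\<Sum>b\<in>B. (1 / \<kappa> - 1 / inner (T b) b) * (1 - (\<Sum>q\<in>Q. (inner q b)\<^sup>2)))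
    \<le> (\<Sum>b\<in>B. 1 / \<kappa> - 1 / inner (T b) b) - (\<Sum>q\<in>Q. 1 / \<kappa> - 1 / inner (S q) q)"
proof -
  have efQ: "eigen_family S \<kappa> Q" using sf by (simp add: spectral_family_def)
  have onQ: "orthonormal Q" using efQ by (simp add: eigen_family_def)
  have "(\<Sum>q\<in>Q. 1 / \<kappa> - 1 / inner (S q) q) \<le> (\<Sum>q\<in>Q. \<Sum>b\<in>B. (1 / \<kappa> - 1 / inner (T b) b) * (inner q b)\<^sup>2)"
  proof (rule sum_mono)
    fix q assume qQ: "q \<in> Q"
    then have "S q = inner (S q) q *\<^sub>R q" using efQ by (simp add: eigen_family_def)
    then show "1 / \<kappa> - 1 / inner (S q) q \<le> (\<Sum>b\<in>B. (1 / \<kappa> - 1 / inner (T b) b) * (inner q b)\<^sup>2)"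
      by (intro energy_estimate[OF sf(1) sT sS psd le \<kappa>] eigen_family_pos[OF efQ \<kappa> qQ] orthonormalD(2)[OF onQ qQ])
  qed
  also have "\<dots> = (\<Sum>b\<in>B. (1 / \<kappa> - 1 / inner (T b) b) * (\<Sum>q\<in>Q. (inner q b)\<^sup>2))"
    by (subst sum.swap) (simp only: sum_distrib_left)
  finally show ?thesis by (simp add: right_diff_distrib sum_subtractf)
qed

lemma sum_gap_le:
  fixes l :: "'a \<Rightarrow> real" and m :: "'b \<Rightarrow> real"
  assumes fin: "finite X" "finite Y" and l: "\<And>x. x \<in> X \<Longrightarrow> 0 < l x \<and> l x \<le> L"
    and m: "\<And>y. y \<in> Y \<Longrightarrow> 0 < m y \<and> m y \<le> L" and "L > 0" "c \<ge> 0"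
    and count: "\<And>t. 0 < t \<Longrightarrow> t \<le> L \<Longrightarrow> real (card {x\<in>X. l x \<le> t}) \<le> real (card {y\<in>Y. m y \<le> t}) + c"
  shows "(\<Sum>x\<in>X. L - l x) \<le> (\<Sum>y\<in>Y. L - m y) + c * L"
proof -
  have int: "integrable lborel (indicator {a..L} :: real \<Rightarrow> real)" for a
    by (rule integrable_real_indicator) (auto simp: emeasure_lborel_Icc_eq)
  have ind: "(LINT t|lborel. indicator {a..L} t) = L - a" if "a \<le> L" for a :: real
    using that by simp
  have cnt: "(\<Sum>x\<in>Z. indicator {k x..L} t) = (if t \<le> L then real (card {x\<in>Z. k x \<le> t}) else 0)"
    if "finite Z" for Z :: "'z set" and k :: "'z \<Rightarrow> real" and t
  proof -
    have "(\<Sum>x\<in>Z. indicator {k x..L} t :: real) = (\<Sum>x\<in>Z. if k x \<le> t \<and> t \<le> L then 1 else 0)"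
      by (intro sum.cong) (auto simp: indicator_def)
    also have "\<dots> = (if t \<le> L then real (card {x\<in>Z. k x \<le> t}) else 0)"
      using that by (simp add: sum.If_cases Int_def)
    finally show ?thesis .
  qed
  define iX where "iX = (\<lambda>t. \<Sum>x\<in>X. indicator {l x..L} t :: real)"
  define iY where "iY = (\<lambda>t. \<Sum>y\<in>Y. indicator {m y..L} t :: real)"
  define iL where "iL = (\<lambda>t. c * indicator {0..L} t :: real)"
  have intX: "integrable lborel iX" and intY: "integrable lborel iY"
    unfolding iX_def iY_def by (rule Bochner_Integration.integrable_sum, rule int)+
  have intL: "integrable lborel iL" unfolding iL_def by (rule integrable_mult_right, rule int)
  have "integral\<^sup>L lborel iX = (\<Sum>x\<in>X. L - l x)"
    unfolding iX_def by (subst Bochner_Integration.integral_sum[OF int]) (use l in \<open>auto intro!: sum.cong simp: ind\<close>)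
  moreover have "integral\<^sup>L lborel iY = (\<Sum>y\<in>Y. L - m y)"
    unfolding iY_def by (subst Bochner_Integration.integral_sum[OF int]) (use m in \<open>auto intro!: sum.cong simp: ind\<close>)
  moreover have "integral\<^sup>L lborel iL = c * L" unfolding iL_def using \<open>L > 0\<close> by simp
  moreover have "integral\<^sup>L lborel iX \<le> integral\<^sup>L lborel (\<lambda>t. iY t + iL t)"
  proof (rule integral_mono[OF intX])
    show "integrable lborel (\<lambda>t. iY t + iL t)"
      by (rule Bochner_Integration.integrable_add[OF intY intL])
    fix t :: real
    show "iX t \<le> iY t + iL t"
    proof (cases "0 < t \<and> t \<le> L")
      case True
      then show ?thesis unfolding iX_def iY_def cnt[OF fin(1)] cnt[OF fin(2)] iL_def using count[of t] by simp
    next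
      case False
      have "iX t = 0"
        unfolding iX_def by (rule sum.neutral) (use l False in \<open>force simp: indicator_def\<close>)
      moreover have "0 \<le> iY t" by (simp add: iY_def sum_nonneg)
      ultimately show ?thesis using \<open>c \<ge> 0\<close> by (simp add: iL_def indicator_def)
    qed
  qed
  moreover have "integral\<^sup>L lborel (\<lambda>t. iY t + iL t) = integral\<^sup>L lborel iY + integral\<^sup>L lborel iL"
    by (rule Bochner_Integration.integral_add[OF intY intL])
  ultimately show ?thesis by simp
qed

lemma kernel_orthonormal:
  assumes on: "orthonormal Z" and C: "finite C" "\<And>c. c \<in> C \<Longrightarrow> linear (c :: 'a::real_inner \<Rightarrow> real)"
  shows "\<exists>U. orthonormal U \<and> U \<subseteq> span Z \<and> (\<forall>u\<in>U. \<forall>c\<in>C. c u = 0) \<and> card Z \<le> card U + card C"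
proof -
  define P where "P = (\<lambda>U. orthonormal U \<and> U \<subseteq> span Z \<and> (\<forall>u\<in>U. \<forall>c\<in>C. c u = 0))"
  have bd: "card U \<le> card Z" if "P U" for U
    using independent_span_bound[OF orthonormalD(1)[OF on] orthonormal_independent] that unfolding P_def by blast
  have "P {}" by (simp add: P_def orthonormal_def)
  then have "\<exists>U. P U \<and> (\<forall>A. P A \<longrightarrow> card A \<le> card U)"
    using bd by (intro ex_has_greatest_nat[where b = "Suc (card Z)"]) (auto simp: less_Suc_eq_le)
  then obtain U where U: "P U" "\<And>A. P A \<Longrightarrow> card A \<le> card U" by blast
  have onU: "orthonormal U" using U(1) by (simp add: P_def)
  have "card Z \<le> card U + card C"
  proof (rule ccontr)
    assume neg: "\<not> ?thesis"
    let ?C = "(\<lambda>a u. inner u a) ` U \<union> C"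
    have "card ?C \<le> card U + card C"
      by (rule order_trans[OF card_Un_le]) (simp add: card_image_le orthonormalD(1)[OF onU])
    then have "card ?C < card Z" using neg by linarith
    moreover have "linear c" if "c \<in> ?C" for c using that C(2) linear_inner_right by blast
    moreover have "finite ?C" using C(1) orthonormalD(1)[OF onU] by simp
    ultimately have "\<exists>u\<in>span Z. u \<noteq> 0 \<and> (\<forall>c\<in>?C. c u = 0)"
      by (intro kernel_meets_span[OF orthonormal_independent[OF on]])
    then obtain u where u: "u \<in> span Z" "u \<noteq> 0" "\<forall>c\<in>?C. c u = 0" by blast
    define v where "v = (1 / norm u) *\<^sub>R u"
    have "norm v = 1" using u(2) by (simp add: v_def)
    then have vv: "inner v v = 1" by (simp add: norm_eq_1)
    have vU: "inner v b = 0" if "b \<in> U" for b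
    proof -
      have "(\<lambda>u. inner u b) \<in> ?C" using that by blast
      from bspec[OF u(3) this] show ?thesis by (simp add: v_def)
    qed
    have "c v = 0" if "c \<in> C" for c
      using u(3) that C(2) by (simp add: v_def linear_scale)
    moreover have "v \<in> span Z" unfolding v_def by (intro span_scale u)
    ultimately have "P (insert v U)"
      using U(1) orthonormal_insert(1)[OF onU vv vU] unfolding P_def by blast
    then have "card (insert v U) \<le> card U" by (rule U(2))
    then show False using orthonormal_insert(2)[OF onU vv vU] orthonormalD(1)[OF onU] by simp
  qed
  then show ?thesis using U(1) unfolding P_def by blast
qed

lemma multiplicity_deficit:
  assumes sf: "spectral_family T \<kappa> B" "spectral_family S \<kappa> Q"
    and sT: "form_symmetric T" and sS: "form_symmetric S"
    and C: "finite C" "\<And>c. c \<in> C \<Longrightarrow> linear (c :: 'a::real_inner \<Rightarrow> real)"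
      "\<And>u. (\<And>c. c \<in> C \<Longrightarrow> c u = 0) \<Longrightarrow> T u = S u"
  shows "(\<Sum>b\<in>{b\<in>B. inner (T b) b = \<mu>}. 1 - (\<Sum>q\<in>Q. (inner q b)\<^sup>2)) \<le> real (card C)"
proof (cases "\<mu> \<ge> \<kappa>")
  case False
  then have "{b\<in>B. inner (T b) b = \<mu>} = {}" using sf(1) by (auto simp: spectral_family_def eigen_family_def)
  then show ?thesis by (simp only: sum.empty of_nat_0_le_iff)
next
  case True
  let ?Z = "{b\<in>B. inner (T b) b = \<mu>}"
  have efB: "eigen_family T \<kappa> B" and efQ: "eigen_family S \<kappa> Q" using sf by (simp_all add: spectral_family_def)
  have onB: "orthonormal B" and onQ: "orthonormal Q" using efB efQ by (simp_all add: eigen_family_def)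
  have onZ: "orthonormal ?Z" by (rule orthonormal_subset[OF onB]) blast
  have lT: "linear T" using sT by (simp add: form_symmetric_def)
  obtain U where U: "orthonormal U" "U \<subseteq> span ?Z" "\<And>u c. u \<in> U \<Longrightarrow> c \<in> C \<Longrightarrow> c u = 0" "card ?Z \<le> card U + card C"
    using kernel_orthonormal[OF onZ C(1) C(2)] by blast
  have Tz: "T u = \<mu> *\<^sub>R u" if "u \<in> span ?Z" for u
    using that
  proof (induction rule: span_induct_alt)
    case base then show ?case by (simp add: linear_0[OF lT])
  next
    case (step c x y)
    have "T x = \<mu> *\<^sub>R x" using step(1) efB unfolding eigen_family_def by force
    then show ?case using step by (simp add: linear_add[OF lT] linear_scale[OF lT] algebra_simps)
  qed
  have UQ: "u \<in> span Q" if "u \<in> U" for u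
  proof (rule spectral_family_span[OF sf(2) sS _ True])
    show "S u = \<mu> *\<^sub>R u" using Tz[of u] C(3)[of u] U(2,3) that by auto
  qed
  have "(\<Sum>u\<in>U. (inner u b)\<^sup>2) \<le> (\<Sum>q\<in>Q. (inner q b)\<^sup>2)" for b
  proof -
    have "(\<Sum>u\<in>U. (inner u b)\<^sup>2) = (\<Sum>u\<in>U. (inner (proj_on Q b) u)\<^sup>2)"
    proof (rule sum.cong[OF refl])
      fix u assume "u \<in> U"
      have "inner (b - proj_on Q b) u = 0"
        by (rule inner_span_eq_0[OF inner_diff_proj_on_basis[OF onQ] UQ[OF \<open>u \<in> U\<close>]])
      then have "inner b u = inner (proj_on Q b) u" by (simp add: inner_diff_left)
      then show "(inner u b)\<^sup>2 = (inner (proj_on Q b) u)\<^sup>2" by (simp only: inner_commute[of u b])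
    qed
    also have "\<dots> \<le> inner (proj_on Q b) (proj_on Q b)" by (rule bessel[OF U(1)])
    also have "\<dots> = (\<Sum>q\<in>Q. (inner q b)\<^sup>2)"
      unfolding inner_proj_on_self[OF onQ] by (simp add: inner_commute)
    finally show ?thesis .
  qed
  then have "(\<Sum>b\<in>?Z. 1 - (\<Sum>q\<in>Q. (inner q b)\<^sup>2)) \<le> (\<Sum>b\<in>?Z. 1 - (\<Sum>u\<in>U. (inner u b)\<^sup>2))"
    by (intro sum_mono) simp
  also have "\<dots> = real (card ?Z) - (\<Sum>u\<in>U. \<Sum>b\<in>?Z. (inner u b)\<^sup>2)"
    by (subst sum.swap) (simp add: sum_subtractf)
  also have "(\<Sum>u\<in>U. \<Sum>b\<in>?Z. (inner u b)\<^sup>2) = (\<Sum>u\<in>U. 1)"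
  proof (rule sum.cong[OF refl])
    fix u assume "u \<in> U"
    then show "(\<Sum>b\<in>?Z. (inner u b)\<^sup>2) = 1"
      using parseval_span[OF onZ, of u] U(2) orthonormalD(2)[OF U(1)] by auto
  qed
  finally show ?thesis using U(4) by simp
qed

section \<open>Eigenvalue counting\<close>

definition spec_basis :: "real \<Rightarrow> sgfun set" where
  "spec_basis L = (SOME B. spectral_family green (1 / L) B)"

definition ecount :: "real \<Rightarrow> nat" where "ecount L = card (spec_basis L)"

definition lam :: "sgfun \<Rightarrow> real" where "lam b = 1 / inner (green b) b"

lemma spec_basis: "L > 0 \<Longrightarrow> spectral_family green (1 / L) (spec_basis L)"
  unfolding spec_basis_def
  using compact_psd.spectral_family_exists[OF compact_psd_green, of "1 / L"] by (metis someI zero_less_divide_1_iff)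

lemma spec_basis_props:
  assumes "L > 0"
  shows "eigen_family green (1 / L) (spec_basis L)" "orthonormal (spec_basis L)" "finite (spec_basis L)"
  using spec_basis[OF assms] by (simp_all add: spectral_family_def eigen_family_def orthonormal_def)

lemma spec_basis_lam:
  assumes "L > 0" "b \<in> spec_basis L"
  shows "0 < lam b" "lam b \<le> L" "0 < t \<Longrightarrow> lam b \<le> t \<longleftrightarrow> 1 / t \<le> inner (green b) b"
proof -
  have 1: "inner (green b) b > 0" using eigen_family_pos[OF spec_basis_props(1)[OF assms(1)]] assms by simp
  then show "0 < lam b" by (simp add: lam_def)
  show *: "lam b \<le> t \<longleftrightarrow> 1 / t \<le> inner (green b) b" if "0 < t" for t
    using 1 that by (simp add: lam_def field_simps)
  have "1 / L \<le> inner (green b) b" using spec_basis_props(1)[OF assms(1)] assms(2) by (simp add: eigen_family_def)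
  then show "lam b \<le> L" using * assms(1) by simp
qed

lemma spectral_family_card_unique:
  assumes "spectral_family T \<kappa> A" "spectral_family T \<kappa> B" "form_symmetric T"
  shows "card A = card B"
  using spectral_family_card_le[OF assms(1,2,3), of "{}"] spectral_family_card_le[OF assms(2,1,3), of "{}"] by simp

lemma card_spec_basis_le:
  assumes "0 < t" "t \<le> L"
  shows "card {b\<in>spec_basis L. lam b \<le> t} = ecount t"
proof -
  have L: "L > 0" using assms by simp
  have "{b\<in>spec_basis L. lam b \<le> t} = {b\<in>spec_basis L. inner (green b) b \<ge> 1 / t}"
    using spec_basis_lam(3)[OF L _ assms(1)] by blast
  moreover have "spectral_family green (1 / t) {b\<in>spec_basis L. inner (green b) b \<ge> 1 / t}"
    by (rule spectral_family_restrict[OF spec_basis[OF L] form_symmetric_green]) (use assms in \<open>simp add: frac_le\<close>)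
  ultimately show ?thesis
    unfolding ecount_def using spectral_family_card_unique[OF _ spec_basis[OF assms(1)] form_symmetric_green] by metis
qed

lemma ecount_mono: "0 < t \<Longrightarrow> t \<le> L \<Longrightarrow> ecount t \<le> ecount L"
  using card_mono[of "spec_basis L" "{b\<in>spec_basis L. lam b \<le> t}"] spec_basis_props(3)[of L] card_spec_basis_le[of t L]
  by (simp add: ecount_def)

lemma ecount_scaled_family:
  assumes "L > 0"
  shows "spectral_family (loc N) (1 / L) (qfam N (spec_basis (L / 5 ^ N)))"
    "card (qfam N (spec_basis (L / 5 ^ N))) = 3 ^ N * ecount (L / 5 ^ N)"
  using qfam_props(1,2)[OF spec_basis[of "L / 5 ^ N"], of N] assms by (simp_all add: ecount_def)

lemma ecount_bracket:
  assumes "L > 0"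
  shows "3 ^ N * ecount (L / 5 ^ N) \<le> ecount L" "2 * ecount L \<le> 2 * (3 ^ N * ecount (L / 5 ^ N)) + 3 * 3 ^ N"
proof -
  note Q = ecount_scaled_family[OF assms, of N]
  show "3 ^ N * ecount (L / 5 ^ N) \<le> ecount L"
    using spectral_family_card_le[OF Q(1) spec_basis[OF assms] form_symmetric_loc, of "{}"] loc_le_green
    by (simp add: Q(2) ecount_def)
  obtain C where C: "finite C" "2 * card C + 3 \<le> 3 * 3 ^ N" "\<And>c. c \<in> C \<Longrightarrow> linear (c :: sgfun \<Rightarrow> real)"
    "\<And>u. (\<And>c. c \<in> C \<Longrightarrow> c u = 0) \<Longrightarrow> green u = loc N u" using loc_finite_rank[of N] by blast
  have "ecount L \<le> card (qfam N (spec_basis (L / 5 ^ N))) + card C"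
    unfolding ecount_def
    by (rule spectral_family_card_le[OF spec_basis[OF assms] Q(1) form_symmetric_green C(1,3)]) (auto simp: C(4))
  then show "2 * ecount L \<le> 2 * (3 ^ N * ecount (L / 5 ^ N)) + 3 * 3 ^ N" using C(2) Q(2) by linarith
qed

lemma ecount_pos: "\<exists>L>0. ecount L \<ge> 1"
proof -
  have "green one_sg \<noteq> 0"
  proof
    assume g: "green one_sg = 0"
    define x where "x = sg_map 1 (corner 2)"
    have "x \<in> sg_vertices 1 - sg_vertices 0"
    proof -
      have "x \<noteq> corner j" if j: "j \<in> idx" for j
      proof
        assume "x = corner j"
        then have "bary 1 x = bary 1 (corner j)" by simp
        then show False using j by (auto simp: x_def bary_sg_map bary_corner)
      qed
      moreover have "x \<in> sg_vertices 1"
        unfolding x_def One_nat_def sg_vertices.simps(2) using corner_in_sg_vertices[of 2 0] by blast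
      ultimately show ?thesis unfolding sg_vertices_0 by blast
    qed
    from graph_laplacian_green_error[OF this, of one_sg 0]
    have "\<bar>3/2 * 5 ^ 1 * graph_laplacian 1 (val (green one_sg)) x + val one_sg x\<bar> \<le> 0" by (simp add: val_one_sg)
    moreover have "x \<in> sg" unfolding x_def by (intro sg_map_in_sg corner_in_sg) auto
    ultimately show False unfolding g linear_0[OF linear_graph_laplacian] by (simp add: val_one_sg)
  qed
  define u where "u = green one_sg"
  have "inner (green u) u \<noteq> 0"
  proof
    assume z: "inner (green u) u = 0"
    have "(inner (green u) one_sg)\<^sup>2 \<le> inner (green u) u * inner (green one_sg) one_sg"
      by (rule form_cauchy_schwarz[OF form_symmetric_green subspace_UNIV green_psd]) auto
    then have "inner (green u) one_sg = 0" using z by simp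
    then have "inner u (green one_sg) = 0" using form_symmetric_green by (simp add: form_symmetric_def)
    then show False using \<open>green one_sg \<noteq> 0\<close> by (simp add: u_def)
  qed
  then have pos: "inner (green u) u > 0" using green_psd[of u] by simp
  have u0: "u \<noteq> 0" using \<open>green one_sg \<noteq> 0\<close> by (simp add: u_def)
  define L where "L = inner u u / inner (green u) u"
  have L: "L > 0" unfolding L_def using pos u0 by simp
  have "spec_basis L \<noteq> {}"
  proof
    assume "spec_basis L = {}"
    then have "inner (green u) u < 1 / L * inner u u"
      using spec_basis[OF L] u0 by (simp add: spectral_family_def)
    also have "1 / L * inner u u = inner (green u) u" using pos u0 by (simp add: L_def)
    finally show False by simp
  qed
  then have "ecount L \<ge> 1" unfolding ecount_def using spec_basis_props(3)[OF L] by (simp add: Suc_le_eq card_gt_0_iff)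
  then show ?thesis using L by blast
qed

lemma ecount_at_top: "\<exists>L0>0. \<forall>L\<ge>L0. real (ecount L) \<ge> K"
proof -
  obtain L1 where L1: "L1 > 0" "ecount L1 \<ge> 1" using ecount_pos by blast
  obtain m where m: "K < 3 ^ m" using real_arch_pow[of 3 K] by auto
  have "K \<le> real (ecount L)" if "L \<ge> 5 ^ m * L1" for L
  proof -
    have L: "L > 0" using that L1(1) less_le_trans[of 0 "5 ^ m * L1" L] by simp
    have "ecount L1 \<le> ecount (L / 5 ^ m)" using that L1(1) by (intro ecount_mono) (simp_all add: field_simps)
    then have "3 ^ m * 1 \<le> 3 ^ m * ecount (L / 5 ^ m)" using L1(2) by (intro mult_left_mono) auto
    also have "\<dots> \<le> ecount L" by (rule ecount_bracket(1)[OF L])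
    finally have "(3 :: nat) ^ m \<le> ecount L" by simp
    then have "(3 :: real) ^ m \<le> real (ecount L)" by (metis of_nat_le_iff of_nat_numeral of_nat_power)
    then show ?thesis using m by linarith
  qed
  then show ?thesis using L1(1) by (intro exI[of _ "5 ^ m * L1"]) auto
qed

lemma power_five_bracket:
  assumes "(x :: real) \<ge> 1"
  shows "\<exists>m. 5 ^ m \<le> x \<and> x < 5 ^ Suc m"
proof -
  obtain n where n: "x < 5 ^ n" using real_arch_pow[of 5 x] by auto
  define k where "k = (LEAST n. x < 5 ^ n)"
  have k: "x < 5 ^ k" unfolding k_def by (rule LeastI[of _ n]) (rule n)
  then have "k \<noteq> 0" using assms by (intro notI) simp
  then obtain m where m: "k = Suc m" using not0_implies_Suc by blast
  have "\<not> x < 5 ^ m" using not_less_Least[of m "\<lambda>n. x < 5 ^ n"] m by (simp add: k_def)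
  then show ?thesis using k unfolding m by (intro exI[of _ m]) simp
qed

text \<open>Rescaling a window at a fixed scale, where the finitely many eigenvalues are separated,
  leaves only one eigenvalue of high multiplicity in the large-scale window.\<close>

lemma eigenvalue_window:
  assumes "\<eta> > 0"
  shows "\<exists>\<epsilon> L0. 0 < \<epsilon> \<and> \<epsilon> < 1 \<and> L0 > 0 \<and> (\<forall>L\<ge>L0. \<exists>l.
    real (card {b\<in>spec_basis L. (1 - \<epsilon>) * L < lam b \<and> lam b \<noteq> l}) \<le> \<eta> * real (ecount L))"
proof -
  obtain \<tau>0 where \<tau>0: "\<tau>0 > 0" "ecount \<tau>0 \<ge> 1" using ecount_pos by blast
  obtain p where "3 / \<eta> < 3 ^ p" using real_arch_pow[of 3 "3 / \<eta>"] by auto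
  then have p: "3 \<le> \<eta> * 3 ^ p" using assms by (simp add: field_simps)
  define T where "T = 5 ^ Suc p * \<tau>0"
  have T: "T > 0" using \<tau>0 by (simp add: T_def)
  define E where "E = lam ` spec_basis T"
  have E: "finite E" "\<And>a. a \<in> E \<Longrightarrow> a > 0"
    using spec_basis_props(3)[OF T] spec_basis_lam(1)[OF T] by (auto simp: E_def)
  define S where "S = insert (1/2) ((\<lambda>(a, b). 1 - a / b) ` {(a, b) \<in> E \<times> E. a < b})"
  have finS: "finite S" unfolding S_def
    using finite_subset[of "{(a, b) \<in> E \<times> E. a < b}" "E \<times> E"] E(1) by auto
  define \<epsilon> where "\<epsilon> = Min S"
  have "\<epsilon> \<in> S" unfolding \<epsilon>_def using finS by (intro Min_in) (auto simp: S_def)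
  then have \<epsilon>0: "\<epsilon> > 0" using E(2) by (auto simp: S_def)
  have "\<epsilon> \<le> 1/2" unfolding \<epsilon>_def using finS by (intro Min_le) (auto simp: S_def)
  then have \<epsilon>1: "\<epsilon> < 1" by simp
  have sep: "a \<le> (1 - \<epsilon>) * b" if "a \<in> E" "b \<in> E" "a < b" for a b
  proof -
    have "\<epsilon> \<le> 1 - a / b" unfolding \<epsilon>_def using finS that by (intro Min_le) (force simp: S_def)+
    then show ?thesis using E(2)[OF that(2)] by (simp add: field_simps)
  qed
  have cE: "ecount t = card {b\<in>spec_basis T. lam b \<le> t}" if "0 < t" "t \<le> T" for t
    using card_spec_basis_le[OF that] by simp
  have "\<exists>l. real (card {b\<in>spec_basis L. (1 - \<epsilon>) * L < lam b \<and> lam b \<noteq> l}) \<le> \<eta> * real (ecount L)"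
    if L0: "L \<ge> 5 ^ p * \<tau>0" for L
  proof -
    have "5 ^ p * \<tau>0 > 0" using \<tau>0(1) by simp
    then have L: "L > 0" and "L / (5 ^ p * \<tau>0) \<ge> 1" using L0 by (auto simp: field_simps)
    then obtain m where m: "5 ^ m \<le> L / (5 ^ p * \<tau>0)" "L / (5 ^ p * \<tau>0) < 5 ^ Suc m"
      using power_five_bracket by blast
    define \<tau> where "\<tau> = L / 5 ^ m"
    have \<tau>: "\<tau> > 0" "L = 5 ^ m * \<tau>" using L by (simp_all add: \<tau>_def)
    have \<tau>p: "5 ^ p * \<tau>0 \<le> \<tau>" "\<tau> < T"
      using m \<open>5 ^ p * \<tau>0 > 0\<close> by (simp_all add: \<tau>_def T_def field_simps)
    define \<rho> where "\<rho> = (1 - \<epsilon>) * \<tau>"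
    have \<rho>: "0 < \<rho>" "\<rho> < \<tau>" "(1 - \<epsilon>) * L = 5 ^ m * \<rho>"
      using \<epsilon>0 \<epsilon>1 \<tau> by (simp_all add: \<rho>_def)
    have low: "3 ^ m * real (ecount t) \<le> real (ecount (5 ^ m * t))"
      and up: "2 * real (ecount (5 ^ m * t)) \<le> 2 * 3 ^ m * real (ecount t) + 3 * 3 ^ m" if "t > 0" for t
    proof -
      have t: "5 ^ m * t > 0" "5 ^ m * t / 5 ^ m = t" using that by simp_all
      have "real (3 ^ m * ecount t) \<le> real (ecount (5 ^ m * t))"
        using ecount_bracket(1)[OF t(1), of m] unfolding t(2) of_nat_le_iff .
      then show "3 ^ m * real (ecount t) \<le> real (ecount (5 ^ m * t))" by simp
      have "real (2 * ecount (5 ^ m * t)) \<le> real (2 * (3 ^ m * ecount t) + 3 * 3 ^ m)"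
        using ecount_bracket(2)[OF t(1), of m] unfolding t(2) of_nat_le_iff .
      then show "2 * real (ecount (5 ^ m * t)) \<le> 2 * 3 ^ m * real (ecount t) + 3 * 3 ^ m" by simp
    qed
    have big: "3 * 3 ^ m \<le> \<eta> * real (ecount L)"
    proof -
      have "ecount \<tau>0 \<le> ecount (\<tau> / 5 ^ p)" using \<tau>p(1) \<tau>0(1) by (intro ecount_mono) (simp_all add: field_simps)
      then have "3 ^ p * 1 \<le> 3 ^ p * ecount (\<tau> / 5 ^ p)" using \<tau>0(2) by (intro mult_left_mono) auto
      also have "\<dots> \<le> ecount \<tau>" by (rule ecount_bracket(1)[OF \<tau>(1)])
      finally have "real (3 ^ p) \<le> real (ecount \<tau>)" unfolding of_nat_le_iff by simp
      then have "(3 :: real) ^ p \<le> real (ecount \<tau>)" by simp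
      then have "3 ^ m * (3 :: real) ^ p \<le> 3 ^ m * real (ecount \<tau>)" by simp
      also have "\<dots> \<le> real (ecount L)" using low[OF \<tau>(1)] \<tau>(2) by simp
      finally have "\<eta> * (3 ^ m * 3 ^ p) \<le> \<eta> * real (ecount L)" using assms by simp
      moreover have "3 ^ m * 3 \<le> 3 ^ m * (\<eta> * 3 ^ p)" by (rule mult_left_mono[OF p]) simp
      moreover have "3 ^ m * (\<eta> * 3 ^ p) = \<eta> * (3 ^ m * 3 ^ p)" by (rule mult.left_commute)
      ultimately show ?thesis by (simp only: mult.commute[of 3])
    qed
    define B where "B = spec_basis L"
    have finB: "finite B" unfolding B_def by (rule spec_basis_props(3)[OF L])
    have cB: "real (card {b\<in>B. 5 ^ m * s < lam b \<and> lam b \<le> 5 ^ m * t}) = real (ecount (5 ^ m * t)) - real (ecount (5 ^ m * s))"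
      if "0 < s" "s \<le> t" "t \<le> \<tau>" for s t
    proof -
      have st: "5 ^ m * s > 0" "5 ^ m * t > 0" "5 ^ m * s \<le> 5 ^ m * t" "5 ^ m * t \<le> L" "5 ^ m * s \<le> L"
        using that \<tau> by auto
      have "{b\<in>B. 5 ^ m * s < lam b \<and> lam b \<le> 5 ^ m * t} = {b\<in>B. lam b \<le> 5 ^ m * t} - {b\<in>B. lam b \<le> 5 ^ m * s}"
        by auto
      moreover have "{b\<in>B. lam b \<le> 5 ^ m * s} \<subseteq> {b\<in>B. lam b \<le> 5 ^ m * t}" using order_trans[OF _ st(3)] by blast
      ultimately have "real (card {b\<in>B. 5 ^ m * s < lam b \<and> lam b \<le> 5 ^ m * t})
          = real (card {b\<in>B. lam b \<le> 5 ^ m * t}) - real (card {b\<in>B. lam b \<le> 5 ^ m * s})"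
        using finB by (simp add: card_Diff_subset card_mono of_nat_diff)
      then show ?thesis
        unfolding B_def card_spec_basis_le[OF st(1,5)] card_spec_basis_le[OF st(2,4)] .
    qed
    define W where "W = {b\<in>B. (1 - \<epsilon>) * L < lam b}"
    have finW: "finite W" using finB by (simp add: W_def)
    have "W = {b\<in>B. 5 ^ m * \<rho> < lam b \<and> lam b \<le> 5 ^ m * \<tau>}"
      using spec_basis_lam(2)[OF L] unfolding W_def \<rho>(3) \<tau>(2)[symmetric] B_def by auto
    then have cW: "real (card W) = real (ecount L) - real (ecount (5 ^ m * \<rho>))"
      using cB[OF \<rho>(1) less_imp_le[OF \<rho>(2)] order_refl] \<tau>(2) by simp
    have W2: "2 * real (card W) \<le> 2 * 3 ^ m * (real (ecount \<tau>) - real (ecount \<rho>)) + 3 * 3 ^ m"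
      unfolding cW using low[OF \<rho>(1)] up[OF \<tau>(1)] \<tau>(2) by (simp add: right_diff_distrib)
    show ?thesis
    proof (cases "\<exists>a\<in>E. \<rho> < a \<and> a \<le> \<tau>")
      case False
      then have "{b\<in>spec_basis T. lam b \<le> \<tau>} = {b\<in>spec_basis T. lam b \<le> \<rho>}"
        using \<rho>(2) unfolding E_def by fastforce
      then have "ecount \<tau> = ecount \<rho>" using cE[of \<tau>] cE[of \<rho>] \<tau> \<tau>p \<rho> by simp
      then have "2 * real (card W) \<le> 3 * 3 ^ m" using W2 by simp
      moreover have "card {b\<in>spec_basis L. (1 - \<epsilon>) * L < lam b \<and> lam b \<noteq> 0} \<le> card W"
        using finW unfolding W_def B_def by (intro card_mono) auto
      ultimately show ?thesis using big by (intro exI[of _ 0]) linarith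
    next
      case True
      then obtain a where a: "a \<in> E" "\<rho> < a" "a \<le> \<tau>" by blast
      have uniq: "a' = a" if "a' \<in> E" "\<rho> < a'" "a' \<le> \<tau>" for a'
      proof (rule ccontr)
        assume "a' \<noteq> a"
        then consider "a' < a" | "a < a'" by linarith
        then show False
        proof cases
          case 1
          have "a' \<le> (1 - \<epsilon>) * a" by (rule sep[OF that(1) a(1) 1])
          also have "\<dots> \<le> \<rho>" unfolding \<rho>_def using a(3) \<epsilon>1 by (intro mult_left_mono) auto
          finally show False using that(2) by simp
        next
          case 2
          have "a \<le> (1 - \<epsilon>) * a'" by (rule sep[OF a(1) that(1) 2])
          also have "\<dots> \<le> \<rho>" unfolding \<rho>_def using that(3) \<epsilon>1 by (intro mult_left_mono) auto
          finally show False using a(2) by simp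
        qed
      qed
      define Z where "Z = insert \<rho> {x \<in> (\<lambda>b. lam b / 5 ^ m) ` B. x < a}"
      define s where "s = Max (insert \<rho> Z)"
      have finZ: "finite (insert \<rho> Z)" unfolding Z_def using finB by simp
      have "s \<in> insert \<rho> Z" unfolding s_def using finZ by (intro Max_in) auto
      then have sa: "s < a" using a(2) by (auto simp: Z_def)
      have s\<rho>: "\<rho> \<le> s" unfolding s_def using finZ by (intro Max_ge) auto
      have s0: "0 < s" using s\<rho> \<rho>(1) by simp
      define l where "l = 5 ^ m * a"
      define M where "M = {b\<in>B. lam b = l}"
      have "{b\<in>B. 5 ^ m * s < lam b \<and> lam b \<le> 5 ^ m * a} \<subseteq> M"
      proof
        fix b assume b: "b \<in> {b\<in>B. 5 ^ m * s < lam b \<and> lam b \<le> 5 ^ m * a}"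
        have "\<not> lam b / 5 ^ m < a"
        proof
          assume "lam b / 5 ^ m < a"
          then have "lam b / 5 ^ m \<in> insert \<rho> Z" using b by (auto simp: Z_def)
          then have "lam b / 5 ^ m \<le> s" unfolding s_def using finZ by (intro Max_ge) auto
          then show False using b by (simp add: field_simps)
        qed
        then have "l \<le> lam b" by (simp add: l_def field_simps)
        then show "b \<in> M" using b by (simp add: M_def l_def)
      qed
      then have "card {b\<in>B. 5 ^ m * s < lam b \<and> lam b \<le> 5 ^ m * a} \<le> card M"
        using finB by (intro card_mono) (simp_all add: M_def)
      then have "real (ecount (5 ^ m * a)) - real (ecount (5 ^ m * s)) \<le> real (card M)"
        using cB[OF s0 less_imp_le[OF sa] a(3)] by linarith
      moreover have "a > 0" using a(2) \<rho>(1) by simp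
      ultimately have M2: "2 * 3 ^ m * (real (ecount a) - real (ecount s)) - 3 * 3 ^ m \<le> 2 * real (card M)"
        using low[of a] up[OF s0] by (simp add: right_diff_distrib)
      have "{b\<in>spec_basis T. lam b \<le> \<tau>} = {b\<in>spec_basis T. lam b \<le> a}"
      proof -
        have "lam b \<le> a" if "b \<in> spec_basis T" "lam b \<le> \<tau>" for b
          using uniq[of "lam b"] that a(2) by (cases "lam b \<le> \<rho>") (auto simp: E_def)
        then show ?thesis using a(3) by auto
      qed
      then have ea: "ecount \<tau> = ecount a" using cE[of \<tau>] cE[of a] \<tau> \<tau>p a \<open>a > 0\<close> by simp
      have "{b\<in>spec_basis T. lam b \<le> s} = {b\<in>spec_basis T. lam b \<le> \<rho>}"
      proof -
        have "lam b \<le> \<rho>" if "b \<in> spec_basis T" "lam b \<le> s" for b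
        proof (rule ccontr)
          assume "\<not> lam b \<le> \<rho>"
          then have "lam b = a" using uniq[of "lam b"] that sa a(3) by (auto simp: E_def)
          then show False using that(2) sa by simp
        qed
        then show ?thesis using s\<rho> by auto
      qed
      then have es: "ecount \<rho> = ecount s" using cE[of \<rho>] cE[of s] \<tau>p \<rho> s0 sa a(3) by simp
      have "M \<subseteq> W"
      proof -
        have "(1 - \<epsilon>) * L < l" unfolding \<rho>(3) l_def using a(2) by simp
        then show ?thesis by (auto simp: M_def W_def)
      qed
      then have "real (card (W - M)) = real (card W) - real (card M)"
        using finW by (simp add: card_Diff_subset finite_subset card_mono of_nat_diff)
      moreover have "W - M = {b\<in>spec_basis L. (1 - \<epsilon>) * L < lam b \<and> lam b \<noteq> l}"
        by (auto simp: W_def M_def B_def)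
      ultimately have "2 * real (card {b\<in>spec_basis L. (1 - \<epsilon>) * L < lam b \<and> lam b \<noteq> l}) \<le> 2 * (3 * 3 ^ m)"
        using W2 M2 unfolding ea es by simp
      then show ?thesis using big by (intro exI[of _ l]) linarith
    qed
  qed
  then show ?thesis using \<epsilon>0 \<epsilon>1 \<tau>0(1) by (intro exI[of _ \<epsilon>] exI[of _ "5 ^ p * \<tau>0"]) auto
qed

lemma energy_deficit:
  assumes L: "L > 0" and Q: "spectral_family (loc N) (1 / L) Q"
    and C: "finite C" "\<And>c. c \<in> C \<Longrightarrow> linear (c :: sgfun \<Rightarrow> real)"
      "\<And>u. (\<And>c. c \<in> C \<Longrightarrow> c u = 0) \<Longrightarrow> green u = loc N u"
  shows "(\<Sum>b\<in>spec_basis L. (L - lam b) * (1 - (\<Sum>q\<in>Q. (inner q b)\<^sup>2))) \<le> real (card C) * L"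
proof -
  have L': "1 / L > 0" using L by simp
  have efQ: "eigen_family (loc N) (1 / L) Q" using Q by (simp add: spectral_family_def)
  have qpos: "inner (loc N q) q > 0" if "q \<in> Q" for q by (rule eigen_family_pos[OF efQ L' that])
  have qt: "1 / inner (loc N q) q \<le> t \<longleftrightarrow> 1 / t \<le> inner (loc N q) q" if "q \<in> Q" "t > 0" for q t
    using qpos[OF that(1)] that(2) by (simp add: field_simps)
  have gap: "(\<Sum>b\<in>spec_basis L. L - lam b) \<le> (\<Sum>q\<in>Q. L - 1 / inner (loc N q) q) + real (card C) * L"
  proof (rule sum_gap_le)
    show "finite (spec_basis L)" by (rule spec_basis_props(3)[OF L])
    show "finite Q" using efQ by (simp add: eigen_family_def orthonormal_def)
    show "0 < lam b \<and> lam b \<le> L" if "b \<in> spec_basis L" for b using spec_basis_lam[OF L that] by blast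
    show "0 < 1 / inner (loc N q) q \<and> 1 / inner (loc N q) q \<le> L" if "q \<in> Q" for q
      using qpos[OF that] qt[OF that L] efQ that by (simp add: eigen_family_def)
    fix t assume t: "0 < t" "t \<le> L"
    have "{q\<in>Q. 1 / inner (loc N q) q \<le> t} = {q\<in>Q. inner (loc N q) q \<ge> 1 / t}" using qt t(1) by blast
    moreover have "1 / L \<le> 1 / t" using t by (simp add: frac_le)
    ultimately have "spectral_family (loc N) (1 / t) {q\<in>Q. 1 / inner (loc N q) q \<le> t}"
      using spectral_family_restrict[OF Q form_symmetric_loc] by simp
    then have "card (spec_basis t) \<le> card {q\<in>Q. 1 / inner (loc N q) q \<le> t} + card C"
      by (intro spectral_family_card_le[OF spec_basis[OF t(1)] _ form_symmetric_green C(1,2)]) (auto simp: C(3))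
    then have "ecount t \<le> card {q\<in>Q. 1 / inner (loc N q) q \<le> t} + card C" by (simp add: ecount_def)
    then show "real (card {b\<in>spec_basis L. lam b \<le> t}) \<le> real (card {q\<in>Q. 1 / inner (loc N q) q \<le> t}) + real (card C)"
      unfolding card_spec_basis_le[OF t] by linarith
  qed (use L in auto)
  have "(\<Sum>b\<in>spec_basis L. (L - lam b) * (1 - (\<Sum>q\<in>Q. (inner q b)\<^sup>2)))
      \<le> (\<Sum>b\<in>spec_basis L. L - lam b) - (\<Sum>q\<in>Q. L - 1 / inner (loc N q) q)"
    using trace_deficit[OF spec_basis[OF L] Q form_symmetric_green form_symmetric_loc loc_psd loc_le_green L']
    by (simp add: lam_def)
  with gap show ?thesis by linarith
qed

lemma projection_deficit:
  assumes "\<eta> > 0"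
  shows "\<exists>L0>0. \<forall>L\<ge>L0. \<forall>Q. spectral_family (loc N) (1 / L) Q \<longrightarrow>
    (\<Sum>b\<in>spec_basis L. 1 - (\<Sum>q\<in>Q. (inner q b)\<^sup>2)) \<le> \<eta> * real (ecount L)"
proof -
  obtain C where C0: "finite C" "2 * card C + 3 \<le> 3 * 3 ^ N" "\<And>c. c \<in> C \<Longrightarrow> linear (c :: sgfun \<Rightarrow> real)"
    "\<And>u. (\<And>c. c \<in> C \<Longrightarrow> c u = 0) \<Longrightarrow> green u = loc N u" using loc_finite_rank[of N] by blast
  note C = C0(1,3,4)
  define c where "c = real (card C)"
  obtain \<epsilon> L1 where \<epsilon>: "0 < \<epsilon>" "\<epsilon> < 1" "L1 > 0" "\<And>L. L \<ge> L1 \<Longrightarrow> \<exists>l.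
      real (card {b\<in>spec_basis L. (1 - \<epsilon>) * L < lam b \<and> lam b \<noteq> l}) \<le> \<eta> / 2 * real (ecount L)"
    using eigenvalue_window[OF half_gt_zero[OF assms]] by blast
  obtain L2 where L2: "L2 > 0" "\<And>L. L \<ge> L2 \<Longrightarrow> (c / \<epsilon> + c) * 2 / \<eta> \<le> real (ecount L)"
    using ecount_at_top[of "(c / \<epsilon> + c) * 2 / \<eta>"] by blast
  have "(\<Sum>b\<in>spec_basis L. 1 - (\<Sum>q\<in>Q. (inner q b)\<^sup>2)) \<le> \<eta> * real (ecount L)"
    if "L \<ge> max L1 L2" and Q: "spectral_family (loc N) (1 / L) Q" for L Q
  proof -
    have L: "L > 0" "L \<ge> L1" "L \<ge> L2" using that(1) \<epsilon>(3) by auto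
    define B where "B = spec_basis L"
    have onB: "orthonormal B" and finB: "finite B" unfolding B_def using spec_basis_props[OF L(1)] by blast+
    have onQ: "orthonormal Q" using Q by (simp add: spectral_family_def eigen_family_def)
    define d where "d = (\<lambda>b. 1 - (\<Sum>q\<in>Q. (inner q b)\<^sup>2))"
    have d: "0 \<le> d b" "d b \<le> 1" if "b \<in> B" for b
    proof -
      have "(\<Sum>q\<in>Q. (inner b q)\<^sup>2) \<le> inner b b" by (rule bessel[OF onQ])
      then show "0 \<le> d b" unfolding d_def orthonormalD(2)[OF onB that] by (simp add: inner_commute)
      show "d b \<le> 1" unfolding d_def by (simp add: sum_nonneg)
    qed
    obtain l where l: "real (card {b\<in>B. (1 - \<epsilon>) * L < lam b \<and> lam b \<noteq> l}) \<le> \<eta> / 2 * real (ecount L)"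
      using \<epsilon>(4)[OF L(2)] unfolding B_def by blast
    define A1 where "A1 = {b\<in>B. lam b \<le> (1 - \<epsilon>) * L}"
    define A2 where "A2 = {b\<in>B. lam b = l}"
    define A3 where "A3 = {b\<in>B. (1 - \<epsilon>) * L < lam b \<and> lam b \<noteq> l}"
    have fin: "finite A1" "finite A2" "finite A3" using finB by (simp_all add: A1_def A2_def A3_def)
    have un: "sum d (X \<union> Y) \<le> sum d X + sum d Y" if "finite X" "finite Y" "X \<subseteq> B" for X Y
    proof -
      have "0 \<le> sum d (X \<inter> Y)" using d(1) that(3) by (intro sum_nonneg) blast
      then show ?thesis using sum.union_inter[OF that(1,2), of d] by linarith
    qed
    have sub: "A1 \<subseteq> B" "A2 \<subseteq> B" by (auto simp: A1_def A2_def)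
    have "sum d B \<le> sum d (A1 \<union> (A2 \<union> A3))"
      using fin d by (intro sum_mono2) (auto simp: A1_def A2_def A3_def)
    also have "\<dots> \<le> sum d A1 + sum d (A2 \<union> A3)"
      by (rule un) (use fin sub in auto)
    also have "sum d (A2 \<union> A3) \<le> sum d A2 + sum d A3"
      by (rule un) (use fin sub in auto)
    finally have tot: "sum d B \<le> sum d A1 + (sum d A2 + sum d A3)" by simp
    have "\<epsilon> * L * sum d A1 \<le> (\<Sum>b\<in>A1. (L - lam b) * d b)"
      unfolding sum_distrib_left
    proof (rule sum_mono)
      fix b assume b: "b \<in> A1"
      then have "\<epsilon> * L \<le> L - lam b" by (simp add: A1_def algebra_simps)
      then show "\<epsilon> * L * d b \<le> (L - lam b) * d b" using d(1)[of b] b by (intro mult_right_mono) (auto simp: A1_def)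
    qed
    also have "\<dots> \<le> (\<Sum>b\<in>B. (L - lam b) * d b)"
      using finB d spec_basis_lam(2)[OF L(1)] by (intro sum_mono2) (auto simp: A1_def B_def)
    also have "\<dots> \<le> c * L" unfolding d_def B_def c_def by (rule energy_deficit[OF L(1) Q C])
    finally have "L * (\<epsilon> * sum d A1) \<le> L * c" by (simp add: mult_ac)
    then have "\<epsilon> * sum d A1 \<le> c" using L(1) by simp
    then have s1: "sum d A1 \<le> c / \<epsilon>" using \<epsilon>(1) by (simp add: field_simps)
    have s2: "sum d A2 \<le> c"
    proof -
      have "A2 = {b\<in>B. inner (green b) b = 1 / l}"
        unfolding A2_def
      proof (intro Collect_cong conj_cong refl)
        fix b assume "b \<in> B"
        then have "lam b > 0" using spec_basis_lam(1)[OF L(1)] by (simp add: B_def)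
        then show "lam b = l \<longleftrightarrow> inner (green b) b = 1 / l" by (auto simp: lam_def)
      qed
      then show ?thesis
        unfolding d_def c_def B_def
        using multiplicity_deficit[OF spec_basis[OF L(1)] Q form_symmetric_green form_symmetric_loc C] by simp
    qed
    have "sum d A3 \<le> real (card A3) * 1"
      using d by (intro sum_bounded_above) (auto simp: A3_def)
    then have s3: "sum d A3 \<le> \<eta> / 2 * real (ecount L)" using l by (simp add: A3_def)
    have "c / \<epsilon> + c \<le> \<eta> / 2 * real (ecount L)" using L2(2)[OF L(3)] assms by (simp add: field_simps)
    moreover have "\<eta> / 2 * real (ecount L) + \<eta> / 2 * real (ecount L) = \<eta> * real (ecount L)" by simp
    ultimately have "sum d B \<le> \<eta> * real (ecount L)" using tot s1 s2 s3 by linarith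
    then show ?thesis by (simp add: d_def B_def)
  qed
  then show ?thesis using L2(1) by (intro exI[of _ "max L1 L2"]) auto
qed

section \<open>The Szego limit theorem\<close>

lemma linear_val: "linear val"
  by (rule linearI) (simp_all add: fun_eq_iff val_simps scaleR_fun_def)

lemma inj_val: "inj val"
  by (rule injI) (simp add: val_inject)

lemma dirichlet_space_eq:
  assumes "L > 0"
  shows "dirichlet_space L = val ` span (spec_basis L)"
proof -
  let ?E = "{v. \<exists>l\<le>L. v \<noteq> 0 \<and> v = l *\<^sub>R green v}"
  have "{u. \<exists>l\<le>L. dirichlet_eigenfunction l u} = val ` ?E"
    unfolding dirichlet_eigenfunction_iff by blast
  then have "dirichlet_space L = val ` span ?E"
    unfolding dirichlet_space_def by (simp add: linear_span_image[OF linear_val])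
  moreover have "span ?E = span (spec_basis L)"
    unfolding span_eq
  proof
    show "?E \<subseteq> span (spec_basis L)"
    proof
      fix v assume "v \<in> ?E"
      then obtain l where l: "l \<le> L" "v \<noteq> 0" "v = l *\<^sub>R green v" by blast
      have "inner v v = l * inner (green v) v" by (subst l(3)) simp
      then have "l * inner (green v) v > 0" using l(2) by (metis inner_gt_zero_iff)
      then have l0: "l > 0" using green_psd[of v] by (simp add: zero_less_mult_iff)
      have "green v = (1 / l) *\<^sub>R v" using l0 by (subst (2) l(3)) simp
      then show "v \<in> span (spec_basis L)"
        by (rule spectral_family_span[OF spec_basis[OF assms] form_symmetric_green])
           (use l0 l(1) in \<open>simp add: frac_le\<close>)
    qed
    show "spec_basis L \<subseteq> span ?E"
    proof
      fix b assume b: "b \<in> spec_basis L"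
      have pos: "inner (green b) b > 0" using spec_basis_lam(1)[OF assms b] by (simp add: lam_def)
      have "green b = inner (green b) b *\<^sub>R b" using spec_basis_props(1)[OF assms] b by (simp add: eigen_family_def)
      then have "lam b *\<^sub>R green b = b" using pos by (metis lam_def scaleR_scaleR nonzero_eq_divide_eq less_irrefl scaleR_one)
      moreover have "b \<noteq> 0" by (rule orthonormal_nonzero[OF spec_basis_props(2)[OF assms] b])
      ultimately have "b \<in> ?E" using spec_basis_lam(2)[OF assms b] by auto
      then show "b \<in> span ?E" by (rule span_base)
    qed
  qed
  ultimately show ?thesis by simp
qed

lemma dim_val_image:
  assumes "orthonormal A"
  shows "dim (val ` span A) = card A"
proof -
  have "independent (val ` A)"
    using linear_independent_injective_image[OF linear_val orthonormal_independent[OF assms] inj_on_subset[OF inj_val]] by blast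
  then have "dim (span (val ` A)) = card (val ` A)" by (rule dim_span_eq_card_independent)
  also have "span (val ` A) = val ` span A" by (rule linear_span_image[OF linear_val])
  also have "card (val ` A) = card A" by (rule card_image[OF inj_on_subset[OF inj_val]]) simp
  finally show ?thesis .
qed

lemma dim_dirichlet_space: "L > 0 \<Longrightarrow> dim (dirichlet_space L) = ecount L"
  by (simp add: dirichlet_space_eq dim_val_image spec_basis_props(2) ecount_def)

lemma LINT_val: "(LINT x|sg_measure. (val u x - val h x) * val v x) = inner (u - h) v"
  by (simp add: inner_sgfun_def val_simps)

lemma dirichlet_proj_val:
  assumes "L > 0"
  shows "dirichlet_proj L (val u) = val (proj_on (spec_basis L) u)"
  unfolding dirichlet_proj_def orth_proj_def dirichlet_space_eq[OF assms]
proof (rule the_equality)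
  let ?B = "spec_basis L"
  have on: "orthonormal ?B" by (rule spec_basis_props(2)[OF assms])
  show "val (proj_on ?B u) \<in> val ` span ?B \<and>
    (\<forall>v\<in>val ` span ?B. (LINT x|sg_measure. (val u x - val (proj_on ?B u) x) * v x) = 0)"
    using proj_on_in_span inner_span_eq_0[OF inner_diff_proj_on_basis[OF on]] by (auto simp: LINT_val)
  fix h assume h: "h \<in> val ` span ?B \<and> (\<forall>v\<in>val ` span ?B. (LINT x|sg_measure. (val u x - h x) * v x) = 0)"
  then obtain w where w: "w \<in> span ?B" "h = val w" by blast
  have "inner (u - w) v = 0" if "v \<in> span ?B" for v
    using h that unfolding w(2) by (auto simp: LINT_val)
  then have "inner u b = inner w b" if "b \<in> ?B" for b
    using span_base[OF that] by (simp add: inner_diff_left)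
  then have "proj_on ?B u = proj_on ?B w" unfolding proj_on_def by (intro sum.cong) auto
  then show "h = val (proj_on ?B u)" unfolding w(2) proj_on_eq_if_span[OF on w(1)] by simp
qed

context
  fixes f :: "real ^ 2 \<Rightarrow> real"
  assumes f_cont: "continuous_on sg f" and f_pos: "\<And>x. x \<in> sg \<Longrightarrow> f x > 0"
begin

definition mulf :: "sgfun \<Rightarrow> sgfun" where "mulf u = mk (\<lambda>x. f x * val u x)"

lemma val_mulf: "val (mulf u) = (\<lambda>x. f x * val u x)"
proof -
  have "continuous_on sg (\<lambda>x. f x * val u x)" by (intro continuous_intros f_cont)
  then show ?thesis by (auto simp: mulf_def val_mk val_outside)
qed

lemma linear_mulf: "linear mulf"
  by (rule linearI; rule sgfun_eqI) (simp_all add: val_mulf val_simps algebra_simps)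

lemma mulf_symmetric: "inner (mulf u) v = inner u (mulf v)"
  by (simp add: inner_sgfun_def val_mulf mult_ac)

lemma f_bounds:
  obtains m0 K where "0 < m0" "0 < K" "\<And>x. x \<in> sg \<Longrightarrow> m0 \<le> f x \<and> f x \<le> K"
    "\<exists>x\<in>sg. f x = m0" "\<exists>x\<in>sg. f x = K"
proof -
  obtain a where a: "a \<in> sg" "\<And>x. x \<in> sg \<Longrightarrow> f a \<le> f x"
    using continuous_attains_inf[OF compact_sg sg_nonempty f_cont] by blast
  obtain b where b: "b \<in> sg" "\<And>x. x \<in> sg \<Longrightarrow> f x \<le> f b"
    using continuous_attains_sup[OF compact_sg sg_nonempty f_cont] by blast
  show thesis by (rule that[of "f a" "f b"]) (use a b f_pos in auto)
qed

lemma inner_mulf_lower: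
  assumes "\<And>x. x \<in> sg \<Longrightarrow> m0 \<le> f x"
  shows "m0 * inner u u \<le> inner (mulf u) u"
proof -
  have "0 \<le> (LINT x|sg_measure. (f x - m0) * (val u x * val u x))"
    using assms by (intro integral_nonneg_AE AE_I2) simp
  also have "\<dots> = inner (mulf u - m0 *\<^sub>R u) u"
    unfolding inner_sgfun_def by (rule Bochner_Integration.integral_cong) (simp_all add: val_simps val_mulf algebra_simps)
  finally show ?thesis by (simp add: inner_diff_left)
qed

lemma inner_mulf_upper:
  assumes "\<And>x. x \<in> sg \<Longrightarrow> f x \<le> K"
  shows "inner (mulf u) u \<le> K * inner u u"
proof -
  have "0 \<le> (LINT x|sg_measure. (K - f x) * (val u x * val u x))"
    using assms by (intro integral_nonneg_AE AE_I2) simp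
  also have "\<dots> = inner (K *\<^sub>R u - mulf u) u"
    unfolding inner_sgfun_def by (rule Bochner_Integration.integral_cong) (simp_all add: val_simps val_mulf algebra_simps)
  finally show ?thesis by (simp add: inner_diff_left)
qed

lemma inner_mulf_shift_le:
  assumes "\<And>x. x \<in> sg \<Longrightarrow> val u x \<noteq> 0 \<Longrightarrow> \<bar>f x - c\<bar> \<le> \<delta>" "\<delta> \<ge> 0"
  shows "inner (mulf u - c *\<^sub>R u) (mulf u - c *\<^sub>R u) \<le> \<delta>\<^sup>2 * inner u u"
proof -
  have "inner (mulf u - c *\<^sub>R u) (mulf u - c *\<^sub>R u) \<le> (LINT x|sg_measure. \<delta>\<^sup>2 * (val u x * val u x))"
    unfolding inner_sgfun_def
  proof (rule integral_mono)
    show "integrable sg_measure (\<lambda>x. \<delta>\<^sup>2 * (val u x * val u x))"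
      by (intro integrable_sg continuous_intros)
    show "integrable sg_measure (\<lambda>x. val (mulf u - c *\<^sub>R u) x * val (mulf u - c *\<^sub>R u) x)"
      by (intro integrable_sg continuous_intros)
    fix x assume "x \<in> space sg_measure"
    then have x: "x \<in> sg" by simp
    have "val (mulf u - c *\<^sub>R u) x * val (mulf u - c *\<^sub>R u) x = (f x - c)\<^sup>2 * (val u x * val u x)"
      by (simp add: val_simps val_mulf power2_eq_square algebra_simps)
    also have "\<dots> \<le> \<delta>\<^sup>2 * (val u x * val u x)"
    proof (cases "val u x = 0")
      case False
      then have "(f x - c)\<^sup>2 \<le> \<delta>\<^sup>2" using assms x by (simp add: abs_le_square_iff[symmetric])
      then show ?thesis by (intro mult_right_mono) auto
    qed simp
    finally show "val (mulf u - c *\<^sub>R u) x * val (mulf u - c *\<^sub>R u) x \<le> \<delta>\<^sup>2 * (val u x * val u x)" .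
  qed
  then show ?thesis by (simp add: inner_sgfun_def)
qed

lemma inner_mulf_mulf_le:
  assumes "\<And>x. x \<in> sg \<Longrightarrow> f x \<le> K"
  shows "inner (mulf u) (mulf u) \<le> K\<^sup>2 * inner u u"
proof -
  have "0 \<le> K" using assms[OF corner_in_sg[of 1]] f_pos[OF corner_in_sg[of 1]] by simp
  then show ?thesis
    using inner_mulf_shift_le[of u 0 K] assms f_pos by (simp add: less_imp_le)
qed

definition toeplitz :: "sgfun set \<Rightarrow> sgfun \<Rightarrow> sgfun" where
  "toeplitz B u = proj_on B (mulf (proj_on B u))"

lemma compressed_mult_val: "L > 0 \<Longrightarrow> compressed_mult f L (val u) = val (toeplitz (spec_basis L) u)"
  unfolding compressed_mult_def toeplitz_def by (simp only: dirichlet_proj_val val_mulf[symmetric])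

lemma inner_toeplitz:
  assumes "orthonormal B"
  shows "inner (toeplitz B u) v = inner (mulf (proj_on B u)) (proj_on B v)"
  unfolding toeplitz_def inner_proj_on
  by (simp add: proj_on_def[of B v] inner_sum_right mult.commute)

lemma compact_psd_toeplitz:
  assumes on: "orthonormal B"
  shows "compact_psd (toeplitz B)"
proof
  have lin: "linear (toeplitz B)"
    unfolding toeplitz_def[abs_def]
    using linear_compose[OF linear_compose[OF linear_proj_on linear_mulf] linear_proj_on] by (simp add: o_def)
  then show "form_symmetric (toeplitz B)"
    unfolding form_symmetric_def
    by (auto simp: inner_toeplitz[OF on] mulf_symmetric inner_commute[of _ "toeplitz B _"])
       (metis inner_commute mulf_symmetric)
  obtain K where K: "0 < K" "\<And>x. x \<in> sg \<Longrightarrow> f x \<le> K" using f_bounds by metis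
  show "0 \<le> inner (toeplitz B u) u" for u
    unfolding inner_toeplitz[OF on] using inner_mulf_lower[of 0 "proj_on B u"] f_pos by (simp add: less_imp_le)
  have T: "toeplitz B u = (\<Sum>b\<in>B. inner (toeplitz B u) b *\<^sub>R b)" for u
  proof -
    have "toeplitz B u = proj_on B (toeplitz B u)"
      unfolding toeplitz_def by (rule proj_on_eq_if_span[OF on proj_on_in_span, symmetric])
    then show ?thesis by (simp only: proj_on_def[symmetric])
  qed
  have bl: "bounded_linear (toeplitz B)"
  proof (rule bounded_linear_intro[where K = K])
    fix u
    have "inner (toeplitz B u) (toeplitz B u) \<le> inner (mulf (proj_on B u)) (mulf (proj_on B u))"
      unfolding toeplitz_def inner_proj_on_self[OF on] by (rule bessel[OF on])
    also have "\<dots> \<le> K\<^sup>2 * inner (proj_on B u) (proj_on B u)" by (rule inner_mulf_mulf_le[OF K(2)])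
    also have "\<dots> \<le> K\<^sup>2 * inner u u"
      unfolding inner_proj_on_self[OF on] by (intro mult_left_mono bessel[OF on]) simp
    finally have "(norm (toeplitz B u))\<^sup>2 \<le> (norm u * K)\<^sup>2"
      by (simp only: dot_square_norm power_mult_distrib mult.commute)
    then show "norm (toeplitz B u) \<le> norm u * K" by (rule power2_le_imp_le) (use K(1) in simp)
  qed (use lin in \<open>simp_all add: linear_add linear_scale\<close>)
  have blb: "bounded_linear (\<lambda>u. inner (toeplitz B u) b)" for b
    by (rule bounded_linear_inner_left_comp[OF bl])
  show "\<exists>C. finite C \<and> (\<forall>c\<in>C. bounded_linear c) \<and>
      (\<forall>u. norm (toeplitz B u) \<le> e * norm u + (\<Sum>c\<in>C. \<bar>c u :: real\<bar>))" if "e > 0" for e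
  proof -
    define n where "n = real (card B) + 1"
    define C where "C = (\<lambda>b u. n * inner (toeplitz B u) b) ` B"
    have finC: "finite C" using orthonormalD(1)[OF on] by (simp add: C_def)
    have "norm (toeplitz B u) \<le> e * norm u + (\<Sum>c\<in>C. \<bar>c u\<bar>)" for u
    proof -
      let ?S = "\<Sum>c\<in>C. \<bar>c u\<bar>"
      have "norm (toeplitz B u) \<le> (\<Sum>b\<in>B. norm (inner (toeplitz B u) b *\<^sub>R b))"
        by (subst T) (rule norm_sum)
      also have "\<dots> \<le> (\<Sum>b\<in>B. ?S / n)"
      proof (rule sum_mono)
        fix b assume b: "b \<in> B"
        have nb: "norm b = 1" using orthonormalD(2)[OF on b] by (simp add: norm_eq_1)
        have "\<bar>n * inner (toeplitz B u) b\<bar> \<le> ?S"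
          using finC b by (intro member_le_sum[of "\<lambda>u. n * inner (toeplitz B u) b" C "\<lambda>c. \<bar>c u\<bar>"]) (auto simp: C_def)
        then have "n * \<bar>inner (toeplitz B u) b\<bar> \<le> ?S" by (simp add: abs_mult n_def)
        then show "norm (inner (toeplitz B u) b *\<^sub>R b) \<le> ?S / n" by (simp add: nb n_def field_simps)
      qed
      also have "\<dots> = real (card B) / n * ?S" by simp
      also have "\<dots> \<le> 1 * ?S" by (intro mult_right_mono) (simp_all add: n_def sum_nonneg)
      finally show ?thesis using that by (simp add: add_increasing)
    qed
    moreover have "bounded_linear c" if "c \<in> C" for c
      using that bounded_linear_const_mult[OF blb] by (auto simp: C_def)
    ultimately show ?thesis using finC by blast
  qed
  show "convergent (\<lambda>n. toeplitz B (u n))" if u: "Cauchy u" for u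
  proof -
    have "convergent (\<lambda>n. inner (toeplitz B (u n)) b)" for b
      using bounded_linear.Cauchy[OF blb u] by (simp add: Cauchy_convergent_iff)
    then have "\<forall>b. \<exists>l. (\<lambda>n. inner (toeplitz B (u n)) b) \<longlonglongrightarrow> l" by (simp add: convergent_def)
    then obtain l where "\<And>b. (\<lambda>n. inner (toeplitz B (u n)) b) \<longlonglongrightarrow> l b" by metis
    then have "(\<lambda>n. \<Sum>b\<in>B. inner (toeplitz B (u n)) b *\<^sub>R b) \<longlonglongrightarrow> (\<Sum>b\<in>B. l b *\<^sub>R b)"
      by (intro tendsto_intros)
    then show ?thesis using T by (auto simp: convergent_def)
  qed
qed

lemma toeplitz_eigenbasis:
  assumes on: "orthonormal B" and m0: "0 < m0" "\<And>x. x \<in> sg \<Longrightarrow> m0 \<le> f x"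
  shows "\<exists>A. orthonormal A \<and> span A = span B \<and> card A = card B \<and>
    (\<forall>a\<in>A. toeplitz B a = inner (mulf a) a *\<^sub>R a \<and> inner (toeplitz B a) a = inner (mulf a) a)"
proof -
  interpret compact_psd "toeplitz B" by (rule compact_psd_toeplitz[OF on])
  obtain A where A: "spectral_family (toeplitz B) (m0 / 2) A" using spectral_family_exists[of "m0 / 2"] m0 by auto
  have ef: "eigen_family (toeplitz B) (m0 / 2) A" using A by (simp add: spectral_family_def)
  have onA: "orthonormal A" using ef by (simp add: eigen_family_def)
  have pos: "inner (toeplitz B a) a > 0" if "a \<in> A" for a using eigen_family_pos[OF ef _ that] m0(1) by simp
  have sub: "A \<subseteq> span B"
  proof
    fix a assume a: "a \<in> A"
    have "toeplitz B a = inner (toeplitz B a) a *\<^sub>R a" using ef a by (simp add: eigen_family_def)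
    then have "(1 / inner (toeplitz B a) a) *\<^sub>R toeplitz B a = a"
      using pos[OF a] by (metis divide_self_if less_irrefl scaleR_one scaleR_scaleR times_divide_eq_left mult_1)
    moreover have "(1 / inner (toeplitz B a) a) *\<^sub>R toeplitz B a \<in> span B"
      unfolding toeplitz_def by (intro span_scale proj_on_in_span)
    ultimately show "a \<in> span B" by simp
  qed
  have span: "span B \<subseteq> span A"
  proof
    fix u assume u: "u \<in> span B"
    define w where "w = u - proj_on A u"
    have wB: "w \<in> span B" unfolding w_def
      by (intro span_diff u subsetD[OF span_minimal[OF sub subspace_span] proj_on_in_span])
    have "w = 0"
    proof (rule ccontr)
      assume "w \<noteq> 0"
      moreover have "\<forall>a\<in>A. inner w a = 0" unfolding w_def by (simp add: inner_diff_proj_on_basis[OF onA])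
      ultimately have "inner (toeplitz B w) w < m0 / 2 * inner w w" using A by (simp add: spectral_family_def)
      moreover have "m0 * inner w w \<le> inner (toeplitz B w) w"
        unfolding inner_toeplitz[OF on] proj_on_eq_if_span[OF on wB] by (rule inner_mulf_lower[OF m0(2)])
      moreover have "m0 / 2 * inner w w \<le> m0 * inner w w" using m0(1) by (intro mult_right_mono) auto
      ultimately show False by linarith
    qed
    then show "u \<in> span A" using proj_on_in_span[of A u] by (simp add: w_def)
  qed
  have eq: "span A = span B" using span span_minimal[OF sub subspace_span] by blast
  have "card A = card B"
    using independent_span_bound[OF orthonormalD(1)[OF on] orthonormal_independent[OF onA] sub]
      independent_span_bound[OF orthonormalD(1)[OF onA] orthonormal_independent[OF on]] span span_superset[of B] by force
  moreover have "inner (toeplitz B a) a = inner (mulf a) a" if "a \<in> A" for a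
    using sub that unfolding inner_toeplitz[OF on] by (simp add: proj_on_eq_if_span[OF on] subsetD)
  ultimately show ?thesis using onA eq ef unfolding eigen_family_def by metis
qed

lemma sum_eigenvalues:
  fixes s :: "nat \<Rightarrow> real"
  assumes L: "L > 0" and ev: "eigenvalues_with_multiplicity (compressed_mult f L) (dirichlet_space L) s"
    and A: "orthonormal A" "span A = span (spec_basis L)" "card A = card (spec_basis L)"
      "\<And>a. a \<in> A \<Longrightarrow> toeplitz (spec_basis L) a = inner (mulf a) a *\<^sub>R a"
  shows "(\<Sum>k=1..ecount L. G (s k)) = (\<Sum>a\<in>A. G (inner (mulf a) a) :: real)"
    "k \<in> {1..ecount L} \<Longrightarrow> \<exists>a\<in>A. s k = inner (mulf a) a"
proof -
  let ?T = "toeplitz (spec_basis L)"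
  have finA: "finite A" by (rule orthonormalD(1)[OF A(1)])
  have linT: "linear ?T" and symT: "form_symmetric ?T"
    using compact_psd.symmetric[OF compact_psd_toeplitz[OF spec_basis_props(2)[OF L]]] by (simp_all add: form_symmetric_def)
  have eig: "{u \<in> span A. ?T u = c *\<^sub>R u} = span {a\<in>A. inner (mulf a) a = c}" for c
  proof
    show "{u \<in> span A. ?T u = c *\<^sub>R u} \<subseteq> span {a\<in>A. inner (mulf a) a = c}"
    proof
      fix u assume "u \<in> {u \<in> span A. ?T u = c *\<^sub>R u}"
      then have u: "u \<in> span A" "?T u = c *\<^sub>R u" by auto
      have z: "inner u a *\<^sub>R a \<in> span {a\<in>A. inner (mulf a) a = c}" if a: "a \<in> A" for a
      proof (cases "inner (mulf a) a = c")
        case True then show ?thesis using a by (intro span_scale span_base) simp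
      next
        case False
        have "c * inner u a = inner (?T u) a" by (simp add: u(2))
        also have "\<dots> = inner u (?T a)" using symT by (simp add: form_symmetric_def)
        also have "\<dots> = inner (mulf a) a * inner u a" by (simp add: A(4)[OF a])
        finally have "inner u a = 0" using False by simp
        then show ?thesis by (simp add: span_0)
      qed
      have "u = (\<Sum>a\<in>A. inner u a *\<^sub>R a)"
        using proj_on_eq_if_span[OF A(1) u(1)] by (simp add: proj_on_def)
      also have "\<dots> \<in> span {a\<in>A. inner (mulf a) a = c}" by (rule span_sum) (rule z)
      finally show "u \<in> span {a\<in>A. inner (mulf a) a = c}" .
    qed
    show "span {a\<in>A. inner (mulf a) a = c} \<subseteq> {u \<in> span A. ?T u = c *\<^sub>R u}"
    proof (rule span_minimal)
      show "{a\<in>A. inner (mulf a) a = c} \<subseteq> {u \<in> span A. ?T u = c *\<^sub>R u}" using A(4) by (auto intro: span_base)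
      show "subspace {u \<in> span A. ?T u = c *\<^sub>R u}"
        unfolding subspace_def
        by (auto simp: linear_0[OF linT] linear_add[OF linT] linear_scale[OF linT] algebra_simps
            intro: span_0 span_add span_scale)
    qed
  qed
  have count: "card {k\<in>{1..ecount L}. s k = c} = card {a\<in>A. inner (mulf a) a = c}" for c
  proof -
    have "{u \<in> dirichlet_space L. compressed_mult f L u = c *\<^sub>R u} = val ` {u \<in> span A. ?T u = c *\<^sub>R u}"
    proof -
      have "compressed_mult f L (val u) = c *\<^sub>R val u \<longleftrightarrow> ?T u = c *\<^sub>R u" for u
        unfolding compressed_mult_val[OF L] linear_scale[OF linear_val, symmetric] val_inject ..
      then show ?thesis unfolding dirichlet_space_eq[OF L] A(2)[symmetric] by auto
    qed
    then have "dim {u \<in> dirichlet_space L. compressed_mult f L u = c *\<^sub>R u} = card {a\<in>A. inner (mulf a) a = c}"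
      unfolding eig using dim_val_image[OF orthonormal_subset[OF A(1)], of "{a\<in>A. inner (mulf a) a = c}"] by simp
    then show ?thesis
      using ev unfolding eigenvalues_with_multiplicity_def dim_dirichlet_space[OF L] by simp
  qed
  have "image_mset s (mset_set {1..ecount L}) = image_mset (\<lambda>a. inner (mulf a) a) (mset_set A)"
  proof (rule multiset_eqI)
    fix c
    have "count (image_mset s (mset_set {1..ecount L})) c = card {k\<in>{1..ecount L}. s k = c}"
      by (simp add: count_image_mset_eq_card_vimage vimage_def Int_def conj_commute)
    moreover have "count (image_mset (\<lambda>a. inner (mulf a) a) (mset_set A)) c = card {a\<in>A. inner (mulf a) a = c}"
      using finA by (simp add: count_image_mset_eq_card_vimage vimage_def Int_def conj_commute)
    ultimately show "count (image_mset s (mset_set {1..ecount L})) c =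
        count (image_mset (\<lambda>a. inner (mulf a) a) (mset_set A)) c" using count by simp
  qed
  then have "sum_mset (image_mset G (image_mset s (mset_set {1..ecount L})))
      = sum_mset (image_mset G (image_mset (\<lambda>a. inner (mulf a) a) (mset_set A)))" by simp
  then show "(\<Sum>k=1..ecount L. G (s k)) = (\<Sum>a\<in>A. G (inner (mulf a) a) :: real)"
    by (simp add: image_mset.compositionality o_def sum_unfold_sum_mset)
  show "\<exists>a\<in>A. s k = inner (mulf a) a" if "k \<in> {1..ecount L}"
  proof (rule ccontr)
    assume "\<not> ?thesis"
    then have "{a\<in>A. inner (mulf a) a = s k} = {}" by auto
    then have "card {j\<in>{1..ecount L}. s j = s k} = 0" using count[of "s k"] by (simp only: card.empty)
    moreover have "finite {j\<in>{1..ecount L}. s j = s k}" by simp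
    ultimately have "{j\<in>{1..ecount L}. s j = s k} = {}" by (simp only: card_0_eq)
    then show False using that by blast
  qed
qed

end

lemma proj_on_eq_if_span_eq:
  assumes "orthonormal A" "orthonormal B" "span A = span B"
  shows "proj_on A u = proj_on B u"
proof -
  have "inner u b = inner (proj_on A u) b" if "b \<in> B" for b
  proof -
    have "b \<in> span A" using assms(3) span_base[OF that] by simp
    from inner_span_eq_0[OF inner_diff_proj_on_basis[OF assms(1)] this, of u] show ?thesis
      by (simp add: inner_diff_left)
  qed
  then have "proj_on B u = proj_on B (proj_on A u)"
    unfolding proj_on_def[of B] by (intro sum.cong) auto
  also have "\<dots> = proj_on A u"
    using proj_on_in_span[of A u] assms(3) by (intro proj_on_eq_if_span[OF assms(2)]) simp
  finally show ?thesis ..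
qed

text \<open>The weights \<open>\<langle>q, a\<rangle>\<^sup>2\<close> are nearly doubly stochastic, and concentrate where the
  eigenvalue at \<open>a\<close> is close to the value of \<open>f\<close> on the support of \<open>q\<close>.\<close>

lemma weighted_comparison:
  fixes w :: "'a \<Rightarrow> 'b \<Rightarrow> real"
  assumes fin: "finite A" "finite Q" and w0: "\<And>a q. 0 \<le> w a q"
    and row: "\<And>a. a \<in> A \<Longrightarrow> (\<Sum>q\<in>Q. w a q) \<le> 1" and col: "\<And>q. q \<in> Q \<Longrightarrow> (\<Sum>a\<in>A. w a q) \<le> 1"
    and \<theta>: "real (card A) - (\<Sum>a\<in>A. \<Sum>q\<in>Q. w a q) \<le> \<theta>" and card: "card Q \<le> card A"
    and var: "(\<Sum>a\<in>A. \<Sum>q\<in>Q. (x a - y q)\<^sup>2 * w a q) \<le> V"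
    and F: "\<And>a q. a \<in> A \<Longrightarrow> q \<in> Q \<Longrightarrow> \<bar>F (x a) - F (y q)\<bar> \<le> e + M * (x a - y q)\<^sup>2"
    and S: "\<And>a. a \<in> A \<Longrightarrow> \<bar>F (x a)\<bar> \<le> S" "\<And>q. q \<in> Q \<Longrightarrow> \<bar>F (y q)\<bar> \<le> S"
    and nonneg: "0 \<le> e" "0 \<le> M" "0 \<le> S"
  shows "\<bar>(\<Sum>a\<in>A. F (x a)) - (\<Sum>q\<in>Q. F (y q) :: real)\<bar> \<le> e * real (card A) + M * V + 2 * S * \<theta>"
proof -
  let ?W = "\<Sum>a\<in>A. \<Sum>q\<in>Q. w a q"
  have W: "?W \<le> real (card A)" using sum_bounded_above[of A, OF row] by simp
  have W': "?W = (\<Sum>q\<in>Q. \<Sum>a\<in>A. w a q)" by (rule sum.swap)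
  define D1 where "D1 = (\<Sum>a\<in>A. \<Sum>q\<in>Q. w a q * (F (x a) - F (y q)))"
  define D2 where "D2 = (\<Sum>a\<in>A. (1 - (\<Sum>q\<in>Q. w a q)) * F (x a))"
  define D3 where "D3 = (\<Sum>q\<in>Q. (1 - (\<Sum>a\<in>A. w a q)) * F (y q))"
  have s: "(\<Sum>a\<in>A. \<Sum>q\<in>Q. w a q * F (y q)) = (\<Sum>q\<in>Q. \<Sum>a\<in>A. w a q * F (y q))" by (rule sum.swap)
  have dec: "(\<Sum>a\<in>A. F (x a)) - (\<Sum>q\<in>Q. F (y q)) = D1 + D2 - D3"
    unfolding D1_def D2_def D3_def
    by (simp add: right_diff_distrib left_diff_distrib sum_subtractf s sum_distrib_right)
  have "\<bar>D1\<bar> \<le> (\<Sum>a\<in>A. \<Sum>q\<in>Q. w a q * (e + M * (x a - y q)\<^sup>2))"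
    unfolding D1_def
  proof (intro order_trans[OF sum_abs] sum_mono)
    fix a q assume "a \<in> A" "q \<in> Q"
    then show "\<bar>w a q * (F (x a) - F (y q))\<bar> \<le> w a q * (e + M * (x a - y q)\<^sup>2)"
      unfolding abs_mult abs_of_nonneg[OF w0] by (intro mult_left_mono F w0)
  qed
  also have "\<dots> = e * ?W + M * (\<Sum>a\<in>A. \<Sum>q\<in>Q. (x a - y q)\<^sup>2 * w a q)"
    by (simp add: distrib_left sum.distrib sum_distrib_left mult_ac)
  also have "\<dots> \<le> e * real (card A) + M * V"
    using W var nonneg by (intro add_mono mult_left_mono) auto
  finally have d1: "\<bar>D1\<bar> \<le> e * real (card A) + M * V" .
  have "\<bar>D2\<bar> \<le> (\<Sum>a\<in>A. (1 - (\<Sum>q\<in>Q. w a q)) * S)"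
    unfolding D2_def
  proof (intro order_trans[OF sum_abs] sum_mono)
    fix a assume a: "a \<in> A"
    have "\<bar>1 - (\<Sum>q\<in>Q. w a q)\<bar> = 1 - (\<Sum>q\<in>Q. w a q)" using row[OF a] by simp
    then show "\<bar>(1 - (\<Sum>q\<in>Q. w a q)) * F (x a)\<bar> \<le> (1 - (\<Sum>q\<in>Q. w a q)) * S"
      unfolding abs_mult using S(1)[OF a] row[OF a] by (simp add: mult_left_mono)
  qed
  also have "\<dots> = (real (card A) - ?W) * S" by (simp add: sum_distrib_right[symmetric] sum_subtractf)
  also have "\<dots> \<le> \<theta> * S" using \<theta> nonneg by (intro mult_right_mono)
  finally have d2: "\<bar>D2\<bar> \<le> \<theta> * S" .
  have "\<bar>D3\<bar> \<le> (\<Sum>q\<in>Q. (1 - (\<Sum>a\<in>A. w a q)) * S)"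
    unfolding D3_def
  proof (intro order_trans[OF sum_abs] sum_mono)
    fix q assume q: "q \<in> Q"
    have "\<bar>1 - (\<Sum>a\<in>A. w a q)\<bar> = 1 - (\<Sum>a\<in>A. w a q)" using col[OF q] by simp
    then show "\<bar>(1 - (\<Sum>a\<in>A. w a q)) * F (y q)\<bar> \<le> (1 - (\<Sum>a\<in>A. w a q)) * S"
      unfolding abs_mult using S(2)[OF q] col[OF q] by (simp add: mult_left_mono)
  qed
  also have "\<dots> = (real (card Q) - ?W) * S" unfolding W' by (simp add: sum_distrib_right[symmetric] sum_subtractf)
  also have "\<dots> \<le> \<theta> * S" using \<theta> card nonneg by (intro mult_right_mono) linarith+
  finally have d3: "\<bar>D3\<bar> \<le> \<theta> * S" .
  have "2 * S * \<theta> = \<theta> * S + \<theta> * S" by simp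
  then show ?thesis unfolding dec using d1 d2 d3 by linarith
qed

lemma uniform_modulus:
  fixes F :: "real \<Rightarrow> real"
  assumes "continuous_on {0..K} F" "e > 0"
  shows "\<exists>M S. 0 \<le> M \<and> 0 \<le> S \<and> (\<forall>x\<in>{0..K}. \<bar>F x\<bar> \<le> S) \<and>
    (\<forall>x\<in>{0..K}. \<forall>y\<in>{0..K}. \<bar>F x - F y\<bar> \<le> e + M * (x - y)\<^sup>2)"
proof -
  have "bounded (F ` {0..K})" by (intro compact_imp_bounded compact_continuous_image assms) simp
  then obtain S0 where "\<forall>x\<in>{0..K}. \<bar>F x\<bar> \<le> S0" by (auto simp: bounded_iff)
  then have S: "\<forall>x\<in>{0..K}. \<bar>F x\<bar> \<le> max S0 0" by (auto intro: max.coboundedI1)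
  define S where "S = max S0 0"
  have "uniformly_continuous_on {0..K} F" by (rule compact_uniformly_continuous[OF assms(1)]) simp
  then obtain r where r: "r > 0" "\<And>x y. x \<in> {0..K} \<Longrightarrow> y \<in> {0..K} \<Longrightarrow> dist y x < r \<Longrightarrow> dist (F y) (F x) < e"
    unfolding uniformly_continuous_on_def using assms(2) by blast
  define M where "M = 2 * S / r\<^sup>2"
  have "\<bar>F x - F y\<bar> \<le> e + M * (x - y)\<^sup>2" if "x \<in> {0..K}" "y \<in> {0..K}" for x y
  proof (cases "\<bar>x - y\<bar> < r")
    case True
    then have "\<bar>F x - F y\<bar> < e" using r(2)[OF that(2,1)] by (simp add: dist_real_def)
    moreover have "0 \<le> M * (x - y)\<^sup>2" by (simp add: M_def S_def)
    ultimately show ?thesis by linarith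
  next
    case False
    then have "r\<^sup>2 \<le> (x - y)\<^sup>2" using r(1) by (simp add: abs_le_square_iff[symmetric])
    then have "2 * S * 1 \<le> 2 * S * ((x - y)\<^sup>2 / r\<^sup>2)" using r(1) by (intro mult_left_mono) (auto simp: S_def)
    then have "2 * S \<le> M * (x - y)\<^sup>2" by (simp add: M_def)
    moreover have "\<bar>F x\<bar> \<le> S" "\<bar>F y\<bar> \<le> S" using S that by (auto simp: S_def)
    ultimately show ?thesis using assms(2) by linarith
  qed
  moreover have "0 \<le> M" "0 \<le> S" by (simp_all add: M_def S_def)
  ultimately show ?thesis using S unfolding S_def[symmetric] by blast
qed

lemma toeplitz_variance:
  assumes f: "continuous_on sg f" "\<And>x. x \<in> sg \<Longrightarrow> f x > 0" "\<And>x. x \<in> sg \<Longrightarrow> f x \<le> K"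
    and onB: "orthonormal B" and onA: "orthonormal A" and span: "span A = span B" and onQ: "orthonormal Q"
    and A: "\<And>a. a \<in> A \<Longrightarrow> toeplitz f B a = inner (mulf f a) a *\<^sub>R a"
    and c: "\<And>q x. q \<in> Q \<Longrightarrow> x \<in> sg \<Longrightarrow> val q x \<noteq> 0 \<Longrightarrow> \<bar>f x - c q\<bar> \<le> \<delta>" and "\<delta> \<ge> 0"
  shows "(\<Sum>a\<in>A. \<Sum>q\<in>Q. (inner (mulf f a) a - c q)\<^sup>2 * (inner q a)\<^sup>2)
    \<le> 2 * K\<^sup>2 * (real (card Q) - (\<Sum>q\<in>Q. \<Sum>b\<in>B. (inner q b)\<^sup>2)) + 2 * \<delta>\<^sup>2 * real (card Q)"
proof -
  have "(\<Sum>a\<in>A. (inner (mulf f a) a - c q)\<^sup>2 * (inner q a)\<^sup>2) \<le> 2 * K\<^sup>2 * (1 - (\<Sum>b\<in>B. (inner q b)\<^sup>2)) + 2 * \<delta>\<^sup>2"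
    if q: "q \<in> Q" for q
  proof -
    define v1 where "v1 = mulf f (proj_on B q - q)"
    define v2 where "v2 = mulf f q - c q *\<^sub>R q"
    have qq: "inner q q = 1" by (rule orthonormalD(2)[OF onQ q])
    have "(inner (mulf f a) a - c q)\<^sup>2 * (inner q a)\<^sup>2 \<le> 2 * (inner v1 a)\<^sup>2 + 2 * (inner v2 a)\<^sup>2" if a: "a \<in> A" for a
    proof -
      have aB: "a \<in> span B" using span span_base[OF a] by simp
      have "inner (mulf f a) a * inner q a = inner (toeplitz f B a) q" by (simp add: A[OF a] inner_commute)
      also have "\<dots> = inner (mulf f a) (proj_on B q)"
        using inner_toeplitz[OF f(1,2) onB, of a q] by (simp only: proj_on_eq_if_span[OF onB aB])
      also have "\<dots> = inner (mulf f (proj_on B q)) a"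
        using mulf_symmetric[OF f(1,2), of a "proj_on B q"] inner_commute[of a "mulf f (proj_on B q)"] by linarith
      also have "mulf f (proj_on B q) = v1 + mulf f q"
        unfolding v1_def by (simp add: linear_diff[OF linear_mulf[OF f(1,2)]])
      finally have "(inner (mulf f a) a - c q) * inner q a = inner v1 a + inner v2 a"
        by (simp add: v2_def inner_add_left inner_diff_left left_diff_distrib)
      then have "(inner (mulf f a) a - c q)\<^sup>2 * (inner q a)\<^sup>2 = (inner v1 a + inner v2 a)\<^sup>2"
        by (simp add: power_mult_distrib[symmetric])
      also have "\<dots> \<le> 2 * (inner v1 a)\<^sup>2 + 2 * (inner v2 a)\<^sup>2"
        using zero_le_power2[of "inner v1 a - inner v2 a"] by (simp add: power2_eq_square algebra_simps)
      finally show ?thesis .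
    qed
    then have "(\<Sum>a\<in>A. (inner (mulf f a) a - c q)\<^sup>2 * (inner q a)\<^sup>2)
        \<le> (\<Sum>a\<in>A. 2 * (inner v1 a)\<^sup>2 + 2 * (inner v2 a)\<^sup>2)" by (rule sum_mono)
    also have "\<dots> = 2 * (\<Sum>a\<in>A. (inner v1 a)\<^sup>2) + 2 * (\<Sum>a\<in>A. (inner v2 a)\<^sup>2)"
      by (simp add: sum.distrib sum_distrib_left)
    also have "\<dots> \<le> 2 * inner v1 v1 + 2 * inner v2 v2"
      by (intro add_mono mult_left_mono bessel[OF onA]) auto
    also have "inner v1 v1 \<le> K\<^sup>2 * inner (proj_on B q - q) (proj_on B q - q)"
      unfolding v1_def by (rule inner_mulf_mulf_le[OF f(1,2,3)])
    also have "inner (proj_on B q - q) (proj_on B q - q) = 1 - (\<Sum>b\<in>B. (inner q b)\<^sup>2)"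
    proof -
      have "inner (proj_on B q - q) (proj_on B q - q) = inner (q - proj_on B q) (q - proj_on B q)"
        by (simp add: inner_diff)
      then show ?thesis using inner_self_pythagoras[OF onB, of q] qq by linarith
    qed
    also have "inner v2 v2 \<le> \<delta>\<^sup>2 * inner q q"
      unfolding v2_def by (rule inner_mulf_shift_le[OF f(1,2)]) (use c[OF q] \<open>\<delta> \<ge> 0\<close> in auto)
    finally show ?thesis using qq by simp
  qed
  then have "(\<Sum>q\<in>Q. \<Sum>a\<in>A. (inner (mulf f a) a - c q)\<^sup>2 * (inner q a)\<^sup>2)
      \<le> (\<Sum>q\<in>Q. 2 * K\<^sup>2 * (1 - (\<Sum>b\<in>B. (inner q b)\<^sup>2)) + 2 * \<delta>\<^sup>2)" by (rule sum_mono)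
  also have "\<dots> = 2 * K\<^sup>2 * (real (card Q) - (\<Sum>q\<in>Q. \<Sum>b\<in>B. (inner q b)\<^sup>2)) + 2 * \<delta>\<^sup>2 * real (card Q)"
    by (simp add: sum.distrib sum_distrib_left[symmetric] sum_subtractf)
  finally show ?thesis by (subst sum.swap)
qed

lemma continuous_scale:
  fixes g :: "real ^ 2 \<Rightarrow> real"
  assumes "continuous_on sg g" "e > 0"
  shows "\<exists>n0. \<forall>n\<ge>n0. \<forall>x\<in>sg. \<forall>y\<in>sg. dist x y \<le> 1 / 2 ^ n \<longrightarrow> \<bar>g x - g y\<bar> \<le> e"
proof -
  have "uniformly_continuous_on sg g" by (rule compact_uniformly_continuous[OF assms(1) compact_sg])
  then obtain d where d: "d > 0" "\<And>x y. x \<in> sg \<Longrightarrow> y \<in> sg \<Longrightarrow> dist y x < d \<Longrightarrow> dist (g y) (g x) < e"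
    unfolding uniformly_continuous_on_def using assms(2) by blast
  obtain n0 where n0: "1 / 2 ^ n0 < d" using half_power_less[OF d(1)] by blast
  have "\<bar>g x - g y\<bar> \<le> e" if "n \<ge> n0" "x \<in> sg" "y \<in> sg" "dist x y \<le> 1 / 2 ^ n" for n x y
  proof -
    have "(1 :: real) / 2 ^ n \<le> 1 / 2 ^ n0" using that(1) by (simp add: frac_le)
    then have "dist x y < d" using that(4) n0 by linarith
    then have "dist (g x) (g y) < e" using d(2)[OF that(3,2)] by simp
    then show ?thesis by (simp add: dist_real_def)
  qed
  then show ?thesis by blast
qed

lemma szego_limit:
  fixes f :: "real ^ 2 \<Rightarrow> real" and F :: "real \<Rightarrow> real"
  assumes f: "continuous_on sg f" "\<And>x. x \<in> sg \<Longrightarrow> f x > 0"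
    and ev: "\<And>L. L > 0 \<Longrightarrow> eigenvalues_with_multiplicity (compressed_mult f L) (dirichlet_space L) (\<sigma> L)"
    and F: "continuous_on {0..} F" and \<epsilon>: "\<epsilon> > 0"
  shows "\<exists>L0>0. \<forall>L\<ge>L0. \<bar>(\<Sum>k=1..ecount L. F (\<sigma> L k)) - real (ecount L) * (LINT x|sg_measure. F (f x))\<bar>
    \<le> \<epsilon> * real (ecount L)"
proof -
  interpret prob_space sg_measure by (rule prob_space_sg_measure)
  obtain m0 K where mK: "0 < m0" "0 < K" "\<And>x. x \<in> sg \<Longrightarrow> m0 \<le> f x \<and> f x \<le> K"
    using f_bounds[OF f] by metis
  have fK: "f x \<in> {0..K}" if "x \<in> sg" for x using mK(1) mK(3)[OF that] by auto
  have FK: "continuous_on {0..K} F" by (rule continuous_on_subset[OF F]) auto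
  define e where "e = \<epsilon> / 8"
  have e: "e > 0" using \<epsilon> by (simp add: e_def)
  obtain M S where MS: "0 \<le> M" "0 \<le> S" "\<And>x. x \<in> {0..K} \<Longrightarrow> \<bar>F x\<bar> \<le> S"
      "\<And>x y. x \<in> {0..K} \<Longrightarrow> y \<in> {0..K} \<Longrightarrow> \<bar>F x - F y\<bar> \<le> e + M * (x - y)\<^sup>2"
    using uniform_modulus[OF FK e] by blast
  define \<delta> where "\<delta> = sqrt (e / (2 * M + 1))"
  have \<delta>: "\<delta> > 0" using e MS(1) by (simp add: \<delta>_def)
  have M\<delta>: "M * (2 * \<delta>\<^sup>2) \<le> e"
  proof -
    have "\<delta>\<^sup>2 = e / (2 * M + 1)" using e MS(1) by (simp add: \<delta>_def)
    then have "M * (2 * \<delta>\<^sup>2) = e * (2 * M / (2 * M + 1))" by simp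
    also have "\<dots> \<le> e * 1" using e MS(1) by (intro mult_left_mono) auto
    finally show ?thesis by simp
  qed
  define \<phi> where "\<phi> = (\<lambda>x. F (f x))"
  have \<phi>: "continuous_on sg \<phi>"
    unfolding \<phi>_def by (rule continuous_on_compose2[OF F f(1)]) (use f(2) in \<open>auto intro: less_imp_le\<close>)
  obtain n1 where n1: "\<forall>n\<ge>n1. \<forall>x\<in>sg. \<forall>y\<in>sg. dist x y \<le> 1 / 2 ^ n \<longrightarrow> \<bar>f x - f y\<bar> \<le> \<delta>"
    using continuous_scale[OF f(1) \<delta>] by blast
  obtain n2 where n2: "\<forall>n\<ge>n2. \<forall>x\<in>sg. \<forall>y\<in>sg. dist x y \<le> 1 / 2 ^ n \<longrightarrow> \<bar>\<phi> x - \<phi> y\<bar> \<le> e"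
    using continuous_scale[OF \<phi> e] by blast
  define N where "N = max n1 n2"
  have Nf: "\<bar>f x - f y\<bar> \<le> \<delta>" and N\<phi>: "\<bar>\<phi> x - \<phi> y\<bar> \<le> e" if "x \<in> sg" "y \<in> sg" "dist x y \<le> 1 / 2 ^ N" for x y
    using n1[rule_format, of N x y] n2[rule_format, of N x y] that by (simp_all add: N_def)
  define R where "R = M * (2 * K\<^sup>2) + 3 * S"
  have R: "R \<ge> 0" using MS(1,2) by (simp add: R_def)
  define \<eta> where "\<eta> = e / (R + 1)"
  have \<eta>: "\<eta> > 0" "R * \<eta> \<le> e"
  proof -
    show "\<eta> > 0" using e R by (simp add: \<eta>_def)
    have "R * \<eta> = e * (R / (R + 1))" by (simp add: \<eta>_def)
    also have "\<dots> \<le> e * 1" using e R by (intro mult_left_mono) auto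
    finally show "R * \<eta> \<le> e" by simp
  qed
  obtain L0 where L0: "L0 > 0" "\<And>L Q. L \<ge> L0 \<Longrightarrow> spectral_family (loc N) (1 / L) Q \<Longrightarrow>
      (\<Sum>b\<in>spec_basis L. 1 - (\<Sum>q\<in>Q. (inner q b)\<^sup>2)) \<le> \<eta> * real (ecount L)"
    using projection_deficit[OF \<eta>(1), of N] by blast
  have int: "\<bar>LINT x|sg_measure. \<phi> x\<bar> \<le> S"
  proof -
    have "(LINT x|sg_measure. \<phi> x) \<le> (LINT x|sg_measure. S)"
      using MS(3)[OF fK] by (intro integral_mono integrable_sg \<phi>) (auto simp: \<phi>_def abs_le_iff)
    moreover have "(LINT x|sg_measure. - S) \<le> (LINT x|sg_measure. \<phi> x)"
      using MS(3)[OF fK] by (intro integral_mono integrable_sg \<phi>) (force simp: \<phi>_def abs_le_iff)+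
    ultimately show ?thesis by (simp add: prob_space[unfolded space_sg_measure])
  qed
  have "\<bar>(\<Sum>k=1..ecount L. F (\<sigma> L k)) - real (ecount L) * (LINT x|sg_measure. \<phi> x)\<bar> \<le> \<epsilon> * real (ecount L)"
    if LL0: "L \<ge> L0" for L
  proof -
    have L: "L > 0" using L0(1) LL0 by simp
    define B where "B = spec_basis L"
    have onB: "orthonormal B" unfolding B_def by (rule spec_basis_props(2)[OF L])
    define d where "d = real (ecount L)"
    have cB: "real (card B) = d" by (simp add: B_def d_def ecount_def)
    have "\<exists>A. orthonormal A \<and> span A = span B \<and> card A = card B \<and>
        (\<forall>a\<in>A. toeplitz f B a = inner (mulf f a) a *\<^sub>R a \<and> inner (toeplitz f B a) a = inner (mulf f a) a)"
      by (rule toeplitz_eigenbasis[OF f onB mK(1)]) (simp_all add: mK(3))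
    then obtain A where A: "orthonormal A" "span A = span B" "card A = card B"
      "\<And>a. a \<in> A \<Longrightarrow> toeplitz f B a = inner (mulf f a) a *\<^sub>R a" by blast
    define B' where "B' = spec_basis (L / 5 ^ N)"
    have L': "L / 5 ^ N > 0" using L by simp
    have sfB': "spectral_family green (1 / (L / 5 ^ N)) B'" unfolding B'_def by (rule spec_basis[OF L'])
    have \<kappa>': "1 / (L / 5 ^ N) > 0" using L by simp
    define Q where "Q = qfam N B'"
    have sfQ: "spectral_family (loc N) (1 / L) Q" and cQ: "card Q = 3 ^ N * ecount (L / 5 ^ N)"
      unfolding Q_def B'_def using ecount_scaled_family[OF L] by blast+
    have onQ: "orthonormal Q" using sfQ by (simp add: spectral_family_def eigen_family_def)
    have cQA: "card Q \<le> card A"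
      using ecount_bracket(1)[OF L, of N] unfolding cQ A(3) B_def ecount_def by simp
    define pt where "pt = (\<lambda>q. SOME x. x \<in> sg \<and> val q x \<noteq> 0)"
    have pt: "pt q \<in> sg \<and> val q (pt q) \<noteq> 0" if "q \<in> Q" for q
    proof -
      have "\<exists>x. x \<in> sg \<and> val q x \<noteq> 0"
      proof (rule ccontr)
        assume "\<not> ?thesis"
        then have "q = 0" by (intro sgfun_eqI) (auto simp: val_simps)
        then show False using orthonormal_nonzero[OF onQ that] by simp
      qed
      from someI_ex[OF this] show ?thesis unfolding pt_def .
    qed
    define c where "c = (\<lambda>q. f (pt q))"
    have cK: "c q \<in> {0..K}" if "q \<in> Q" for q unfolding c_def using fK pt[OF that] by blast
    have c\<delta>: "\<bar>f x - c q\<bar> \<le> \<delta>" if "q \<in> Q" "x \<in> sg" "val q x \<noteq> 0" for q x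
      unfolding c_def
      using Nf[OF that(2)] pt[OF that(1)] qfam_support[OF sfB' \<kappa>' that(1)[unfolded Q_def] that(2) _ that(3)] by blast
    define x where "x = (\<lambda>a. inner (mulf f a) a)"
    have xK: "x a \<in> {0..K}" if "a \<in> A" for a
    proof -
      have "m0 * inner a a \<le> x a" unfolding x_def by (rule inner_mulf_lower[OF f]) (simp_all add: mK(3))
      moreover have "x a \<le> K * inner a a" unfolding x_def by (rule inner_mulf_upper[OF f]) (simp_all add: mK(3))
      ultimately show ?thesis using mK(1) orthonormalD(2)[OF A(1) that] by simp
    qed
    define w :: "sgfun \<Rightarrow> sgfun \<Rightarrow> real" where "w = (\<lambda>a q. (inner q a)\<^sup>2)"
    have colA: "(\<Sum>a\<in>A. w a q) = (\<Sum>b\<in>B. w b q)" for q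
      unfolding w_def inner_proj_on_self[OF A(1), symmetric] inner_proj_on_self[OF onB, symmetric]
        proj_on_eq_if_span_eq[OF A(1) onB A(2)] ..
    define W where "W = (\<Sum>b\<in>B. \<Sum>q\<in>Q. w b q)"
    have WA: "(\<Sum>a\<in>A. \<Sum>q\<in>Q. w a q) = W"
      unfolding W_def by (subst (1 2) sum.swap) (simp only: colA)
    have \<theta>: "d - W \<le> \<eta> * d"
      using L0(2)[OF LL0 sfQ] by (simp add: W_def w_def B_def[symmetric] sum_subtractf cB d_def[symmetric])
    have row: "(\<Sum>q\<in>Q. w a q) \<le> 1" if "a \<in> A" for a
    proof -
      have "(\<Sum>q\<in>Q. (inner a q)\<^sup>2) \<le> inner a a" by (rule bessel[OF onQ])
      then show ?thesis unfolding w_def orthonormalD(2)[OF A(1) that] by (simp add: inner_commute)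
    qed
    have col: "(\<Sum>a\<in>A. w a q) \<le> 1" if "q \<in> Q" for q
      using bessel[OF A(1), of q] orthonormalD(2)[OF onQ that] by (simp add: w_def)
    have WQ: "W \<le> real (card Q)"
    proof -
      have "W = (\<Sum>q\<in>Q. \<Sum>a\<in>A. w a q)" unfolding WA[symmetric] by (rule sum.swap)
      also have "\<dots> \<le> real (card Q) * 1" by (rule sum_bounded_above) (rule col)
      finally show ?thesis by simp
    qed
    have rd: "real (card Q) \<le> d" using cQA A(3) cB by linarith
    define V where "V = 2 * K\<^sup>2 * (d - W) + 2 * \<delta>\<^sup>2 * d"
    have var: "(\<Sum>a\<in>A. \<Sum>q\<in>Q. (x a - c q)\<^sup>2 * w a q) \<le> V"
    proof -
      have "(\<Sum>a\<in>A. \<Sum>q\<in>Q. (x a - c q)\<^sup>2 * w a q)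
          \<le> 2 * K\<^sup>2 * (real (card Q) - (\<Sum>q\<in>Q. \<Sum>b\<in>B. (inner q b)\<^sup>2)) + 2 * \<delta>\<^sup>2 * real (card Q)"
        unfolding x_def w_def
        by (rule toeplitz_variance[OF f _ onB A(1,2) onQ A(4) c\<delta> less_imp_le[OF \<delta>]]) (use mK(3) in auto)
      also have "(\<Sum>q\<in>Q. \<Sum>b\<in>B. (inner q b)\<^sup>2) = W" unfolding W_def w_def by (rule sum.swap)
      also have "2 * K\<^sup>2 * (real (card Q) - W) + 2 * \<delta>\<^sup>2 * real (card Q) \<le> V"
        unfolding V_def using rd by (intro add_mono mult_left_mono) auto
      finally show ?thesis .
    qed
    have comp: "\<bar>(\<Sum>a\<in>A. F (x a)) - (\<Sum>q\<in>Q. F (c q))\<bar> \<le> e * real (card A) + M * V + 2 * S * (d - W)"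
    proof (rule weighted_comparison[where w = w and F = F and x = x and y = c and S = S])
      show "finite A" "finite Q" using A(1) onQ by (simp_all add: orthonormal_def)
      show "real (card A) - (\<Sum>a\<in>A. \<Sum>q\<in>Q. w a q) \<le> d - W" unfolding WA A(3) cB by simp
      show "\<bar>F (x a) - F (c q)\<bar> \<le> e + M * (x a - c q)\<^sup>2" if "a \<in> A" "q \<in> Q" for a q
        by (rule MS(4)[OF xK[OF that(1)] cK[OF that(2)]])
    qed (use row col cQA var MS(1-3) xK cK e in \<open>auto simp: w_def\<close>)
    have eq: "\<bar>(\<Sum>q\<in>Q. \<phi> (pt q)) - real (card Q) * (LINT x|sg_measure. \<phi> x)\<bar> \<le> real (card Q) * e"
      unfolding Q_def by (rule qfam_equidistribution[OF sfB' \<kappa>' \<phi> N\<phi>]) (use pt Q_def in auto)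
    have "(\<Sum>k=1..ecount L. F (\<sigma> L k)) = (\<Sum>a\<in>A. F (x a))"
      unfolding x_def
      by (rule sum_eigenvalues(1)[OF f L ev[OF L] A(1)]) (use A(2,3,4) in \<open>simp_all add: B_def\<close>)
    moreover have "(\<Sum>q\<in>Q. F (c q)) = (\<Sum>q\<in>Q. \<phi> (pt q))" by (simp add: c_def \<phi>_def)
    moreover have "\<bar>real (card Q) * (LINT x|sg_measure. \<phi> x) - d * (LINT x|sg_measure. \<phi> x)\<bar> \<le> S * (d - W)"
    proof -
      have "\<bar>real (card Q) * (LINT x|sg_measure. \<phi> x) - d * (LINT x|sg_measure. \<phi> x)\<bar>
          = (d - real (card Q)) * \<bar>LINT x|sg_measure. \<phi> x\<bar>"
        using rd unfolding left_diff_distrib[symmetric] abs_mult by simp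
      also have "\<dots> \<le> (d - W) * S" using int rd WQ by (intro mult_mono) auto
      finally show ?thesis by (simp add: mult.commute)
    qed
    moreover have "real (card Q) * e \<le> e * d" using rd e by (simp add: mult.commute)
    moreover have "M * V = M * (2 * K\<^sup>2) * (d - W) + M * (2 * \<delta>\<^sup>2) * d"
      by (simp add: V_def algebra_simps)
    moreover have "M * (2 * \<delta>\<^sup>2) * d \<le> e * d" using M\<delta> by (intro mult_right_mono) (auto simp: d_def)
    moreover have "R * (d - W) \<le> e * d"
    proof -
      have "R * (d - W) \<le> R * (\<eta> * d)" by (rule mult_left_mono[OF \<theta> R])
      also have "\<dots> = (R * \<eta>) * d" by simp
      also have "\<dots> \<le> e * d" using \<eta>(2) by (intro mult_right_mono) (auto simp: d_def)
      finally show ?thesis .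
    qed
    moreover have "R * (d - W) = M * (2 * K\<^sup>2) * (d - W) + 2 * S * (d - W) + S * (d - W)"
      by (simp add: R_def algebra_simps)
    moreover have "e * real (card A) = e * d" using A(3) cB by simp
    ultimately have "\<bar>(\<Sum>k=1..ecount L. F (\<sigma> L k)) - d * (LINT x|sg_measure. \<phi> x)\<bar> \<le> 4 * (e * d)"
      using comp eq by linarith
    also have "4 * (e * d) \<le> \<epsilon> * d" using \<epsilon> by (simp add: e_def d_def)
    finally show ?thesis by (simp add: d_def)
  qed
  then show ?thesis using L0(1) unfolding \<phi>_def by blast
qed

lemma Linf_norm_sg:
  assumes f: "continuous_on sg f" "\<And>x. x \<in> sg \<Longrightarrow> f x > 0" and K: "\<And>x. x \<in> sg \<Longrightarrow> f x \<le> K" "x0 \<in> sg" "f x0 = K"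
  shows "Linf_norm sg_measure f = K"
proof -
  define E where "E = esssup sg_measure (\<lambda>x. ereal \<bar>f x\<bar>)"
  have meas: "(\<lambda>x. ereal \<bar>f x\<bar>) \<in> borel_measurable sg_measure"
    using measurable_sg_continuous[OF f(1)] by measurable
  have "E \<le> ereal K"
    unfolding E_def using f(2) K(1) by (intro esssup_I meas AE_I2) (auto simp: less_imp_le)
  moreover have "ereal K \<le> E"
  proof (rule ccontr)
    assume "\<not> ereal K \<le> E"
    then obtain c where c: "E < ereal c" "ereal c < ereal K" using ereal_dense2[of E "ereal K"] by (auto simp: not_le)
    have ae: "AE x in sg_measure. ereal \<bar>f x\<bar> \<le> E" unfolding E_def by (rule esssup_AE)
    define g where "g = (\<lambda>x. max 0 (f x - c))"
    have g: "continuous_on sg g" unfolding g_def by (intro continuous_intros f(1))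
    have "AE x in sg_measure. g x = 0"
      using ae
    proof (rule AE_mp, intro AE_I2 impI)
      fix x assume "ereal \<bar>f x\<bar> \<le> E"
      then have "ereal \<bar>f x\<bar> < ereal c" using c(1) by (rule le_less_trans)
      then show "g x = 0" by (simp add: g_def)
    qed
    then have "(LINT x|sg_measure. g x) = 0" by (rule integral_eq_zero_AE)
    then have "g x0 = 0" by (intro integral_sg_eq_0_imp[OF g _ _ K(2)]) (simp_all add: g_def)
    then show False using c(2) K(3) by (simp add: g_def)
  qed
  ultimately show ?thesis unfolding Linf_norm_def E_def[symmetric] by (simp add: antisym)
qed

theorem theorem4:
  fixes f :: "real ^ 2 \<Rightarrow> real" and F :: "real \<Rightarrow> real" and \<sigma> :: "real \<Rightarrow> nat \<Rightarrow> real"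
    and d :: "real \<Rightarrow> nat"
  defines "d \<equiv> \<lambda>\<Lambda>. dim (dirichlet_space \<Lambda>)"
  assumes "continuous_on sg f" and "\<And>x. x \<in> sg \<Longrightarrow> f x > 0"
    and "\<And>\<Lambda>. \<Lambda> > 0 \<Longrightarrow>
           eigenvalues_with_multiplicity (compressed_mult f \<Lambda>) (dirichlet_space \<Lambda>) (\<sigma> \<Lambda>)"
    and "continuous_on {0..} F"
  shows "((\<lambda>\<Lambda>. 1 / real (d \<Lambda>) * (\<Sum>k=1..d \<Lambda>. F (\<sigma> \<Lambda> k)))
            \<longlongrightarrow> (LINT x|sg_measure. F (f x))) at_top \<and>
         (\<exists>s. (\<forall>\<Lambda>>0. \<forall>k\<in>{1..d \<Lambda>}. s \<Lambda> k \<in> sg) \<and>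
              almost_equally_distributed {0..Linf_norm sg_measure f} d \<sigma> (\<lambda>\<Lambda> k. f (s \<Lambda> k)))"
proof
  note f = assms(2,3) and ev = assms(4)
  have d: "d L = ecount L" if "L > 0" for L by (simp add: d_def dim_dirichlet_space[OF that])
  show "((\<lambda>\<Lambda>. 1 / real (d \<Lambda>) * (\<Sum>k=1..d \<Lambda>. F (\<sigma> \<Lambda> k))) \<longlongrightarrow> (LINT x|sg_measure. F (f x))) at_top"
  proof (rule tendstoI)
    fix \<epsilon> :: real assume \<epsilon>: "\<epsilon> > 0"
    let ?I = "LINT x|sg_measure. F (f x)"
    obtain L1 where L1: "L1 > 0" "\<And>L. L \<ge> L1 \<Longrightarrow>
        \<bar>(\<Sum>k=1..ecount L. F (\<sigma> L k)) - real (ecount L) * ?I\<bar> \<le> \<epsilon> / 2 * real (ecount L)"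
      using szego_limit[OF f ev assms(5) half_gt_zero[OF \<epsilon>]] by blast
    obtain L2 where L2: "L2 > 0" "\<And>L. L \<ge> L2 \<Longrightarrow> real (ecount L) \<ge> 1" using ecount_at_top[of 1] by blast
    show "\<forall>\<^sub>F L in at_top. dist (1 / real (d L) * (\<Sum>k=1..d L. F (\<sigma> L k))) ?I < \<epsilon>"
      unfolding eventually_at_top_linorder
    proof (intro exI[of _ "max L1 L2"] allI impI)
      fix L assume "L \<ge> max L1 L2"
      then have L: "L > 0" "L \<ge> L1" "L \<ge> L2" using L1(1) by auto
      define n where "n = real (ecount L)"
      have n: "n > 0" using L2(2)[OF L(3)] by (simp add: n_def)
      have "1 / n * (\<Sum>k=1..ecount L. F (\<sigma> L k)) - ?I = ((\<Sum>k=1..ecount L. F (\<sigma> L k)) - n * ?I) / n"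
        using n by (simp add: field_simps)
      then have "\<bar>1 / n * (\<Sum>k=1..ecount L. F (\<sigma> L k)) - ?I\<bar> = \<bar>(\<Sum>k=1..ecount L. F (\<sigma> L k)) - n * ?I\<bar> / n"
        using n by simp
      also have "\<dots> \<le> (\<epsilon> / 2 * n) / n" using L1(2)[OF L(2)] n by (intro divide_right_mono) (auto simp: n_def)
      also have "\<dots> < \<epsilon>" using n \<epsilon> by simp
      finally show "dist (1 / real (d L) * (\<Sum>k=1..d L. F (\<sigma> L k))) ?I < \<epsilon>"
        by (simp add: dist_real_def d[OF L(1)] n_def)
    qed
  qed
  obtain m0 K where mK: "0 < m0" "0 < K" "\<And>x. x \<in> sg \<Longrightarrow> m0 \<le> f x \<and> f x \<le> K"
      "\<exists>x\<in>sg. f x = m0" "\<exists>x\<in>sg. f x = K"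
    using f_bounds[OF f] by metis
  have fK: "f x \<le> K" if "x \<in> sg" for x using mK(3)[OF that] by simp
  obtain x0 where x0: "x0 \<in> sg" "f x0 = K" using mK(5) by blast
  have Linf: "Linf_norm sg_measure f = K" by (rule Linf_norm_sg[OF f fK x0])
  have \<sigma>: "\<exists>x\<in>sg. f x = \<sigma> L k" if L: "L > 0" and k: "k \<in> {1..d L}" for L k
  proof -
    have onB: "orthonormal (spec_basis L)" by (rule spec_basis_props(2)[OF L])
    have "\<exists>A. orthonormal A \<and> span A = span (spec_basis L) \<and> card A = card (spec_basis L) \<and>
        (\<forall>a\<in>A. toeplitz f (spec_basis L) a = inner (mulf f a) a *\<^sub>R a \<and>
          inner (toeplitz f (spec_basis L) a) a = inner (mulf f a) a)"
      by (rule toeplitz_eigenbasis[OF f onB mK(1)]) (simp_all add: mK(3))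
    then obtain A where A: "orthonormal A" "span A = span (spec_basis L)" "card A = card (spec_basis L)"
      "\<And>a. a \<in> A \<Longrightarrow> toeplitz f (spec_basis L) a = inner (mulf f a) a *\<^sub>R a" by blast
    obtain a where a: "a \<in> A" "\<sigma> L k = inner (mulf f a) a"
      using sum_eigenvalues(2)[OF f L ev[OF L] A] k d[OF L] by auto
    have "m0 * inner a a \<le> \<sigma> L k" unfolding a(2) by (rule inner_mulf_lower[OF f]) (simp_all add: mK(3))
    moreover have "\<sigma> L k \<le> K * inner a a" unfolding a(2) by (rule inner_mulf_upper[OF f]) (simp_all add: mK(3))
    ultimately have "\<sigma> L k \<in> {m0..K}" using orthonormalD(2)[OF A(1) a(1)] by simp
    moreover have "{m0..K} \<subseteq> f ` sg"
      using mK(4,5) by (intro connected_contains_Icc connected_continuous_image f(1) connected_sg) auto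
    ultimately show ?thesis by (metis imageE subsetD)
  qed
  define s where "s = (\<lambda>L k. SOME x. x \<in> sg \<and> f x = \<sigma> L k)"
  have s: "s L k \<in> sg \<and> f (s L k) = \<sigma> L k" if "L > 0" "k \<in> {1..d L}" for L k
    using someI_ex[of "\<lambda>x. x \<in> sg \<and> f x = \<sigma> L k"] \<sigma>[OF that] unfolding s_def by blast
  show "\<exists>s. (\<forall>\<Lambda>>0. \<forall>k\<in>{1..d \<Lambda>}. s \<Lambda> k \<in> sg) \<and>
      almost_equally_distributed {0..Linf_norm sg_measure f} d \<sigma> (\<lambda>\<Lambda> k. f (s \<Lambda> k))"
  proof (intro exI[of _ s] conjI allI impI ballI)
    show "s L k \<in> sg" if "L > 0" "k \<in> {1..d L}" for L k using s[OF that] by blast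
    show "almost_equally_distributed {0..Linf_norm sg_measure f} d \<sigma> (\<lambda>\<Lambda> k. f (s \<Lambda> k))"
      unfolding almost_equally_distributed_def Linf
    proof (intro conjI allI impI ballI)
      fix L :: real and k assume Lk: "L > 0" "k \<in> {1..d L}"
      have "f (s L k) \<in> {0..K}" using mK(1) mK(3)[of "s L k"] s[OF Lk] by auto
      then show "f (s L k) \<in> {0..K}" "\<sigma> L k \<in> {0..K}" using s[OF Lk] by auto
    next
      fix G :: "real \<Rightarrow> real"
      have "\<forall>\<^sub>F L in at_top. 1 / real (d L) * (\<Sum>k=1..d L. G (\<sigma> L k) - G (f (s L k))) = 0"
        using eventually_gt_at_top[of "0 :: real"]
      proof eventually_elim
        case (elim L)
        then have "(\<Sum>k=1..d L. G (\<sigma> L k) - G (f (s L k))) = 0" using s by (intro sum.neutral) auto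
        then show ?case by simp
      qed
      then show "((\<lambda>L. 1 / real (d L) * (\<Sum>k=1..d L. G (\<sigma> L k) - G (f (s L k)))) \<longlongrightarrow> 0) at_top"
        by (rule tendsto_eventually)
    qed
  qed
qed

end
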